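(* Let $k$ be an even integer, $f=\sum_{n\ge1}a_f(n)e(n\tau)\in S_k^1$ a cusp form of weight $k$ on $\mathrm{SL}(2,\mathbf Z)$, $m\ge1$, and write $m=ab^2$ with $a$ square-free and $b\ge1$. Let $\mathcal E_{k,m}$ be the Eisenstein part of the $m$-th Fourier-Jacobi coefficient of the Klingen Eisenstein series $E_{2,1}(f)$. Then $$\mathcal E_{k,m}=\sum_{1\le\lambda\le b,\ \lambda\mid b}a_f(a\lambda^2)\sum_{1\le d\le b,\ d\lambda\mid b}\mu(d)\,E_{k,a\lambda^2d^2}\mid U_{\frac b{\lambda d}}.$$
   Context: $e(x)=e^{2\pi ix}$; $J_{k,m}$ is the space of Jacobi forms of weight $k$ and index $m$ on $\Gamma^J=\mathrm{SL}(2,\mathbf Z)\ltimes\mathbf Z^2$. Klingen Eisenstein series: $E_{2,1}(f)(Z)=\sum_{g\in C_{2,1}\backslash\mathrm{Sp}(2,\mathbf Z)}f(g\langle Z\rangle^* )\det(CZ+D)^{-k}$, $g=\begin{pmatrix} A & B \\ C & D \end{pmatrix}$, $g\langle Z\rangle=(AZ+B)(CZ+D)^{-1}$, where $C_{2,1}$ consists of the $g$ with last row $(0,0,0,* )$ and $Z^*$ is the upper left entry of $Z$. With $Z=\begin{pmatrix} \tau & z \\ z & \tau' \end{pmatrix}$, write $E_{2,1}(f)(Z)=\sum_{m\ge0}\phi_m(\tau,z)e(m\tau')$; for $m\ge1$, $\phi_m=\mathcal E_{k,m}+\phi_m^\circ$ with $\mathcal E_{k,m}\in J^{\mathrm{Eis}}_{k,m}$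 (span of Jacobi Eisenstein series) and $\phi_m^\circ$ a Jacobi cusp form. $E_{k,m}(\tau,z)=\tfrac12\sum_{\gamma\in\Gamma^J_\infty\backslash\Gamma^J}1|_{k,m}\gamma$ is the Jacobi Eisenstein series of weight $k$ and index $m$ (attached to the cusp $\infty$), where $\Gamma_\infty^J=\{(\begin{pmatrix} 1 & n \\ 0 & 1 \end{pmatrix},[0,\mu])\}$ and $(\phi|_{k,m}\gamma)(\tau,z)=(c\tau+d)^{-k}e\big(m(-\tfrac{c(z+\lambda\tau+\mu)^2}{c\tau+d}+\lambda^2\tau+2\lambda z)\big)\phi\big(\tfrac{a\tau+b}{c\tau+d},\tfrac{z+\lambda\tau+\mu}{c\tau+d}\big)$ for $\gamma=(\begin{pmatrix} a & b \\ c & d \end{pmatrix},[\lambda,\mu])$. For $l\ge1$, $U_l:J_{k,m}\to J_{k,ml^2}$ is $(\phi|U_l)(\tau,z)=\phi(\tau,lz)$. $\mu(d)$ is the Möbius function. *)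

theory Defs
  imports "HOL-Analysis.Analysis" "HOL-Computational_Algebra.Squarefree"
begin

definition ee :: "complex \<Rightarrow> complex" where
  "ee x = exp (2 * complex_of_real pi * \<i> * x)"

definition moebius_mu :: "nat \<Rightarrow> int" where
  "moebius_mu n = (if squarefree n then (- 1) ^ card (prime_factors n) else 0)"

text \<open>
  The sum of \<open>t g\<close> over the right cosets \<open>H g\<close> in \<open>H \ G\<close>, where \<open>mul\<close> is the group
  multiplication. One representative is taken from each coset, so the value is meaningful only
  if \<open>t (h g) = t g\<close> for all \<open>h \<in> H\<close>.
\<close>
definition coset_sum ::
  "('g \<Rightarrow> 'g \<Rightarrow> 'g) \<Rightarrow> 'g set \<Rightarrow> 'g set \<Rightarrow> ('g \<Rightarrow> complex) \<Rightarrow> complex" where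
  "coset_sum mul H G t = (\<Sum>\<^sub>\<infinity>X\<in>(\<lambda>g. (\<lambda>h. mul h g) ` H) ` G. t (SOME g. g \<in> X))"


section \<open>Elliptic cusp forms\<close>

definition SL2Z :: "(int^2^2) set" where
  "SL2Z = {M. det M = 1}"

definition cusp_expansion :: "(complex \<Rightarrow> complex) \<Rightarrow> (nat \<Rightarrow> complex) \<Rightarrow> bool" where
  "cusp_expansion f a \<longleftrightarrow>
     (\<forall>\<tau>. Im \<tau> > 0 \<longrightarrow> ((\<lambda>n. a n * ee (of_nat n * \<tau>)) has_sum f \<tau>) {1..})"

text \<open>
  Functions on the upper half plane are rendered as total functions; their values elsewhere are
  irrelevant. The same applies below to functions on other domains.
\<close>
definition cusp_forms :: "int \<Rightarrow> (complex \<Rightarrow> complex) set" where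
  "cusp_forms k = {f.
     f holomorphic_on {\<tau>. Im \<tau> > 0} \<and>
     (\<forall>M\<in>SL2Z. \<forall>\<tau>. Im \<tau> > 0 \<longrightarrow>
        f ((of_int (M$1$1) * \<tau> + of_int (M$1$2)) / (of_int (M$2$1) * \<tau> + of_int (M$2$2)))
          = (of_int (M$2$1) * \<tau> + of_int (M$2$2)) powi k * f \<tau>) \<and>
     (\<exists>a. cusp_expansion f a)}"


section \<open>The Klingen Eisenstein series of degree two\<close>

text \<open>
  A matrix of size four is indexed by the sum type \<^typ>\<open>2 + 2\<close>, so that its four blocks
  of size two are selected by \<^const>\<open>Inl\<close> and \<^const>\<open>Inr\<close>.
\<close>

definition blockA :: "int^(2+2)^(2+2) \<Rightarrow> complex^2^2" where
  "blockA g = (\<chi> i j. of_int (g $ Inl i $ Inl j))"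

definition blockB :: "int^(2+2)^(2+2) \<Rightarrow> complex^2^2" where
  "blockB g = (\<chi> i j. of_int (g $ Inl i $ Inr j))"

definition blockC :: "int^(2+2)^(2+2) \<Rightarrow> complex^2^2" where
  "blockC g = (\<chi> i j. of_int (g $ Inr i $ Inl j))"

definition blockD :: "int^(2+2)^(2+2) \<Rightarrow> complex^2^2" where
  "blockD g = (\<chi> i j. of_int (g $ Inr i $ Inr j))"

definition symp_unit :: "int^(2+2)^(2+2)" where
  "symp_unit = (\<chi> i j. case (i, j) of
      (Inl p, Inr q) \<Rightarrow> (if p = q then 1 else 0)
    | (Inr p, Inl q) \<Rightarrow> (if p = q then - 1 else 0)
    | _ \<Rightarrow> 0)"

definition Sp2Z :: "(int^(2+2)^(2+2)) set" where
  "Sp2Z = {g. transpose g ** symp_unit ** g = symp_unit}"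

definition C21 :: "(int^(2+2)^(2+2)) set" where
  "C21 = {g \<in> Sp2Z. g $ Inr 2 $ Inl 1 = 0 \<and> g $ Inr 2 $ Inl 2 = 0 \<and> g $ Inr 2 $ Inr 1 = 0}"

definition siegel_half_space :: "(complex^2^2) set" where
  "siegel_half_space = {Z. transpose Z = Z \<and>
     (\<forall>x::real^2. x \<noteq> 0 \<longrightarrow> x \<bullet> ((\<chi> i j. Im (Z $ i $ j)) *v x) > 0)}"

definition sp_act :: "int^(2+2)^(2+2) \<Rightarrow> complex^2^2 \<Rightarrow> complex^2^2" where
  "sp_act g Z = (blockA g ** Z + blockB g) ** matrix_inv (blockC g ** Z + blockD g)"

definition klingen_eisenstein :: "int \<Rightarrow> (complex \<Rightarrow> complex) \<Rightarrow> complex^2^2 \<Rightarrow> complex" where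
  "klingen_eisenstein k f Z = coset_sum (**) C21 Sp2Z
     (\<lambda>g. f (sp_act g Z $ 1 $ 1) * det (blockC g ** Z + blockD g) powi (- k))"

definition siegel_point :: "complex \<Rightarrow> complex \<Rightarrow> complex \<Rightarrow> complex^2^2" where
  "siegel_point \<tau> z \<tau>' = vector [vector [\<tau>, z], vector [z, \<tau>']]"

definition fourier_jacobi_expansion ::
  "(complex^2^2 \<Rightarrow> complex) \<Rightarrow> (nat \<Rightarrow> complex \<Rightarrow> complex \<Rightarrow> complex) \<Rightarrow> bool" where
  "fourier_jacobi_expansion F \<phi> \<longleftrightarrow>
     (\<forall>\<tau> z \<tau>'. siegel_point \<tau> z \<tau>' \<in> siegel_half_space \<longrightarrow>
        ((\<lambda>m. \<phi> m \<tau> z * ee (of_nat m * \<tau>')) has_sum F (siegel_point \<tau> z \<tau>')) UNIV)"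


section \<open>Jacobi forms\<close>

text \<open>
  An element \<open>(M, X)\<close> with \<open>X = [\<lambda>, \<mu>]\<close> is the product of \<open>M\<close> and \<open>X\<close> in this order, so
  that the multiplication is \<open>(M, X) (M', X') = (M M', X M' + X')\<close>. With this convention
  \<open>slash k m\<close> below is a right action.
\<close>
definition jacobi_group :: "((int^2^2) \<times> (int^2)) set" where
  "jacobi_group = SL2Z \<times> UNIV"

definition jacobi_mult ::
  "(int^2^2) \<times> (int^2) \<Rightarrow> (int^2^2) \<times> (int^2) \<Rightarrow> (int^2^2) \<times> (int^2)" where
  "jacobi_mult g h = (fst g ** fst h, snd g v* fst h + snd h)"

definition jacobi_group_inf :: "((int^2^2) \<times> (int^2)) set" where
  "jacobi_group_inf = {(vector [vector [1, n], vector [0, 1]], vector [0, \<mu>]) | n \<mu>. True}"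

definition slash ::
  "int \<Rightarrow> nat \<Rightarrow> (int^2^2) \<times> (int^2) \<Rightarrow> (complex \<Rightarrow> complex \<Rightarrow> complex)
     \<Rightarrow> complex \<Rightarrow> complex \<Rightarrow> complex" where
  "slash k m \<gamma> \<phi> \<tau> z =
     (let a = of_int (fst \<gamma> $ 1 $ 1); b = of_int (fst \<gamma> $ 1 $ 2);
          c = of_int (fst \<gamma> $ 2 $ 1); d = of_int (fst \<gamma> $ 2 $ 2);
          l = of_int (snd \<gamma> $ 1); \<mu> = of_int (snd \<gamma> $ 2)
      in (c * \<tau> + d) powi (- k)
         * ee (of_nat m * (- (c * (z + l * \<tau> + \<mu>)^2 / (c * \<tau> + d)) + l^2 * \<tau> + 2 * l * z))
         * \<phi> ((a * \<tau> + b) / (c * \<tau> + d)) ((z + l * \<tau> + \<mu>) / (c * \<tau> + d)))"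

definition jacobi_expansion ::
  "(complex \<Rightarrow> complex \<Rightarrow> complex) \<Rightarrow> (int \<Rightarrow> int \<Rightarrow> complex) \<Rightarrow> bool" where
  "jacobi_expansion \<phi> c \<longleftrightarrow> (\<forall>\<tau> z. Im \<tau> > 0 \<longrightarrow>
     ((\<lambda>(n, r). c n r * ee (of_int n * \<tau> + of_int r * z)) has_sum \<phi> \<tau> z) UNIV)"

text \<open>
  The first condition is holomorphy in two variables: the real derivative exists everywhere and
  is complex linear.
\<close>
definition jacobi_forms :: "int \<Rightarrow> nat \<Rightarrow> (complex \<Rightarrow> complex \<Rightarrow> complex) set" where
  "jacobi_forms k m = {\<phi>.
     (\<forall>\<tau> z. Im \<tau> > 0 \<longrightarrow>
        (\<exists>p q. ((\<lambda>(u, w). \<phi> u w) has_derivative (\<lambda>(u, w). p * u + q * w)) (at (\<tau>, z)))) \<and>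
     (\<forall>\<gamma>\<in>jacobi_group. \<forall>\<tau> z. Im \<tau> > 0 \<longrightarrow> slash k m \<gamma> \<phi> \<tau> z = \<phi> \<tau> z) \<and>
     (\<exists>c. jacobi_expansion \<phi> c \<and> (\<forall>n r. c n r \<noteq> 0 \<longrightarrow> r^2 \<le> 4 * n * int m))}"

definition jacobi_cusp_forms :: "int \<Rightarrow> nat \<Rightarrow> (complex \<Rightarrow> complex \<Rightarrow> complex) set" where
  "jacobi_cusp_forms k m = {\<phi> \<in> jacobi_forms k m.
     \<exists>c. jacobi_expansion \<phi> c \<and> (\<forall>n r. c n r \<noteq> 0 \<longrightarrow> r^2 < 4 * n * int m)}"

definition jacobi_average ::
  "int \<Rightarrow> nat \<Rightarrow> (complex \<Rightarrow> complex \<Rightarrow> complex) \<Rightarrow> complex \<Rightarrow> complex \<Rightarrow> complex" where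
  "jacobi_average k m \<psi> \<tau> z =
     1 / 2 * coset_sum jacobi_mult jacobi_group_inf jacobi_group (\<lambda>\<gamma>. slash k m \<gamma> \<psi> \<tau> z)"

definition jacobi_eisenstein :: "int \<Rightarrow> nat \<Rightarrow> complex \<Rightarrow> complex \<Rightarrow> complex" where
  "jacobi_eisenstein k m = jacobi_average k m (\<lambda>\<tau> z. 1)"

text \<open>
  The Eisenstein series \<open>E\<^bsub>k,m,s\<^esub>\<close> of Eichler and Zagier, of index \<open>m = a b\<^sup>2\<close> with \<open>a\<close>
  square-free. It depends only on \<open>s\<close> modulo \<open>b\<close>, and \<open>s = 0\<close> gives \<^const>\<open>jacobi_eisenstein\<close>.
\<close>
definition jacobi_eisenstein_at ::
  "int \<Rightarrow> nat \<Rightarrow> nat \<Rightarrow> nat \<Rightarrow> complex \<Rightarrow> complex \<Rightarrow> complex" where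
  "jacobi_eisenstein_at k a b s =
     jacobi_average k (a * b^2) (\<lambda>\<tau> z. ee (of_nat (a * s^2) * \<tau> + of_nat (2 * a * b * s) * z))"

text \<open>The complex span of the \<open>E\<^bsub>k,m,s\<^esub>\<close>, \<open>s\<close> modulo \<open>b\<close>.\<close>
definition jacobi_eis :: "int \<Rightarrow> nat \<Rightarrow> (complex \<Rightarrow> complex \<Rightarrow> complex) set" where
  "jacobi_eis k m = {\<phi>. \<exists>a b. m = a * b^2 \<and> squarefree a \<and>
     (\<exists>\<alpha>. \<forall>\<tau> z. Im \<tau> > 0 \<longrightarrow> \<phi> \<tau> z = (\<Sum>s<b. \<alpha> s * jacobi_eisenstein_at k a b s \<tau> z))}"

definition jacobi_U ::
  "nat \<Rightarrow> (complex \<Rightarrow> complex \<Rightarrow> complex) \<Rightarrow> complex \<Rightarrow> complex \<Rightarrow> complex" where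
  "jacobi_U l \<phi> \<tau> z = \<phi> \<tau> (of_nat l * z)"

end

theory Submission
  imports Defs "HOL-Complex_Analysis.Conformal_Mappings"
begin

text \<open>
  An element of the span of the \<open>E\<^bsub>k,m,s\<^esub>\<close> is determined by its boundary values: for
  \<open>m = a b\<^sup>2\<close> and an integer \<open>s\<close>, the limit of \<open>e(a s\<^sup>2 \<tau>) \<phi>(\<tau>, s \<tau> / b)\<close> as \<open>\<tau> = i y\<close> tends
  to the cusp is, for a Jacobi form, its Fourier coefficient at \<open>n = a s\<^sup>2\<close>, \<open>r = - 2 a b s\<close>, where
  \<open>r\<^sup>2 = 4 n m\<close>. It vanishes for a cusp form (\<open>jacobi_cusp_form_limit\<close>), and for \<open>E\<^bsub>k,m,t\<^esub>\<close> it
  is half the number of signs with \<open>s \<equiv> \<plusminus> t\<close> modulo \<open>b\<close> (\<open>eis_part_limit\<close>). As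
  \<open>E\<^bsub>k,m,s\<^esub> = E\<^bsub>k,m,-s\<^esub>\<close> for even \<open>k\<close>, the Eisenstein part of \<open>\<phi>\<^sub>m\<close> is the sum over
  \<open>s\<close> modulo \<open>b\<close> of the boundary value of \<open>\<phi>\<^sub>m\<close> at \<open>s\<close> times \<open>E\<^bsub>k,m,s\<^esub>\<close>
  (\<open>eisenstein_combination\<close>).

  The boundary value of \<open>\<phi>\<^sub>m\<close> at \<open>s\<close> is \<open>a\<^sub>f(a gcd(s, b)\<^sup>2)\<close>. Indeed \<open>\<phi>\<^sub>m\<close> is an integral of the
  Klingen Eisenstein series over the real part of \<open>\<tau>'\<close>, along which the limit concerns a point
  whose imaginary part grows in all directions but that of the primitive vector \<open>(- s, b) / gcd(s, b)\<close>.
  There the series degenerates, as under the Siegel operator, to \<open>f\<close> at the value of \<open>Z\<close> on that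
  vector, and the integral picks out one coefficient of \<open>f\<close>. The degeneration holds term by
  term: after the Hecke bound for \<open>f\<close>, each term is bounded by
  a power of a positive definite quadratic form at the last row of the symplectic matrix, this row
  determines the coset, and the form stays bounded only for one coset
  (\<open>klingen_term_bound\<close>, \<open>klingen_eisenstein_degenerates\<close>, \<open>fourier_jacobi_limit\<close>).

  On the other side, \<open>E\<^bsub>k,m,s\<^esub>\<close> is a sum over coprime pairs \<open>(c, d)\<close> and integers
  \<open>n \<equiv> s\<close> modulo \<open>b\<close> of terms that depend on \<open>b\<close> only through \<open>b z\<close>
  (\<open>jacobi_eisenstein_at_eq_part\<close>). Hence \<open>E\<^bsub>k,a\<beta>\<^sup>2\<^esub> | U\<^bsub>b/\<beta>\<^esub>\<close> is the sum of the
  \<open>E\<^bsub>k,m,s\<^esub>\<close> with \<open>\<beta>\<close> dividing \<open>s\<close>, and Moebius inversion over the divisors of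
  \<open>gcd(s, b)\<close> turns the sum over \<open>s\<close> into the asserted one.

  The sums over \<open>(c, d, n)\<close> converge for \<open>k \<ge> 4\<close>, the Klingen series for \<open>k > 4\<close>. For \<open>k \<le> 4\<close>
  there is no cusp form other than zero (\<open>cusp_forms_small_weight\<close>), so that in weight four the
  argument applies with the bound zero for \<open>f\<close>. For \<open>k \<le> 2\<close> the Jacobi Eisenstein series diverge
  at every point (\<open>not_summable_eis_term\<close>); their sums then have the default value zero, and both
  sides of the formula vanish.
\<close>

section \<open>Limits of infinite sums\<close>

text \<open>
  Dominated convergence for sums: the majorant makes the finite partial sums converge uniformly in
  the sequence index, which permits to exchange the two limits.
\<close>
lemma infsum_dominated_tendsto:
  fixes t :: "nat \<Rightarrow> 'a \<Rightarrow> 'b::banach"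
  assumes "B summable_on A"
    and "\<And>n x. x \<in> A \<Longrightarrow> norm (t n x) \<le> B x"
    and "\<And>x. x \<in> A \<Longrightarrow> (\<lambda>n. t n x) \<longlonglongrightarrow> l x"
  shows "(\<lambda>n. infsum (t n) A) \<longlonglongrightarrow> infsum l A"
proof (rule swap_uniform_limit')
  have bl: "norm (l x) \<le> B x" if "x \<in> A" for x
    using Lim_bounded[OF tendsto_norm[OF assms(3)[OF that]]] assms(2)[OF that] by blast
  show "(sum l \<longlongrightarrow> infsum l A) (finite_subsets_at_top A)"
    using Infinite_Sum.abs_summable_on_comparison_test'[OF assms(1) bl]
    by (rule infsum_tendsto[OF abs_summable_summable])
  show "uniform_limit UNIV (\<lambda>X n. \<Sum>x\<in>X. t n x) (\<lambda>n. infsum (t n) A) (finite_subsets_at_top A)"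
    using assms(1,2) by (intro Weierstrass_m_test_general) auto
  show "\<forall>\<^sub>F X in finite_subsets_at_top A. (\<lambda>n. \<Sum>x\<in>X. t n x) \<longlonglongrightarrow> sum l X"
    using assms(3) by (intro eventually_finite_subsets_at_top_weakI tendsto_sum) auto
qed auto

text \<open>
  Every majorant below is a product of these one-variable factors: at nonzero integer points a
  positive definite form is, up to a constant, at least the product of the \<open>1 + |x\<^sub>i|\<close>, raised to
  the power that matches the degree. So the majorants are summed one variable at a time.
\<close>
definition int_decay :: "real \<Rightarrow> int \<Rightarrow> real" where
  "int_decay p n = (1 + \<bar>real_of_int n\<bar>) powr (- p)"

lemma int_decay_nonneg [simp]: "0 \<le> int_decay p n"
  by (simp add: int_decay_def)

lemma summable_int_decay:
  assumes "p > 1"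
  shows "int_decay p summable_on UNIV"
proof -
  have "summable (\<lambda>n. real n powr - p)"
    using assms by (simp add: summable_real_powr_iff)
  hence "summable (\<lambda>n. real (Suc n) powr - p)"
    by (subst summable_Suc_iff)
  hence *: "(\<lambda>n. real (Suc n) powr - p) summable_on UNIV"
    by (intro summable_nonneg_imp_summable_on) auto
  have 1: "int_decay p summable_on {0..}"
    using * by (subst summable_on_reindex_bij_witness[of "{0..}" int nat UNIV "\<lambda>n. real (Suc n) powr - p"])
       (auto simp: int_decay_def add.commute)
  have 2: "int_decay p summable_on {..0}"
    using 1 by (subst summable_on_reindex_bij_witness[of "{..0}" uminus uminus "{0..}" "int_decay p"])
       (auto simp: int_decay_def)
  have "int_decay p summable_on ({0..} \<union> {..0})"
    by (rule summable_on_union[OF 1 2])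
  also have "{0..} \<union> {..0} = (UNIV :: int set)" by auto
  finally show ?thesis .
qed

lemma summable_on_times_nonneg:
  fixes f :: "'a \<Rightarrow> real" and g :: "'b \<Rightarrow> real"
  assumes "f summable_on A" "g summable_on B"
    and "\<And>x. x \<in> A \<Longrightarrow> 0 \<le> f x" "\<And>x. x \<in> B \<Longrightarrow> 0 \<le> g x"
  shows "(\<lambda>(x, y). f x * g y) summable_on A \<times> B"
proof (rule summable_on_SigmaI)
  fix x assume "x \<in> A"
  show "((\<lambda>y. case (x, y) of (x, y) \<Rightarrow> f x * g y) has_sum (f x * infsum g B)) B"
    using assms(2) by (auto intro!: has_sum_cmult_right)
next
  show "(\<lambda>x. f x * infsum g B) summable_on A"
    using assms(1) by (rule summable_on_cmult_left)
qed (use assms in auto)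

section \<open>Exponentials and Fourier coefficients\<close>

lemma ee_add: "ee (x + y) = ee x * ee y"
  by (simp add: ee_def exp_add distrib_left)

lemma ee_0 [simp]: "ee 0 = 1"
  by (simp add: ee_def)

lemma norm_ee: "norm (ee x) = exp (- 2 * pi * Im x)"
  by (simp add: ee_def)

lemma ee_int [simp]: "ee (of_int n) = 1"
  using exp_integer_2pi[of "of_int n"] by (simp add: ee_def mult_ac)

lemma ee_add_int: "ee (x + of_int n) = ee x"
  by (simp add: ee_add)

lemma ee_minus: "ee (- x) = inverse (ee x)"
  by (simp add: ee_def exp_minus)

lemma ee_nonzero [simp]: "ee x \<noteq> 0"
  by (simp add: ee_def)

lemma integral_ee_int:
  fixes N :: int
  shows "((\<lambda>u::real. ee (of_int N * of_real u)) has_integral (if N = 0 then 1 else 0)) {0..1}"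
proof (cases "N = 0")
  case True
  then show ?thesis using has_integral_const_real[of "1::complex" 0 1] by simp
next
  case False
  define c where "c = 2 * complex_of_real pi * \<i> * of_int N"
  have c: "c \<noteq> 0" using False by (simp add: c_def)
  have d: "((\<lambda>u::real. exp (c * of_real u) / c) has_vector_derivative exp (c * of_real x))
        (at x within {0..1})" for x :: real
    using c by (auto intro!: derivative_eq_intros has_vector_derivative_real_field)
  have eq: "ee (of_int N * of_real u) = exp (c * of_real u)" for u :: real
    by (simp add: ee_def c_def mult_ac)
  have "exp c = 1"
    using ee_int[of N] by (simp add: ee_def c_def mult_ac)
  have "((\<lambda>u::real. exp (c * of_real u)) has_integral
      (exp (c * of_real 1) / c - exp (c * of_real 0) / c)) {0..1}"
    by (rule fundamental_theorem_of_calculus[OF _ d]) auto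
  with \<open>exp c = 1\<close> False show ?thesis
    by (simp add: eq)
qed

text \<open>
  The series converges absolutely, at a rate independent of \<open>u\<close>, so it can be integrated termwise.
  The frequencies \<open>\<nu>\<close> are arbitrary in order to treat \<open>f(p\<^sup>2 \<tau>)\<close> together with \<open>f(\<tau>)\<close>.
\<close>
lemma fourier_coefficient:
  fixes c :: "nat \<Rightarrow> complex" and \<nu> :: "nat \<Rightarrow> int" and G :: "real \<Rightarrow> complex"
  assumes sum: "\<And>u. 0 \<le> u \<Longrightarrow> u \<le> 1 \<Longrightarrow> ((\<lambda>n. c n * ee (of_int (\<nu> n) * of_real u)) has_sum G u) UNIV"
  shows "((\<lambda>u. G u * ee (- of_int N * of_real u)) has_integral (\<Sum>\<^sub>\<infinity>n\<in>{n. \<nu> n = N}. c n)) {0..1}"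
proof -
  define t where "t n u = c n * ee (of_int (\<nu> n - N) * of_real u)" for n and u :: real
  have te: "t n u = c n * ee (of_int (\<nu> n) * of_real u) * ee (- of_int N * of_real u)" for n u
    by (simp add: t_def ee_add[symmetric] left_diff_distrib)
  have cs: "c summable_on UNIV"
    using has_sum_imp_summable[OF sum[of 0]] by simp
  hence "(\<lambda>n. norm (c n)) summable_on UNIV"
    by (simp add: summable_on_iff_abs_summable_on_complex)
  hence abs: "summable (\<lambda>n. norm (c n))"
    by (rule summable_on_imp_summable)
  have int1: "(t n has_integral (if \<nu> n = N then c n else 0)) {0..1}" for n
    using has_integral_mult_right[OF integral_ee_int[of "\<nu> n - N"], of "c n"]
    unfolding t_def by (auto split: if_splits)
  define P where "P K u = (\<Sum>n<K. t n u)" for K u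
  have intP: "(P K has_integral (\<Sum>n<K. if \<nu> n = N then c n else 0)) {0..1}" for K
    unfolding P_def by (intro has_integral_sum int1) auto
  have le: "norm (P K u) \<le> (\<Sum>n. norm (c n))" for K u
  proof -
    have "norm (P K u) \<le> (\<Sum>n<K. norm (t n u))"
      unfolding P_def by (rule norm_sum)
    also have "\<dots> = (\<Sum>n<K. norm (c n))"
      by (simp add: t_def norm_mult norm_ee)
    also have "\<dots> \<le> (\<Sum>n. norm (c n))"
      using abs by (intro sum_le_suminf) auto
    finally show ?thesis .
  qed
  have lim: "(\<lambda>K. P K u) \<longlonglongrightarrow> G u * ee (- of_int N * of_real u)" if "u \<in> {0..1}" for u
  proof -
    have "((\<lambda>n. t n u) has_sum (G u * ee (- of_int N * of_real u))) UNIV"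
      unfolding te using that by (intro has_sum_cmult_left sum) auto
    thus ?thesis
      unfolding P_def using has_sum_imp_sums sums_def by blast
  qed
  note dc = dominated_convergence[of P "{0..1}" "\<lambda>_. \<Sum>n. norm (c n)",
      OF has_integral_integrable[OF intP] integrable_const_ivl le lim]
  have "(\<lambda>K. integral {0..1} (P K)) = (\<lambda>K. \<Sum>n<K. if \<nu> n = N then c n else 0)"
    by (intro ext integral_unique intP)
  with dc have "(\<lambda>n. if \<nu> n = N then c n else 0) sums
      integral {0..1} (\<lambda>u. G u * ee (- of_int N * of_real u))"
    unfolding sums_def by simp
  moreover have "(\<lambda>n. if \<nu> n = N then c n else 0) sums (\<Sum>\<^sub>\<infinity>n\<in>{n. \<nu> n = N}. c n)"
  proof -
    have "(c has_sum (\<Sum>\<^sub>\<infinity>n\<in>{n. \<nu> n = N}. c n)) {n. \<nu> n = N}"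
      using summable_on_subset_banach[OF cs] by auto
    hence "((\<lambda>n. if \<nu> n = N then c n else 0) has_sum (\<Sum>\<^sub>\<infinity>n\<in>{n. \<nu> n = N}. c n)) UNIV"
      by (subst (asm) has_sum_cong_neutral[of UNIV _ "\<lambda>n. if \<nu> n = N then c n else 0"]) auto
    thus ?thesis by (rule has_sum_imp_sums)
  qed
  ultimately have "integral {0..1} (\<lambda>u. G u * ee (- of_int N * of_real u)) =
      (\<Sum>\<^sub>\<infinity>n\<in>{n. \<nu> n = N}. c n)"
    by (rule sums_unique2)
  with dc(1) show ?thesis
    by (metis has_integral_integral)
qed

section \<open>Growth of cusp forms\<close>

text \<open>
  The logarithm is concave: \<open>ln (t / p) \<le> t / p\<close>.
\<close>
lemma powr_le_exp:
  fixes p t :: real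
  assumes "p > 0" "t > 0"
  shows "t powr p \<le> p powr p * exp t"
proof -
  have "ln (t / p) \<le> t / p"
    using ln_le_minus_one[of "t / p"] assms by simp
  hence "p * (ln t - ln p) \<le> t"
    using assms by (simp add: ln_div field_simps)
  hence "p * ln t \<le> p * ln p + t"
    by (simp add: right_diff_distrib)
  hence "exp (p * ln t) \<le> exp (p * ln p + t)" by simp
  thus ?thesis using assms by (simp add: powr_def exp_add)
qed

lemma cusp_form_modular:
  assumes "f \<in> cusp_forms k" "p * s - q * r = (1::int)" "Im \<tau> > 0"
  shows "f ((of_int p * \<tau> + of_int q) / (of_int r * \<tau> + of_int s)) = (of_int r * \<tau> + of_int s) powi k * f \<tau>"
proof -
  define M :: "int^2^2" where "M = vector [vector [p, q], vector [r, s]]"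
  have "M \<in> SL2Z"
    using assms(2) by (simp add: SL2Z_def M_def det_2)
  hence "f ((of_int (M$1$1) * \<tau> + of_int (M$1$2)) / (of_int (M$2$1) * \<tau> + of_int (M$2$2)))
          = (of_int (M$2$1) * \<tau> + of_int (M$2$2)) powi k * f \<tau>"
    using assms(1,3) by (simp add: cusp_forms_def)
  thus ?thesis by (simp add: M_def)
qed

text \<open>
  The pointwise Petersson norm, which is invariant under the modular group.
\<close>
definition petersson_abs :: "int \<Rightarrow> (complex \<Rightarrow> complex) \<Rightarrow> complex \<Rightarrow> real" where
  "petersson_abs k f \<tau> = norm (f \<tau>) * Im \<tau> powr (of_int k / 2)"

lemma petersson_abs_nonneg: "0 \<le> petersson_abs k f \<tau>"
  by (simp add: petersson_abs_def)

lemma petersson_abs_translate: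
  assumes "f \<in> cusp_forms k" "Im \<tau> > 0"
  shows "petersson_abs k f (\<tau> + of_int n) = petersson_abs k f \<tau>"
  using cusp_form_modular[OF assms(1), of 1 1 n 0 \<tau>] assms by (simp add: petersson_abs_def)

lemma petersson_abs_invert:
  assumes "f \<in> cusp_forms k" "Im \<tau> > 0"
  shows "petersson_abs k f (- 1 / \<tau>) = petersson_abs k f \<tau>"
proof -
  have nz: "\<tau> \<noteq> 0" using assms(2) by auto
  have f: "f (- 1 / \<tau>) = \<tau> powi k * f \<tau>"
    using cusp_form_modular[OF assms(1), of 0 0 "-1" 1 \<tau>] assms by simp
  have im: "Im (- 1 / \<tau>) = Im \<tau> / (norm \<tau>)\<^sup>2"
    by (simp add: Im_divide cmod_power2)
  have "(norm \<tau>)\<^sup>2 powr (of_int k / 2) = norm \<tau> powr of_int k"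
    using nz by (simp add: powr_powr flip: powr_numeral)
  hence "(Im \<tau> / (norm \<tau>)\<^sup>2) powr (of_int k / 2) = Im \<tau> powr (of_int k / 2) / norm \<tau> powi k"
    using nz assms(2) by (simp add: powr_divide powr_real_of_int')
  thus ?thesis
    using nz unfolding petersson_abs_def f im by (simp add: norm_mult norm_power_int)
qed

text \<open>
  A translation followed by inversion at least doubles an imaginary part below \<open>1/2\<close>, because the
  translate with real part in \<open>[-1/2, 1/2]\<close> has absolute value at most \<open>1/sqrt 2\<close>.
\<close>
lemma petersson_abs_reduce:
  assumes f: "f \<in> cusp_forms k" and "Im \<tau> > 0"
  shows "\<exists>\<tau>'. Im \<tau>' \<ge> 1 / 2 \<and> petersson_abs k f \<tau>' = petersson_abs k f \<tau>"
proof -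
  have *: "\<exists>\<tau>'. Im \<tau>' \<ge> 1 / 2 \<and> petersson_abs k f \<tau>' = petersson_abs k f \<tau>"
    if "Im \<tau> \<ge> (1 / 2) / 2 ^ n" for n \<tau>
    using that
  proof (induction n arbitrary: \<tau>)
    case 0
    thus ?case by auto
  next
    case (Suc n)
    show ?case
    proof (cases "Im \<tau> \<ge> 1 / 2")
      case True
      thus ?thesis by auto
    next
      case False
      have pos: "Im \<tau> > 0"
        using Suc.prems by (rule less_le_trans[rotated]) simp
      define \<tau>1 where "\<tau>1 = \<tau> + of_int (- round (Re \<tau>))"
      have im1: "Im \<tau>1 = Im \<tau>" by (simp add: \<tau>1_def)
      have "\<bar>Re \<tau>1\<bar> \<le> 1 / 2"
        using of_int_round_abs_le[of "Re \<tau>"] by (simp add: \<tau>1_def abs_minus_commute)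
      hence "(Re \<tau>1)\<^sup>2 \<le> (1 / 2)\<^sup>2" using abs_le_square_iff[of "Re \<tau>1" "1 / 2"] by simp
      moreover have "(Im \<tau>1)\<^sup>2 \<le> (1 / 2)\<^sup>2"
        using False pos im1 by (intro power_mono) auto
      ultimately have n2: "(norm \<tau>1)\<^sup>2 \<le> 1 / 2"
        unfolding cmod_power2 power_divide by simp
      have n0: "(norm \<tau>1)\<^sup>2 > 0" using pos im1 by auto
      have "Im (- 1 / \<tau>1) = Im \<tau> / (norm \<tau>1)\<^sup>2"
        by (simp add: Im_divide cmod_power2 im1)
      also have "\<dots> \<ge> 2 * Im \<tau>"
        using n2 n0 pos by (simp add: field_simps)
      finally have "Im (- 1 / \<tau>1) \<ge> (1 / 2) / 2 ^ n"
        using Suc.prems by simp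
      from Suc.IH[OF this] show ?thesis
        using petersson_abs_invert[OF f, of \<tau>1] petersson_abs_translate[OF f pos, of "- round (Re \<tau>)"]
          pos im1 by (simp add: \<tau>1_def)
    qed
  qed
  obtain n where "1 / 2 / Im \<tau> < 2 ^ n"
    using real_arch_pow[of 2 "1 / 2 / Im \<tau>"] by auto
  hence "Im \<tau> \<ge> (1 / 2) / 2 ^ n"
    using assms(2) by (simp add: field_simps)
  thus ?thesis by (rule *)
qed

text \<open>
  As \<open>n \<ge> 1\<close>, the factor \<open>exp (- 2 \<pi> n y)\<close> decays from height \<open>1/2\<close> upwards at least as fast as
  that of \<open>n = 1\<close>.
\<close>
lemma cusp_form_exponential_decay:
  assumes "cusp_expansion f a" "Im \<tau> \<ge> 1 / 2"
  shows "norm (f \<tau>) \<le> (\<Sum>\<^sub>\<infinity>n\<in>{1..}. norm (a n) * exp (- pi * real n)) * exp (pi - 2 * pi * Im \<tau>)"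
proof -
  have s: "((\<lambda>n. a n * ee (of_nat n * \<tau>)) has_sum f \<tau>) {1..}" if "Im \<tau> > 0" for \<tau>
    using assms(1) that by (auto simp: cusp_expansion_def)
  have "(\<lambda>n. a n * ee (of_nat n * (\<i> / 2))) summable_on {1..}"
    using s[of "\<i> / 2"] has_sum_imp_summable by force
  hence "(\<lambda>n. norm (a n * ee (of_nat n * (\<i> / 2)))) summable_on {1..}"
    by (simp add: summable_on_iff_abs_summable_on_complex)
  hence A: "(\<lambda>n. norm (a n) * exp (- pi * real n)) summable_on {1..}"
    by (simp add: norm_mult norm_ee)
  have le: "norm (a n * ee (of_nat n * \<tau>)) \<le> norm (a n) * exp (- pi * real n) * exp (pi - 2 * pi * Im \<tau>)"
    if "n \<in> {1..}" for n
  proof -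
    have "(real n - 1) * (2 * Im \<tau> - 1) \<ge> 0" using that assms(2) by simp
    hence "0 \<le> pi * ((real n - 1) * (2 * Im \<tau> - 1))" by simp
    hence "exp (- 2 * pi * (real n * Im \<tau>)) \<le> exp (- pi * real n + (pi - 2 * pi * Im \<tau>))"
      by (simp add: algebra_simps)
    hence "norm (a n) * exp (- 2 * pi * (real n * Im \<tau>)) \<le> norm (a n) * exp (- pi * real n + (pi - 2 * pi * Im \<tau>))"
      by (rule mult_left_mono) simp
    also have "exp (- pi * real n + (pi - 2 * pi * Im \<tau>)) = exp (- pi * real n) * exp (pi - 2 * pi * Im \<tau>)"
      by (rule exp_add)
    finally show ?thesis by (simp add: norm_mult norm_ee mult_ac)
  qed
  have "norm (f \<tau>) \<le> (\<Sum>\<^sub>\<infinity>n\<in>{1..}. norm (a n) * exp (- pi * real n) * exp (pi - 2 * pi * Im \<tau>))"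
    using s[of \<tau>] assms(2) le
    by (intro norm_infsum_le[OF _ has_sum_infsum[OF summable_on_cmult_left[OF A]]]) auto
  also have "\<dots> = (\<Sum>\<^sub>\<infinity>n\<in>{1..}. norm (a n) * exp (- pi * real n)) * exp (pi - 2 * pi * Im \<tau>)"
    by (rule infsum_cmult_left')
  finally show ?thesis .
qed

text \<open>
  In \<open>Im \<tau> \<ge> 1/2\<close> exponential decay beats any power of the imaginary part, and this region meets
  every orbit.
\<close>
lemma petersson_abs_bounded:
  assumes f: "f \<in> cusp_forms k"
  obtains M where "\<And>\<tau>. Im \<tau> > 0 \<Longrightarrow> petersson_abs k f \<tau> \<le> M"
proof -
  obtain a where a: "cusp_expansion f a"
    using f by (auto simp: cusp_forms_def)
  define A where "A = (\<Sum>\<^sub>\<infinity>n\<in>{1..}. norm (a n) * exp (- pi * real n))"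
  have A0: "A \<ge> 0" unfolding A_def by (intro infsum_nonneg) auto
  define p where "p = max 1 (of_int k / 2 :: real)"
  have p: "p > 0" by (simp add: p_def)
  define M where "M = A * exp pi * (2 powr (- (of_int k / 2)) * p powr p)"
  have 1: "petersson_abs k f \<tau> \<le> M" if "Im \<tau> \<ge> 1 / 2" for \<tau>
  proof -
    define y where "y = Im \<tau>"
    have y: "y \<ge> 1 / 2" using that by (simp add: y_def)
    have "y powr (of_int k / 2) = 2 powr (- (of_int k / 2)) * (2 * y) powr (of_int k / 2)"
      using y by (simp add: powr_mult powr_minus field_simps)
    moreover have "(2 * y) powr (of_int k / 2) \<le> p powr p * exp (2 * pi * y)"
    proof -
      have "(2 * y) powr (of_int k / 2) \<le> (2 * y) powr p"
        using y by (intro powr_mono) (auto simp: p_def)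
      also have "\<dots> \<le> p powr p * exp (2 * y)"
        using y p by (intro powr_le_exp) auto
      also have "\<dots> \<le> p powr p * exp (2 * pi * y)"
        using y pi_gt3 by (intro mult_left_mono) auto
      finally show ?thesis .
    qed
    ultimately have y2: "y powr (of_int k / 2) \<le> 2 powr (- (of_int k / 2)) * (p powr p * exp (2 * pi * y))"
      by (simp add: mult_left_mono)
    have "petersson_abs k f \<tau> \<le> (A * exp (pi - 2 * pi * y)) * (2 powr (- (of_int k / 2)) * (p powr p * exp (2 * pi * y)))"
      unfolding petersson_abs_def y_def[symmetric]
      using cusp_form_exponential_decay[OF a that, folded A_def y_def] y2 A0
      by (intro mult_mono) auto
    also have "\<dots> = M"
      by (simp add: M_def exp_diff)
    finally show ?thesis .
  qed
  have "petersson_abs k f \<tau> \<le> M" if "Im \<tau> > 0" for \<tau>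
    using petersson_abs_reduce[OF f that] 1 by metis
  thus thesis by (rule that)
qed

text \<open>
  Dividing \<open>f\<close> by \<open>q = e(\<tau>)\<close> leaves a holomorphic function of \<open>q\<close> on the unit disc, to which the
  maximum principle applies on the disc \<open>Im \<tau> \<ge> y\<^sub>1\<close>. The gain is the factor \<open>|q|\<close>.
\<close>
lemma cusp_form_max_modulus:
  assumes a: "cusp_expansion f a" and y1: "0 < y1"
    and B: "\<And>\<tau>. Im \<tau> = y1 \<Longrightarrow> norm (f \<tau>) \<le> B"
    and \<tau>: "y1 \<le> Im \<tau>"
  shows "norm (f \<tau>) \<le> B * exp (- 2 * pi * (Im \<tau> - y1))"
proof -
  define h where "h q = (\<Sum>n. a (Suc n) * q ^ n)" for q
  have s: "((\<lambda>n. a n * ee (of_nat n * \<tau>)) has_sum f \<tau>) {1..}" if "Im \<tau> > 0" for \<tau>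
    using a that by (auto simp: cusp_expansion_def)
  have s1: "(\<lambda>n. a (Suc n) * ee \<tau> ^ n) sums (f \<tau> / ee \<tau>)" if "Im \<tau> > 0" for \<tau>
  proof -
    have "((\<lambda>n. a (Suc n) * ee (of_nat (Suc n) * \<tau>)) has_sum f \<tau>) UNIV"
      using s[OF that]
      by (subst has_sum_reindex_bij_witness[of UNIV "\<lambda>n. n - 1" Suc "{1..}"
            "\<lambda>n. a n * ee (of_nat n * \<tau>)"]) auto
    hence "(\<lambda>n. a (Suc n) * ee (of_nat (Suc n) * \<tau>)) sums f \<tau>"
      by (rule has_sum_imp_sums)
    moreover have "ee (of_nat (Suc n) * \<tau>) = ee \<tau> ^ n * ee \<tau>" for n
      by (simp add: ee_def exp_add algebra_simps exp_of_nat2_mult flip: exp_of_nat_mult)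
    ultimately have "(\<lambda>n. a (Suc n) * ee \<tau> ^ n * ee \<tau>) sums f \<tau>" by (simp add: mult_ac)
    from sums_divide[OF this, of "ee \<tau>"] show ?thesis by simp
  qed
  have surj: "\<exists>\<tau>. ee \<tau> = q \<and> Im \<tau> = - ln (norm q) / (2 * pi)" if "q \<noteq> 0" for q
  proof (intro exI conjI)
    show "ee (Ln q / (2 * pi * \<i>)) = q" using that by (simp add: ee_def)
    show "Im (Ln q / (2 * pi * \<i>)) = - ln (norm q) / (2 * pi)"
      using that by (simp add: Im_divide power2_eq_square)
  qed
  have h: "(\<lambda>n. a (Suc n) * q ^ n) sums h q" if "norm q < 1" for q
  proof (cases "q = 0")
    case True
    thus ?thesis using powser_sums_zero[of "\<lambda>n. a (Suc n)"] by (simp add: h_def powser_zero)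
  next
    case False
    then obtain \<tau> where "ee \<tau> = q" "Im \<tau> = - ln (norm q) / (2 * pi)" using surj by blast
    moreover have "ln (norm q) < 0" using that False by simp
    ultimately have "(\<lambda>n. a (Suc n) * q ^ n) sums (f \<tau> / ee \<tau>)" using s1[of \<tau>]
      by (simp add: divide_neg_pos)
    thus ?thesis unfolding h_def using sums_summable summable_sums by blast
  qed
  have hol: "h holomorphic_on ball 0 1"
    using h by (intro power_series_holomorphic[where a = "\<lambda>n. a (Suc n)"]) auto
  have hf: "f \<tau> = ee \<tau> * h (ee \<tau>)" if "Im \<tau> > 0" for \<tau>
  proof -
    have "norm (ee \<tau>) < 1" using that by (simp add: norm_ee mult_pos_pos)
    from sums_unique2[OF h[OF this] s1[OF that]] show ?thesis by simp
  qed
  define r where "r = exp (- 2 * pi * y1)"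
  have r: "0 < r" "r < 1" using y1 by (auto simp: r_def)
  have fr: "norm (h q) \<le> B / r" if "norm q = r" for q
  proof -
    have "q \<noteq> 0" using that r by auto
    then obtain \<tau> where \<tau>: "ee \<tau> = q" "Im \<tau> = - ln (norm q) / (2 * pi)" using surj by blast
    have "Im \<tau> = y1" using \<tau>(2) that by (simp add: r_def)
    hence "norm (f \<tau>) \<le> B" "norm (f \<tau>) = r * norm (h q)"
      using B[of \<tau>] hf[of \<tau>] y1 \<tau>(1) that by (auto simp: norm_mult)
    thus ?thesis using r by (simp add: field_simps)
  qed
  have in_disc: "ee \<tau> \<in> cball 0 r"
    using \<tau> by (simp add: norm_ee r_def)
  have "norm (h (ee \<tau>)) \<le> B / r"
  proof (rule maximum_modulus_frontier[where S = "cball 0 r" and f = h and \<xi> = "ee \<tau>"])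
    show "h holomorphic_on interior (cball 0 r)"
      using r by (intro holomorphic_on_subset[OF hol]) auto
    show "continuous_on (closure (cball 0 r)) h"
      using r by (intro holomorphic_on_imp_continuous_on holomorphic_on_subset[OF hol]) auto
    show "norm (h z) \<le> B / r" if "z \<in> frontier (cball 0 r)" for z
      using that fr[of z] r by (simp add: frontier_cball)
  qed (use in_disc in auto)
  moreover have "norm (f \<tau>) = exp (- 2 * pi * Im \<tau>) * norm (h (ee \<tau>))"
    using hf[of \<tau>] y1 \<tau> by (simp add: norm_mult norm_ee)
  ultimately have "norm (f \<tau>) \<le> exp (- 2 * pi * Im \<tau>) * (B / r)"
    using mult_left_mono[of "norm (h (ee \<tau>))" "B / r" "exp (- 2 * pi * Im \<tau>)"] by simp
  also have "\<dots> = B * exp (- 2 * pi * (Im \<tau> - y1))"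
    by (simp add: r_def exp_diff exp_minus algebra_simps divide_inverse)
  finally show ?thesis .
qed

text \<open>
  The supremum of \<open>y\<^bsup>k/2\<^esup> |f|\<close> is approached in \<open>Im \<tau> \<ge> 1/2\<close>. There the maximum principle, applied
  from the height \<open>2/5\<close>, bounds it by \<open>exp (- 1/10)\<close> times itself, so it is zero. The height is chosen
  below \<open>1/2\<close> but above the maximum of \<open>y\<^bsup>k/2\<^esup> exp (- 2 \<pi> y)\<close>, which for \<open>0 < k \<le> 4\<close> is at
  \<open>k / (4 \<pi>) \<le> 1 / \<pi>\<close>.
\<close>
lemma cusp_forms_small_weight:
  assumes f: "f \<in> cusp_forms k" and k: "k \<le> 4" and "Im \<tau> > 0"
  shows "f \<tau> = 0"
proof -
  obtain a where a: "cusp_expansion f a"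
    using f by (auto simp: cusp_forms_def)
  define X where "X = petersson_abs k f ` {\<tau>. Im \<tau> > 0}"
  define M where "M = Sup X"
  define \<kappa> where "\<kappa> = of_int k / (2 :: real)"
  have \<kappa>: "\<kappa> \<le> 2" using k by (simp add: \<kappa>_def)
  obtain M0 where "\<And>\<tau>. Im \<tau> > 0 \<Longrightarrow> petersson_abs k f \<tau> \<le> M0"
    using petersson_abs_bounded[OF f] by blast
  hence bdd: "bdd_above X" by (auto simp: X_def bdd_above_def)
  have M: "petersson_abs k f \<tau> \<le> M" if "Im \<tau> > 0" for \<tau>
    unfolding M_def using that bdd by (intro cSup_upper) (auto simp: X_def)
  have M0: "M \<ge> 0" using M[OF assms(3)] petersson_abs_nonneg[of k f \<tau>] by linarith
  have contr: "petersson_abs k f \<tau> \<le> M * exp (- (1 / 10))" if y: "Im \<tau> \<ge> 1 / 2" for \<tau>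
  proof -
    define y where "y = Im \<tau>"
    have bound: "norm (f \<tau>') \<le> M * (2 / 5) powr (- \<kappa>)" if "Im \<tau>' = 2 / 5" for \<tau>'
      using M[of \<tau>'] that by (simp add: petersson_abs_def \<kappa>_def powr_minus field_simps)
    have "norm (f \<tau>) \<le> M * (2 / 5) powr (- \<kappa>) * exp (- 2 * pi * (y - 2 / 5))"
      unfolding y_def using y by (intro cusp_form_max_modulus[OF a _ bound]) auto
    hence "petersson_abs k f \<tau> \<le> M * (2 / 5) powr (- \<kappa>) * exp (- 2 * pi * (y - 2 / 5)) * y powr \<kappa>"
      unfolding petersson_abs_def y_def \<kappa>_def by (rule mult_right_mono) simp
    also have "\<dots> = M * ((y / (2 / 5)) powr \<kappa> * exp (- 2 * pi * (y - 2 / 5)))"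
      using y by (simp add: powr_divide powr_minus y_def powr_mult field_simps)
    also have "(y / (2 / 5)) powr \<kappa> * exp (- 2 * pi * (y - 2 / 5)) \<le> exp (- (1 / 10))"
    proof -
      have "(y / (2 / 5)) powr \<kappa> \<le> (y / (2 / 5)) powr 2"
        using y \<kappa> by (intro powr_mono) (auto simp: y_def)
      also have "\<dots> = exp (2 * ln (y / (2 / 5)))"
        using y by (simp add: powr_def y_def)
      also have "\<dots> \<le> exp (2 * (y / (2 / 5) - 1))"
        using y ln_le_minus_one[of "y / (2 / 5)"] by (simp add: y_def)
      finally have "(y / (2 / 5)) powr \<kappa> * exp (- 2 * pi * (y - 2 / 5)) \<le>
          exp (2 * (y / (2 / 5) - 1)) * exp (- 2 * pi * (y - 2 / 5))"
        by (rule mult_right_mono) simp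
      also have "\<dots> = exp (- (2 * pi - 5) * (y - 2 / 5))"
        by (simp add: algebra_simps flip: exp_add)
      also have "- (2 * pi - 5) * (y - 2 / 5) \<le> - (1 / 10)"
      proof -
        have "1 * (1 / 10) \<le> (2 * pi - 5) * (y - 2 / 5)"
          using y pi_gt3 by (intro mult_mono) (auto simp: y_def)
        thus ?thesis unfolding mult_minus_left by linarith
      qed
      finally show ?thesis by simp
    qed
    finally show ?thesis using M0 by (simp add: mult_left_mono)
  qed
  have "M \<le> M * exp (- (1 / 10))"
    unfolding M_def
  proof (rule cSup_least)
    fix x assume "x \<in> X"
    then obtain \<tau>' where "Im \<tau>' > 0" "x = petersson_abs k f \<tau>'" by (auto simp: X_def)
    thus "x \<le> Sup X * exp (- (1 / 10))"
      using petersson_abs_reduce[OF f] contr unfolding M_def by metis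
  qed (use assms(3) in \<open>auto simp: X_def\<close>)
  hence "M = 0"
    using M0 by (smt (verit) exp_less_one_iff mult_less_cancel_left2 zero_less_divide_iff)
  hence "petersson_abs k f \<tau> = 0"
    using M[OF assms(3)] petersson_abs_nonneg[of k f \<tau>] by simp
  thus ?thesis using assms(3) by (simp add: petersson_abs_def)
qed

text \<open>
  The Hecke bound. The constant vanishes in the weights up to four, in which the majorant of the
  Klingen series would diverge but every cusp form is zero.
\<close>
lemma cusp_form_bound:
  assumes f: "f \<in> cusp_forms k"
  obtains C where "C \<ge> 0" "k \<le> 4 \<Longrightarrow> C = 0"
    "\<And>\<tau>. Im \<tau> > 0 \<Longrightarrow> norm (f \<tau>) \<le> C * Im \<tau> powr (- (of_int k / 2))"
proof -
  obtain M where M: "\<And>\<tau>. Im \<tau> > 0 \<Longrightarrow> petersson_abs k f \<tau> \<le> M"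
    using petersson_abs_bounded[OF f] by blast
  define C where "C = (if k \<le> 4 then 0 else M)"
  show thesis
  proof (rule that[of C])
    show "C \<ge> 0"
      using M[of \<i>] petersson_abs_nonneg[of k f \<i>] by (simp add: C_def)
    show "norm (f \<tau>) \<le> C * Im \<tau> powr (- (of_int k / 2))" if "Im \<tau> > 0" for \<tau>
      using M[OF that] cusp_forms_small_weight[OF f _ that] that
      by (auto simp: C_def petersson_abs_def powr_minus field_simps)
  qed (simp add: C_def)
qed

section \<open>The symplectic group of degree two\<close>

lemma UNIV_2_plus_2: "(UNIV :: (2 + 2) set) = {Inl 1, Inl 2, Inr 1, Inr 2}"
  by (auto simp: UNIV_sum UNIV_2)

lemma sum_2_plus_2:
  fixes f :: "2 + 2 \<Rightarrow> 'a::comm_monoid_add"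
  shows "sum f UNIV = f (Inl 1) + f (Inl 2) + f (Inr 1) + f (Inr 2)"
  unfolding UNIV_2_plus_2 by (simp add: add_ac)

lemma all_2_plus_2: "(\<forall>i::2+2. P i) \<longleftrightarrow> P (Inl 1) \<and> P (Inl 2) \<and> P (Inr 1) \<and> P (Inr 2)"
  using UNIV_2_plus_2 by (metis UNIV_I empty_iff insert_iff)

text \<open>
  The symplectic product of the columns \<open>i\<close> and \<open>j\<close>; thus \<open>g\<close> is symplectic if and only if its
  columns form a symplectic basis.
\<close>
definition column_pairing :: "int^(2+2)^(2+2) \<Rightarrow> 2+2 \<Rightarrow> 2+2 \<Rightarrow> int" where
  "column_pairing g i j = g $ Inl 1 $ i * g $ Inr 1 $ j + g $ Inl 2 $ i * g $ Inr 2 $ j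
     - g $ Inr 1 $ i * g $ Inl 1 $ j - g $ Inr 2 $ i * g $ Inl 2 $ j"

lemma Sp2Z_iff_pairing: "g \<in> Sp2Z \<longleftrightarrow> (\<forall>i j. column_pairing g i j = symp_unit $ i $ j)"
proof -
  have "(transpose g ** symp_unit ** g) $ i $ j = column_pairing g i j" for i j
    by (simp add: matrix_matrix_mult_def transpose_def sum_2_plus_2 symp_unit_def column_pairing_def
        algebra_simps)
  thus ?thesis by (simp add: Sp2Z_def vec_eq_iff)
qed

text \<open>
  Over a field this is linear algebra; the integers embed into the reals.
\<close>
lemma int_matrix_left_right_inverse:
  fixes A B :: "int^'n^'n"
  assumes "A ** B = mat 1"
  shows "B ** A = mat 1"
proof -
  define R :: "int^'n^'n \<Rightarrow> real^'n^'n" where "R A = (\<chi> i j. of_int (A $ i $ j))" for A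
  have R_mult: "R (A ** B) = R A ** R B" for A B
    by (simp add: R_def matrix_matrix_mult_def vec_eq_iff)
  have R_1: "R (mat 1) = mat 1"
    by (simp add: R_def mat_def vec_eq_iff)
  have R_inj: "R A = R B \<Longrightarrow> A = B" for A B
    by (simp add: R_def vec_eq_iff)
  have "R A ** R B = mat 1" using assms R_mult R_1 by metis
  hence "R B ** R A = mat 1" by (simp add: matrix_left_right_inverse)
  thus ?thesis using R_mult R_1 R_inj by metis
qed

lemma symp_unit_square: "symp_unit ** symp_unit = - mat 1"
  by (simp add: matrix_matrix_mult_def symp_unit_def mat_def vec_eq_iff all_2_plus_2 sum_2_plus_2)

lemma matrix_neg_mult:
  fixes A B :: "'a::ring_1^'n^'n"
  shows "(- A) ** B = - (A ** B)" "A ** (- B) = - (A ** B)"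
  by (simp_all add: matrix_matrix_mult_def vec_eq_iff sum_negf)

definition sp_inv :: "int^(2+2)^(2+2) \<Rightarrow> int^(2+2)^(2+2)" where
  "sp_inv g = - (symp_unit ** (transpose g ** symp_unit))"

lemma sp_inv_left: "g \<in> Sp2Z \<Longrightarrow> sp_inv g ** g = mat 1"
  using symp_unit_square
  by (simp add: Sp2Z_def sp_inv_def matrix_neg_mult flip: matrix_mul_assoc)

lemma sp_inv_right: "g \<in> Sp2Z \<Longrightarrow> g ** sp_inv g = mat 1"
  using sp_inv_left int_matrix_left_right_inverse by blast

lemma mat_1_Sp2Z: "mat 1 \<in> Sp2Z"
  by (simp add: Sp2Z_def transpose_mat)

lemma Sp2Z_mult: "g \<in> Sp2Z \<Longrightarrow> h \<in> Sp2Z \<Longrightarrow> g ** h \<in> Sp2Z"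
  unfolding Sp2Z_def mem_Collect_eq matrix_transpose_mul
  by (metis matrix_mul_assoc)

lemma Sp2Z_inv:
  assumes g: "g \<in> Sp2Z"
  shows "sp_inv g \<in> Sp2Z"
proof -
  let ?h = "sp_inv g"
  have 1: "transpose ?h ** transpose g = mat 1"
    using sp_inv_right[OF g] by (metis matrix_transpose_mul transpose_mat)
  have "transpose ?h ** (transpose g ** symp_unit ** g) ** ?h = (transpose ?h ** transpose g) ** symp_unit ** (g ** ?h)"
    by (simp add: matrix_mul_assoc)
  also have "\<dots> = symp_unit" using 1 sp_inv_right[OF g] by simp
  finally show ?thesis using g by (simp add: Sp2Z_def)
qed

definition last_row :: "int^(2+2)^(2+2) \<Rightarrow> int \<times> int \<times> int \<times> int" where
  "last_row g = (g $ Inr 2 $ Inl 1, g $ Inr 2 $ Inl 2, g $ Inr 2 $ Inr 1, g $ Inr 2 $ Inr 2)"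

lemma last_row_nonzero: "g \<in> Sp2Z \<Longrightarrow> last_row g \<noteq> (0, 0, 0, 0)"
proof
  assume g: "g \<in> Sp2Z" and 0: "last_row g = (0, 0, 0, 0)"
  have "(g ** sp_inv g) $ Inr 2 $ Inr 2 = 0"
    using 0 by (simp add: matrix_matrix_mult_def sum_2_plus_2 last_row_def)
  thus False using sp_inv_right[OF g] by (simp add: mat_def)
qed

text \<open>
  The last row of \<open>g' g\<^bsup>-1\<^esup>\<close> is the last row of \<open>g'\<close> times \<open>g\<^bsup>-1\<^esup>\<close>. If the rows are proportional,
  it is therefore a multiple of the last row of the unit matrix.
\<close>
lemma same_coset_C21:
  assumes g: "g \<in> Sp2Z" and g': "g' \<in> Sp2Z"
    and row: "\<And>j. g' $ Inr 2 $ j = e * g $ Inr 2 $ j"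
  shows "\<exists>h\<in>C21. g' = h ** g"
proof
  have "(g' ** sp_inv g) $ Inr 2 $ j = e * (g ** sp_inv g) $ Inr 2 $ j" for j
    by (simp add: matrix_matrix_mult_def row sum_distrib_left mult.assoc)
  hence "(g' ** sp_inv g) $ Inr 2 $ j = e * (if j = Inr 2 then 1 else 0)" for j
    using sp_inv_right[OF g] by (simp add: mat_def)
  thus "g' ** sp_inv g \<in> C21"
    using Sp2Z_mult[OF g' Sp2Z_inv[OF g]] by (simp add: C21_def)
  show "g' = g' ** sp_inv g ** g"
    using sp_inv_left[OF g] by (simp flip: matrix_mul_assoc)
qed

text \<open>
  The symplectic products of the columns with index up to three do not see the last row;
  they force the two further zeros and the unimodular block that acts on the upper half plane.
\<close>
lemma C21_entries:
  assumes "h \<in> C21"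
  obtains e where "e = 1 \<or> e = (-1::int)"
    "h $ Inr 2 $ Inl 1 = 0" "h $ Inr 2 $ Inl 2 = 0" "h $ Inr 2 $ Inr 1 = 0" "h $ Inr 2 $ Inr 2 = e"
    "h $ Inl 1 $ Inl 2 = 0" "h $ Inr 1 $ Inl 2 = 0"
    "h $ Inl 1 $ Inl 1 * h $ Inr 1 $ Inr 1 - h $ Inl 1 $ Inr 1 * h $ Inr 1 $ Inl 1 = 1"
proof -
  have z: "h $ Inr 2 $ Inl 1 = 0" "h $ Inr 2 $ Inl 2 = 0" "h $ Inr 2 $ Inr 1 = 0"
    and h: "h \<in> Sp2Z" using assms by (auto simp: C21_def)
  have P: "column_pairing h i j = symp_unit $ i $ j" for i j
    using h by (simp add: Sp2Z_iff_pairing)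
  define a b c d p q where "a = h $ Inl 1 $ Inl 1" and "b = h $ Inl 1 $ Inr 1"
    and "c = h $ Inr 1 $ Inl 1" and "d = h $ Inr 1 $ Inr 1"
    and "p = h $ Inl 1 $ Inl 2" and "q = h $ Inr 1 $ Inl 2"
  note defs = a_def b_def c_def d_def p_def q_def
  have 1: "a * d - c * b = 1"
    using P[of "Inl 1" "Inr 1"] z by (simp add: column_pairing_def symp_unit_def defs)
  have 2: "a * q - c * p = 0"
    using P[of "Inl 1" "Inl 2"] z by (simp add: column_pairing_def symp_unit_def defs)
  have 3: "p * d - q * b = 0"
    using P[of "Inl 2" "Inr 1"] z by (simp add: column_pairing_def symp_unit_def defs)
  have "p = p * (a * d - c * b)" using 1 by simp
  also have "\<dots> = a * (p * d - q * b) + b * (a * q - c * p)" by (simp add: algebra_simps)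
  finally have p: "p = 0" using 2 3 by simp
  have "q = q * (a * d - c * b)" using 1 by simp
  also have "\<dots> = c * (p * d - q * b) + d * (a * q - c * p)" by (simp add: algebra_simps)
  finally have q: "q = 0" using 2 3 by simp
  have "h $ Inl 2 $ Inl 2 * h $ Inr 2 $ Inr 2 = 1"
    using P[of "Inl 2" "Inr 2"] z p q by (simp add: column_pairing_def symp_unit_def defs)
  hence "h $ Inr 2 $ Inr 2 = 1 \<or> h $ Inr 2 $ Inr 2 = - 1"
    using zmult_eq_1_iff by blast
  thus thesis
    using that[of "h $ Inr 2 $ Inr 2"] z p q 1 by (simp add: defs mult.commute)
qed

lemma mat_1_C21: "mat 1 \<in> C21"
  using mat_1_Sp2Z by (simp add: C21_def mat_def)

lemma C21_mult: "g \<in> C21 \<Longrightarrow> h \<in> C21 \<Longrightarrow> g ** h \<in> C21"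
  using Sp2Z_mult by (auto simp: C21_def matrix_matrix_mult_def sum_2_plus_2)

section \<open>Terms of the Klingen Eisenstein series\<close>

text \<open>
  The \<open>4 \<times> 2\<close> matrix with blocks \<open>A Z + B\<close> and \<open>C Z + D\<close>, that is, \<open>g\<close> applied to the stack of
  \<open>Z\<close> and the unit matrix. It is linear in \<open>g\<close>.
\<close>
definition stacked :: "int^(2+2)^(2+2) \<Rightarrow> complex^2^2 \<Rightarrow> 2+2 \<Rightarrow> 2 \<Rightarrow> complex" where
  "stacked g Z r j = of_int (g $ r $ Inl 1) * Z $ 1 $ j + of_int (g $ r $ Inl 2) * Z $ 2 $ j
     + of_int (g $ r $ Inr j)"

text \<open>
  By Cramer's rule the upper left entry of \<open>(A Z + B) (C Z + D)\<^bsup>-1\<^esup>\<close> is \<open>act_num / act_det\<close>;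
  the numerator is the corresponding entry of \<open>(A Z + B) adj (C Z + D)\<close>.
\<close>
definition act_num :: "int^(2+2)^(2+2) \<Rightarrow> complex^2^2 \<Rightarrow> complex" where
  "act_num g Z = stacked g Z (Inl 1) 1 * stacked g Z (Inr 2) 2
     - stacked g Z (Inl 1) 2 * stacked g Z (Inr 2) 1"

definition act_det :: "int^(2+2)^(2+2) \<Rightarrow> complex^2^2 \<Rightarrow> complex" where
  "act_det g Z = stacked g Z (Inr 1) 1 * stacked g Z (Inr 2) 2
     - stacked g Z (Inr 1) 2 * stacked g Z (Inr 2) 1"

lemma block_entries:
  "(blockA g ** Z + blockB g) $ i $ j = stacked g Z (Inl i) j"
  "(blockC g ** Z + blockD g) $ i $ j = stacked g Z (Inr i) j"
  by (simp_all add: blockA_def blockB_def blockC_def blockD_def matrix_matrix_mult_def sum_2 stacked_def)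

lemma det_block: "det (blockC g ** Z + blockD g) = act_det g Z"
  unfolding det_2 block_entries act_det_def ..

lemma matrix_inv_2:
  fixes M :: "complex^2^2"
  assumes "det M \<noteq> 0"
  shows "matrix_inv M $ 1 $ 1 = M $ 2 $ 2 / det M" "matrix_inv M $ 2 $ 1 = - M $ 2 $ 1 / det M"
proof -
  have "invertible M" using assms by (simp add: invertible_det_nz)
  hence 1: "M ** matrix_inv M = mat 1" unfolding invertible_def matrix_inv_def
    by (rule someI2_ex) auto
  have e: "M $ 1 $ 1 * matrix_inv M $ 1 $ 1 + M $ 1 $ 2 * matrix_inv M $ 2 $ 1 = 1"
    "M $ 2 $ 1 * matrix_inv M $ 1 $ 1 + M $ 2 $ 2 * matrix_inv M $ 2 $ 1 = 0"
    using arg_cong[OF 1, of "\<lambda>A. A $ 1 $ 1"] arg_cong[OF 1, of "\<lambda>A. A $ 2 $ 1"]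
    by (simp_all add: matrix_matrix_mult_def sum_2 mat_def)
  have "matrix_inv M $ 1 $ 1 * det M = M $ 2 $ 2"
    using e unfolding det_2 by algebra
  moreover have "matrix_inv M $ 2 $ 1 * det M = - M $ 2 $ 1"
    using e unfolding det_2 by algebra
  ultimately show "matrix_inv M $ 1 $ 1 = M $ 2 $ 2 / det M" "matrix_inv M $ 2 $ 1 = - M $ 2 $ 1 / det M"
    using assms by (simp_all add: field_simps)
qed

lemma sp_act_11:
  assumes "act_det g Z \<noteq> 0"
  shows "sp_act g Z $ 1 $ 1 = act_num g Z / act_det g Z"
proof -
  let ?N = "blockA g ** Z + blockB g" and ?M = "blockC g ** Z + blockD g"
  have dM: "det ?M \<noteq> 0" using assms unfolding det_block .
  have eq: "sp_act g Z $ 1 $ 1 = ?N $ 1 $ 1 * matrix_inv ?M $ 1 $ 1 + ?N $ 1 $ 2 * matrix_inv ?M $ 2 $ 1"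
    unfolding sp_act_def by (subst matrix_matrix_mult_def) (simp add: sum_2)
  have "sp_act g Z $ 1 $ 1 = stacked g Z (Inl 1) 1 * (stacked g Z (Inr 2) 2 / act_det g Z)
      + stacked g Z (Inl 1) 2 * (- stacked g Z (Inr 2) 1 / act_det g Z)"
    by (rule eq[unfolded matrix_inv_2[OF dM] block_entries det_block])
  thus ?thesis
    by (simp add: act_num_def diff_divide_distrib)
qed

lemma stacked_mult: "stacked (h ** g) Z r j = (\<Sum>t\<in>UNIV. of_int (h $ r $ t) * stacked g Z t j)"
  by (simp add: stacked_def matrix_matrix_mult_def sum_2_plus_2 algebra_simps)

definition klingen_term :: "int \<Rightarrow> (complex \<Rightarrow> complex) \<Rightarrow> complex^2^2 \<Rightarrow> int^(2+2)^(2+2) \<Rightarrow> complex" where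
  "klingen_term k f Z g = f (sp_act g Z $ 1 $ 1) * det (blockC g ** Z + blockD g) powi (- k)"

lemma symplectic_preserves_hermitian:
  fixes V :: "2+2 \<Rightarrow> complex"
  assumes "g \<in> Sp2Z" and "\<And>r. G r = (\<Sum>t\<in>UNIV. of_int (g $ r $ t) * V t)"
  shows "cnj (G (Inl 1)) * G (Inr 1) + cnj (G (Inl 2)) * G (Inr 2)
       - cnj (G (Inr 1)) * G (Inl 1) - cnj (G (Inr 2)) * G (Inl 2)
     = cnj (V (Inl 1)) * V (Inr 1) + cnj (V (Inl 2)) * V (Inr 2)
       - cnj (V (Inr 1)) * V (Inl 1) - cnj (V (Inr 2)) * V (Inl 2)"
proof -
  have P: "column_pairing g i j = symp_unit $ i $ j" for i j
    using assms(1) by (simp add: Sp2Z_iff_pairing)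
  have "cnj (G (Inl 1)) * G (Inr 1) + cnj (G (Inl 2)) * G (Inr 2)
       - cnj (G (Inr 1)) * G (Inl 1) - cnj (G (Inr 2)) * G (Inl 2)
     = (\<Sum>i\<in>UNIV. \<Sum>j\<in>UNIV. cnj (V i) * V j * of_int (column_pairing g i j))"
    by (simp add: assms(2) sum_2_plus_2 column_pairing_def algebra_simps)
  also have "\<dots> = (\<Sum>i\<in>UNIV. \<Sum>j\<in>UNIV. cnj (V i) * V j * of_int (symp_unit $ i $ j))"
    by (simp only: P)
  also have "\<dots> = cnj (V (Inl 1)) * V (Inr 1) + cnj (V (Inl 2)) * V (Inr 2)
       - cnj (V (Inr 1)) * V (Inl 1) - cnj (V (Inr 2)) * V (Inl 2)"
    by (simp add: sum_2_plus_2 symp_unit_def algebra_simps)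
  finally show ?thesis .
qed

text \<open>
  With \<open>p\<close> the first column of the adjugate of \<open>C Z + D\<close>, the vector \<open>(A Z + B) p\<close> has first entry
  \<open>act_num\<close> and \<open>(C Z + D) p = (act_det, 0)\<close>; the symplectic relation equates their Hermitian
  product with that of \<open>Z p\<close> and \<open>p\<close>, which is the imaginary part of \<open>Z\<close> evaluated at \<open>p\<close>.
\<close>
lemma Im_act:
  fixes \<tau> z \<tau>' :: complex
  assumes g: "g \<in> Sp2Z"
  defines "Z \<equiv> siegel_point \<tau> z \<tau>'"
  defines "p \<equiv> stacked g Z (Inr 2) 1" and "q \<equiv> stacked g Z (Inr 2) 2"
  shows "Im (cnj (act_det g Z) * act_num g Z)
    = Im \<tau> * (norm q)\<^sup>2 - 2 * Im z * Re (q * cnj p) + Im \<tau>' * (norm p)\<^sup>2"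
proof -
  define V :: "2+2 \<Rightarrow> complex" where "V = (\<lambda>t. case t of Inl i \<Rightarrow> Z $ i $ 1 * q - Z $ i $ 2 * p
    | Inr i \<Rightarrow> (if i = 1 then q else - p))"
  define G where "G r = stacked g Z r 1 * q - stacked g Z r 2 * p" for r
  have G: "G r = (\<Sum>t\<in>UNIV. of_int (g $ r $ t) * V t)" for r
    by (simp add: G_def V_def stacked_def sum_2_plus_2 algebra_simps)
  have G3: "G (Inr 2) = 0" by (simp add: G_def p_def q_def)
  have Zs: "Z $ 1 $ 1 = \<tau>" "Z $ 1 $ 2 = z" "Z $ 2 $ 1 = z" "Z $ 2 $ 2 = \<tau>'"
    by (simp_all add: Z_def siegel_point_def)
  have "cnj (G (Inl 1)) * G (Inr 1) - cnj (G (Inr 1)) * G (Inl 1)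
     = cnj (V (Inl 1)) * V (Inr 1) + cnj (V (Inl 2)) * V (Inr 2)
       - cnj (V (Inr 1)) * V (Inl 1) - cnj (V (Inr 2)) * V (Inl 2)"
    using symplectic_preserves_hermitian[OF g G] G3 by simp
  hence "Im (cnj (G (Inl 1)) * G (Inr 1) - cnj (G (Inr 1)) * G (Inl 1))
     = Im (cnj (V (Inl 1)) * V (Inr 1) + cnj (V (Inl 2)) * V (Inr 2)
       - cnj (V (Inr 1)) * V (Inl 1) - cnj (V (Inr 2)) * V (Inl 2))"
    by simp
  hence "Im (cnj (G (Inr 1)) * G (Inl 1)) =
      Im \<tau> * (norm q)\<^sup>2 - 2 * Im z * Re (q * cnj p) + Im \<tau>' * (norm p)\<^sup>2"
    unfolding cmod_power2 by (simp add: V_def Zs power2_eq_square algebra_simps)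
  thus ?thesis
    by (simp add: G_def act_det_def act_num_def p_def q_def)
qed

text \<open>
  With \<open>W = act_num / act_det\<close>, the quantity \<open>Q\<close> is \<open>Im W |act_det|\<^sup>2\<close>, so the Hecke bound for \<open>f W\<close>
  and the automorphy factor combine to a power of \<open>Q\<close>.
\<close>
lemma klingen_term_bound:
  assumes f: "\<And>\<tau>. Im \<tau> > 0 \<Longrightarrow> norm (f \<tau>) \<le> C * Im \<tau> powr (- (of_int k / 2))"
    and Q: "Im (cnj (act_det g Z) * act_num g Z) = Q" "Q > 0"
  shows "act_det g Z \<noteq> 0" "Im (act_num g Z / act_det g Z) > 0"
    "klingen_term k f Z g = f (act_num g Z / act_det g Z) * act_det g Z powi (- k)"
    "norm (klingen_term k f Z g) \<le> C * Q powr (- (of_int k / 2))"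
proof -
  show d: "act_det g Z \<noteq> 0" using Q by auto
  define W where "W = act_num g Z / act_det g Z"
  have "Im W = Q / (norm (act_det g Z))\<^sup>2"
    unfolding W_def Q(1)[symmetric] cmod_power2 by (simp add: Im_divide algebra_simps)
  hence W: "Q = Im W * (norm (act_det g Z))\<^sup>2" using d by simp
  have W0: "Im W > 0"
    using \<open>Im W = _\<close> Q(2) d by simp
  thus "Im (act_num g Z / act_det g Z) > 0" by (simp add: W_def)
  show eq: "klingen_term k f Z g = f (act_num g Z / act_det g Z) * act_det g Z powi (- k)"
    by (simp add: klingen_term_def sp_act_11[OF d] det_block)
  have "((norm (act_det g Z))\<^sup>2) powr (- (of_int k / 2)) = norm (act_det g Z) powr (- of_int k)"
    using d by (simp add: powr_powr flip: powr_numeral)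
  also have "\<dots> = norm (act_det g Z) powi (- k)"
    using d powr_real_of_int'[of "norm (act_det g Z)" "- k"] by simp
  finally have "Q powr (- (of_int k / 2)) = Im W powr (- (of_int k / 2)) * norm (act_det g Z) powi (- k)"
    unfolding W using W0 by (simp add: powr_mult)
  moreover have "norm (f W) * norm (act_det g Z) powi (- k)
      \<le> C * Im W powr (- (of_int k / 2)) * norm (act_det g Z) powi (- k)"
    using f[OF W0] by (rule mult_right_mono) simp
  ultimately show "norm (klingen_term k f Z g) \<le> C * Q powr (- (of_int k / 2))"
    unfolding eq W_def[symmetric] by (simp add: norm_mult norm_power_int mult.assoc)
qed

text \<open>
  An element of the parabolic multiplies the last row by a sign and acts on
  \<open>(act_num, act_det)\<close>, up to that sign, through its unimodular block; the modularity of \<open>f\<close>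
  and the evenness of \<open>k\<close> absorb both.
\<close>
lemma klingen_term_C21_invariant:
  assumes h: "h \<in> C21" and "even k"
    and f: "\<And>p q r s \<tau>. p * s - q * r = (1::int) \<Longrightarrow> Im \<tau> > 0 \<Longrightarrow>
       f ((of_int p * \<tau> + of_int q) / (of_int r * \<tau> + of_int s)) = (of_int r * \<tau> + of_int s) powi k * f \<tau>"
    and d: "act_det g Z \<noteq> 0" and W: "Im (act_num g Z / act_det g Z) > 0"
  shows "klingen_term k f Z (h ** g) = klingen_term k f Z g"
proof -
  obtain e where e: "e = 1 \<or> e = (-1::int)"
    and z: "h $ Inr 2 $ Inl 1 = 0" "h $ Inr 2 $ Inl 2 = 0" "h $ Inr 2 $ Inr 1 = 0" "h $ Inr 2 $ Inr 2 = e"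
    "h $ Inl 1 $ Inl 2 = 0" "h $ Inr 1 $ Inl 2 = 0"
    and det: "h $ Inl 1 $ Inl 1 * h $ Inr 1 $ Inr 1 - h $ Inl 1 $ Inr 1 * h $ Inr 1 $ Inl 1 = 1"
    using C21_entries[OF h] by metis
  define p q r s where "p = h $ Inl 1 $ Inl 1" and "q = h $ Inl 1 $ Inr 1"
    and "r = h $ Inr 1 $ Inl 1" and "s = h $ Inr 1 $ Inr 1"
  define X D where "X = act_num g Z" and "D = act_det g Z"
  have num: "act_num (h ** g) Z = of_int e * (of_int p * X + of_int q * D)"
    and den: "act_det (h ** g) Z = of_int e * (of_int r * X + of_int s * D)"
    unfolding act_num_def act_det_def stacked_mult sum_2_plus_2 X_def D_def p_def q_def r_def s_def
    by (simp_all add: z algebra_simps)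
  define W where "W = X / D"
  have D: "D \<noteq> 0" "Im W > 0" using d W by (auto simp: D_def W_def X_def)
  have X: "X = W * D" using D by (simp add: W_def)
  have j: "of_int r * W + of_int s \<noteq> 0"
  proof
    assume 0: "of_int r * W + of_int s = 0"
    hence "of_int r * Im W = 0" by (auto simp: complex_eq_iff)
    hence "r = 0" using D by simp
    with 0 det show False by (simp add: p_def q_def r_def s_def)
  qed
  have den': "act_det (h ** g) Z = of_int e * D * (of_int r * W + of_int s)"
    unfolding den X by (simp add: algebra_simps)
  have num': "act_num (h ** g) Z = of_int e * D * (of_int p * W + of_int q)"
    unfolding num X by (simp add: algebra_simps)
  have nz: "act_det (h ** g) Z \<noteq> 0" using D j e by (auto simp: den')
  have "act_num (h ** g) Z / act_det (h ** g) Z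
     = (of_int p * W + of_int q) / (of_int r * W + of_int s)"
    using D e by (auto simp: num' den')
  hence "klingen_term k f Z (h ** g) = f ((of_int p * W + of_int q) / (of_int r * W + of_int s))
      * act_det (h ** g) Z powi (- k)"
    by (simp add: klingen_term_def sp_act_11[OF nz] det_block)
  also have "f ((of_int p * W + of_int q) / (of_int r * W + of_int s)) = (of_int r * W + of_int s) powi k * f W"
    using det D by (intro f) (auto simp: p_def q_def r_def s_def)
  also have "act_det (h ** g) Z powi (- k) = D powi (- k) * (of_int r * W + of_int s) powi (- k)"
    using e \<open>even k\<close> by (auto simp: den' power_int_mult_distrib power_int_minus_left)
  also have "(of_int r * W + of_int s) powi k * f W * (D powi (- k) * (of_int r * W + of_int s) powi (- k))
    = f W * D powi (- k)"
    using j by (simp add: power_int_minus field_simps)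
  also have "\<dots> = klingen_term k f Z g"
    by (simp add: klingen_term_def sp_act_11[OF d] det_block W_def X_def D_def)
  finally show ?thesis .
qed

section \<open>The degeneration of the Klingen Eisenstein series\<close>

text \<open>
  The imaginary part is \<open>y\<close> times the square of the linear form \<open>x\<^sub>1 + \<sigma> x\<^sub>2\<close> plus \<open>x\<^sub>2 ^ 2\<close>. As \<open>y\<close>
  grows it stays bounded only in the direction of \<open>(- \<sigma>, 1)\<close>. The coordinate \<open>u\<close> is the real part of
  \<open>\<tau>'\<close>, the variable of the Fourier-Jacobi expansion.
\<close>
definition degenerate_point :: "real \<Rightarrow> real \<Rightarrow> real \<Rightarrow> complex^2^2" where
  "degenerate_point \<sigma> y u = siegel_point (\<i> * of_real y) (of_real \<sigma> * (\<i> * of_real y))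
     (of_real u + \<i> * of_real (\<sigma>\<^sup>2 * y + 1))"

lemma degenerate_point_in_half_space:
  assumes "y > 0"
  shows "degenerate_point \<sigma> y u \<in> siegel_half_space"
  unfolding siegel_half_space_def mem_Collect_eq
proof (intro conjI allI impI)
  show "transpose (degenerate_point \<sigma> y u) = degenerate_point \<sigma> y u"
    by (simp add: degenerate_point_def siegel_point_def transpose_def vec_eq_iff forall_2)
  fix x :: "real^2" assume "x \<noteq> 0"
  hence x: "x $ 1 \<noteq> 0 \<or> x $ 2 \<noteq> 0" by (auto simp: vec_eq_iff forall_2)
  have "x \<bullet> ((\<chi> i j. Im (degenerate_point \<sigma> y u $ i $ j)) *v x) = y * (x $ 1 + \<sigma> * x $ 2)\<^sup>2 + (x $ 2)\<^sup>2"
    by (simp add: inner_vec_def sum_2 matrix_vector_mult_def degenerate_point_def siegel_point_def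
        power2_eq_square algebra_simps)
  also have "\<dots> > 0"
  proof (cases "x $ 2 = 0")
    case True
    thus ?thesis using x assms by simp
  next
    case False
    thus ?thesis using assms by (intro add_nonneg_pos) auto
  qed
  finally show "x \<bullet> ((\<chi> i j. Im (degenerate_point \<sigma> y u $ i $ j)) *v x) > 0" .
qed

text \<open>
  The value of \<open>Im_act\<close> at a degenerate point as a quadratic form in the last row \<open>(c\<^sub>1, c\<^sub>2, d\<^sub>1, d\<^sub>2)\<close>.
\<close>
definition row_form :: "real \<Rightarrow> real \<Rightarrow> real \<Rightarrow> int \<times> int \<times> int \<times> int \<Rightarrow> real" where
  "row_form \<sigma> y u = (\<lambda>(c1, c2, d1, d2). y * ((of_int c2 * u + of_int d2 - \<sigma> * of_int d1)\<^sup>2 + (of_int c2)\<^sup>2)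
     + (of_int d1)\<^sup>2 + y\<^sup>2 * (of_int c1 + \<sigma> * of_int c2)\<^sup>2)"

lemma Im_act_degenerate:
  assumes "g \<in> Sp2Z"
  shows "Im (cnj (act_det g (degenerate_point \<sigma> y u)) * act_num g (degenerate_point \<sigma> y u))
    = row_form \<sigma> y u (last_row g)"
  unfolding degenerate_point_def Im_act[OF assms] cmod_power2
  by (simp add: stacked_def siegel_point_def row_form_def last_row_def power2_eq_square algebra_simps)

text \<open>
  For \<open>y \<ge> 1\<close> the form dominates the sum of the squares of four linear forms in the row that do not
  involve \<open>y\<close> and from which the coordinates are recovered with bounded coefficients. With \<open>R\<close> the
  square root of the form, the coordinates are at most \<open>3 R\<close>, and \<open>1 \<le> 3 R\<close> because one of them is a
  nonzero integer; this gives the constant \<open>1296 = 6 ^ 4\<close>.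
\<close>
lemma row_form_lower_bound:
  assumes y: "1 \<le> y" and u: "0 \<le> u" "u \<le> 1" and \<sigma>: "0 \<le> \<sigma>" "\<sigma> \<le> 1"
    and nz: "(c1, c2, d1, d2) \<noteq> (0, 0, 0, 0)"
  defines "Q \<equiv> row_form \<sigma> y u (c1, c2, d1, d2)"
  shows "Q > 0"
    "(1 + \<bar>real_of_int c1\<bar>) * (1 + \<bar>real_of_int c2\<bar>) * (1 + \<bar>real_of_int d1\<bar>) * (1 + \<bar>real_of_int d2\<bar>)
       \<le> 1296 * Q\<^sup>2"
proof -
  define R where "R = sqrt Q"
  define l where "l = of_int c2 * u + of_int d2 - \<sigma> * of_int d1"
  define l' where "l' = of_int c1 + \<sigma> * of_int c2"
  have y2: "1 \<le> y\<^sup>2" using y by simp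
  have Q: "l\<^sup>2 + (of_int c2)\<^sup>2 + (of_int d1)\<^sup>2 + l'\<^sup>2 \<le> Q"
  proof -
    have "1 * (l\<^sup>2 + (of_int c2)\<^sup>2) \<le> y * (l\<^sup>2 + (of_int c2)\<^sup>2)"
      using y by (intro mult_right_mono) auto
    moreover have "1 * l'\<^sup>2 \<le> y\<^sup>2 * l'\<^sup>2"
      using y2 by (intro mult_right_mono) auto
    ultimately show ?thesis by (simp add: Q_def row_form_def l_def l'_def)
  qed
  have sq: "0 \<le> l\<^sup>2" "0 \<le> (real_of_int c2)\<^sup>2" "0 \<le> (real_of_int d1)\<^sup>2" "0 \<le> l'\<^sup>2" by simp_all
  have Q0: "Q \<ge> 0" using Q sq by linarith
  have R: "\<bar>x\<bar> \<le> R" if "x\<^sup>2 \<le> Q" for x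
    unfolding R_def using that real_le_rsqrt[of "\<bar>x\<bar>" Q] by simp
  have c2: "\<bar>real_of_int c2\<bar> \<le> R" and d1: "\<bar>real_of_int d1\<bar> \<le> R" and l: "\<bar>l\<bar> \<le> R" and l': "\<bar>l'\<bar> \<le> R"
    using Q sq by (intro R; linarith)+
  have R0: "R \<ge> 0" by (simp add: R_def Q0)
  have m: "\<bar>\<sigma> * x\<bar> \<le> \<bar>x\<bar>" "\<bar>x * u\<bar> \<le> \<bar>x\<bar>" for x :: real
    using \<sigma> u mult_right_mono[of \<sigma> 1 "\<bar>x\<bar>"] mult_left_mono[of u 1 "\<bar>x\<bar>"] by (auto simp: abs_mult)
  have c1: "\<bar>real_of_int c1\<bar> \<le> 2 * R"
    using l' c2 m(1)[of "of_int c2"] unfolding l'_def by linarith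
  have d2: "\<bar>real_of_int d2\<bar> \<le> 3 * R"
    using l c2 d1 m(1)[of "of_int d1"] m(2)[of "of_int c2"] unfolding l_def by linarith
  have "1 \<le> \<bar>c1\<bar> \<or> 1 \<le> \<bar>c2\<bar> \<or> 1 \<le> \<bar>d1\<bar> \<or> 1 \<le> \<bar>d2\<bar>" using nz by auto
  hence "1 \<le> \<bar>real_of_int c1\<bar> \<or> 1 \<le> \<bar>real_of_int c2\<bar> \<or> 1 \<le> \<bar>real_of_int d1\<bar> \<or> 1 \<le> \<bar>real_of_int d2\<bar>"
    by linarith
  hence R3: "1 \<le> 3 * R" using c1 c2 d1 d2 R0 by linarith
  hence "R > 0" by linarith
  thus "Q > 0" by (simp add: R_def)
  have "(1 + \<bar>real_of_int c1\<bar>) * (1 + \<bar>real_of_int c2\<bar>) * (1 + \<bar>real_of_int d1\<bar>) * (1 + \<bar>real_of_int d2\<bar>)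
     \<le> (6 * R) * (6 * R) * (6 * R) * (6 * R)"
    using c1 c2 d1 d2 R3 R0 by (intro mult_mono mult_nonneg_nonneg) linarith+
  also have "\<dots> = 1296 * (R\<^sup>2)\<^sup>2" by (simp add: power2_eq_square)
  also have "R\<^sup>2 = Q" using Q0 by (simp add: R_def)
  finally show "(1 + \<bar>real_of_int c1\<bar>) * (1 + \<bar>real_of_int c2\<bar>) * (1 + \<bar>real_of_int d1\<bar>) * (1 + \<bar>real_of_int d2\<bar>)
     \<le> 1296 * Q\<^sup>2" .
qed

definition row_majorant :: "real \<Rightarrow> real \<Rightarrow> int \<times> int \<times> int \<times> int \<Rightarrow> real" where
  "row_majorant C p = (\<lambda>(c1, c2, d1, d2). C * 1296 powr p *
     (int_decay p c1 * (int_decay p c2 * (int_decay p d1 * int_decay p d2))))"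

lemma summable_row_majorant:
  assumes "C = 0 \<or> p > 1"
  shows "row_majorant C p summable_on UNIV"
proof (cases "C = 0")
  case True
  hence "row_majorant C p = (\<lambda>_. 0)" by (auto simp: row_majorant_def)
  thus ?thesis by simp
next
  case False
  hence p: "p > 1" using assms by simp
  note s = summable_int_decay[OF p]
  have "(\<lambda>(c1, c2, d1, d2). int_decay p c1 * (int_decay p c2 * (int_decay p d1 * int_decay p d2)))
      summable_on UNIV \<times> UNIV \<times> UNIV \<times> UNIV"
    using summable_on_times_nonneg[OF s summable_on_times_nonneg[OF s summable_on_times_nonneg[OF s s]]]
    by (simp add: case_prod_unfold)
  from summable_on_cmult_right[OF this, of "C * 1296 powr p"] show ?thesis
    by (simp add: row_majorant_def case_prod_unfold)
qed

lemma row_form_powr_le_majorant: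
  assumes "1 \<le> y" "0 \<le> u" "u \<le> 1" "0 \<le> \<sigma>" "\<sigma> \<le> 1" "r \<noteq> (0, 0, 0, 0)" "C \<ge> 0" "C = 0 \<or> p > 1"
  shows "C * row_form \<sigma> y u r powr (- (2 * p)) \<le> row_majorant C p r"
proof (cases "C = 0")
  case True
  thus ?thesis by (auto simp: row_majorant_def case_prod_beta)
next
  case False
  hence p: "p > 1" using assms by simp
  obtain c1 c2 d1 d2 where r: "r = (c1, c2, d1, d2)" by (cases r)
  define Q where "Q = row_form \<sigma> y u r"
  define P where "P = (1 + \<bar>real_of_int c1\<bar>) * (1 + \<bar>real_of_int c2\<bar>) * (1 + \<bar>real_of_int d1\<bar>) * (1 + \<bar>real_of_int d2\<bar>)"
  have Q: "Q > 0" "P \<le> 1296 * Q\<^sup>2"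
    using row_form_lower_bound[OF assms(1-5), of c1 c2 d1 d2] assms(6) by (simp_all add: Q_def P_def r)
  have P: "P > 0" unfolding P_def by (intro mult_pos_pos) auto
  have "Q powr (- (2 * p)) = (Q\<^sup>2) powr (- p)"
    using Q by (simp add: powr_powr flip: powr_numeral)
  also have "\<dots> \<le> (P / 1296) powr (- p)"
    using Q P p by (intro powr_mono2') auto
  also have "\<dots> = 1296 powr p * P powr (- p)"
    using P by (simp add: powr_divide powr_minus field_simps)
  also have "P powr (- p) = int_decay p c1 * (int_decay p c2 * (int_decay p d1 * int_decay p d2))"
    by (simp add: P_def int_decay_def powr_mult)
  finally show ?thesis
    using assms(7) by (simp add: row_majorant_def r Q_def mult_left_mono mult.assoc)
qed

text \<open>
  All summands that carry a factor \<open>y\<close> vanish only if \<open>c = 0\<close> and \<open>d\<close> is proportional to \<open>(1, \<sigma>)\<close>.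
\<close>
lemma row_form_growth:
  assumes ne: "\<not> (c1 = 0 \<and> c2 = 0 \<and> \<sigma> * of_int d1 = of_int d2)"
  shows "\<exists>\<delta>>0. \<forall>y\<ge>1. y * \<delta> \<le> row_form \<sigma> y u (c1, c2, d1, d2)"
proof -
  define l where "l = of_int c2 * u + of_int d2 - \<sigma> * of_int d1"
  define l' where "l' = of_int c1 + \<sigma> * of_int c2"
  define \<delta> where "\<delta> = l\<^sup>2 + (of_int c2)\<^sup>2 + l'\<^sup>2"
  have "\<delta> \<noteq> 0"
  proof
    assume "\<delta> = 0"
    moreover have "0 \<le> l\<^sup>2" "0 \<le> (real_of_int c2)\<^sup>2" "0 \<le> l'\<^sup>2" by simp_all
    ultimately have "l\<^sup>2 = 0" "(real_of_int c2)\<^sup>2 = 0" "l'\<^sup>2 = 0" unfolding \<delta>_def by linarith+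
    thus False using ne by (simp add: l_def l'_def)
  qed
  moreover have "\<delta> \<ge> 0" by (simp add: \<delta>_def)
  ultimately have "\<delta> > 0" by simp
  moreover have "y * \<delta> \<le> row_form \<sigma> y u (c1, c2, d1, d2)" if "y \<ge> 1" for y
  proof -
    have "y \<le> y\<^sup>2" using that by (simp add: power2_eq_square)
    hence "y * l'\<^sup>2 \<le> y\<^sup>2 * l'\<^sup>2" by (rule mult_right_mono) simp
    hence "y * \<delta> \<le> y * (l\<^sup>2 + (of_int c2)\<^sup>2) + (of_int d1)\<^sup>2 + y\<^sup>2 * l'\<^sup>2"
      by (simp add: \<delta>_def distrib_left add_increasing)
    thus ?thesis by (simp add: row_form_def l_def l'_def)
  qed
  ultimately show ?thesis by blast
qed

text \<open>
  The coset sum is kept as a sum over cosets and majorized through the injection that sends a coset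
  to the last row of its chosen representative.
\<close>
definition C21_cosets :: "(int^(2+2)^(2+2)) set set" where
  "C21_cosets = (\<lambda>g. (\<lambda>h. h ** g) ` C21) ` Sp2Z"

definition coset_rep :: "'a set \<Rightarrow> 'a" where
  "coset_rep X = (SOME g. g \<in> X)"

lemma klingen_eisenstein_eq:
  "klingen_eisenstein k f Z = (\<Sum>\<^sub>\<infinity>X\<in>C21_cosets. klingen_term k f Z (coset_rep X))"
  by (simp add: klingen_eisenstein_def coset_sum_def C21_cosets_def klingen_term_def coset_rep_def)

text \<open>
  A sign is its own inverse, so \<open>same_coset_C21\<close> applies in both directions.
\<close>
lemma C21_coset_eqI:
  assumes g: "g \<in> Sp2Z" and g': "g' \<in> Sp2Z" and e: "e = 1 \<or> e = (-1::int)"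
    and row: "\<And>j. g' $ Inr 2 $ j = e * g $ Inr 2 $ j"
  shows "(\<lambda>h. h ** g') ` C21 = (\<lambda>h. h ** g) ` C21"
proof -
  have row': "g $ Inr 2 $ j = e * g' $ Inr 2 $ j" for j
    using e row[of j] by auto
  obtain h h' where h: "h \<in> C21" "g' = h ** g" and h': "h' \<in> C21" "g = h' ** g'"
    using same_coset_C21[OF g g' row] same_coset_C21[OF g' g row'] by metis
  have "x ** g' \<in> (\<lambda>h. h ** g) ` C21" if "x \<in> C21" for x
    using C21_mult[OF that h(1)] h(2) by (auto simp: image_iff matrix_mul_assoc)
  moreover have "x ** g \<in> (\<lambda>h. h ** g') ` C21" if "x \<in> C21" for x
    using C21_mult[OF that h'(1)] h'(2) by (auto simp: image_iff) (metis matrix_mul_assoc)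
  ultimately show ?thesis by blast
qed

lemma coset_rep_C21:
  assumes "X \<in> C21_cosets"
  shows "coset_rep X \<in> X" "coset_rep X \<in> Sp2Z" "X = (\<lambda>h. h ** coset_rep X) ` C21"
proof -
  obtain g where g: "g \<in> Sp2Z" "X = (\<lambda>h. h ** g) ` C21"
    using assms by (auto simp: C21_cosets_def)
  have "mat 1 ** g \<in> X" using mat_1_C21 g(2) by blast
  thus in_X: "coset_rep X \<in> X" unfolding coset_rep_def by (rule someI)
  then obtain h where h: "h \<in> C21" "coset_rep X = h ** g" using g(2) by auto
  show rep: "coset_rep X \<in> Sp2Z"
    using h g(1) Sp2Z_mult by (auto simp: C21_def)
  obtain e where e: "e = 1 \<or> e = (-1::int)" and
    "h $ Inr 2 $ Inl 1 = 0" "h $ Inr 2 $ Inl 2 = 0" "h $ Inr 2 $ Inr 1 = 0" "h $ Inr 2 $ Inr 2 = e"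
    using C21_entries[OF h(1)] by metis
  hence "coset_rep X $ Inr 2 $ j = e * g $ Inr 2 $ j" for j
    unfolding h(2) by (simp add: matrix_matrix_mult_def sum_2_plus_2)
  from C21_coset_eqI[OF g(1) rep e this] show "X = (\<lambda>h. h ** coset_rep X) ` C21"
    using g(2) by simp
qed

lemma last_row_eq_iff: "last_row g = last_row g' \<longleftrightarrow> (\<forall>j. g $ Inr 2 $ j = g' $ Inr 2 $ j)"
  by (auto simp: last_row_def all_2_plus_2)

lemma inj_on_last_row: "inj_on (\<lambda>X. last_row (coset_rep X)) C21_cosets"
proof (rule inj_onI)
  fix X Y assume X: "X \<in> C21_cosets" and Y: "Y \<in> C21_cosets"
    and eq: "last_row (coset_rep X) = last_row (coset_rep Y)"
  have "(\<lambda>h. h ** coset_rep X) ` C21 = (\<lambda>h. h ** coset_rep Y) ` C21"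
    using eq coset_rep_C21(2)[OF X] coset_rep_C21(2)[OF Y]
    by (intro C21_coset_eqI[where e = 1]) (auto simp: last_row_eq_iff)
  thus "X = Y" using coset_rep_C21(3)[OF X] coset_rep_C21(3)[OF Y] by simp
qed

text \<open>
  The block diagonal element with blocks \<open>U\<close> and its inverse transpose, where
  \<open>U = (q, -p; x, w)\<close> has determinant one.
\<close>
definition levi_element :: "int \<Rightarrow> int \<Rightarrow> int \<Rightarrow> int \<Rightarrow> int^(2+2)^(2+2)" where
  "levi_element p q x w = (\<chi> i j. case (i, j) of
      (Inl i, Inl j) \<Rightarrow> (if i = 1 then (if j = 1 then q else - p) else (if j = 1 then x else w))
    | (Inr i, Inr j) \<Rightarrow> (if i = 1 then (if j = 1 then w else - x) else (if j = 1 then p else q))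
    | _ \<Rightarrow> 0)"

lemma levi_element_Sp2Z:
  assumes "q * w + p * x = 1"
  shows "levi_element p q x w \<in> Sp2Z"
  using assms unfolding Sp2Z_iff_pairing all_2_plus_2
  by (simp add: column_pairing_def levi_element_def symp_unit_def algebra_simps)

lemma levi_element_act:
  assumes "q * w + p * x = 1" and \<sigma>: "of_int q = of_int p * \<sigma>"
  shows "act_det (levi_element p q x w) (degenerate_point \<sigma> y u) = 1"
    "act_num (levi_element p q x w) (degenerate_point \<sigma> y u) = (of_int p)\<^sup>2 * (of_real u + \<i>)"
proof -
  have "complex_of_int w * of_int q + of_int x * of_int p = of_int (q * w + p * x)" by simp
  thus "act_det (levi_element p q x w) (degenerate_point \<sigma> y u) = 1"
    unfolding assms(1) by (simp add: act_det_def stacked_def levi_element_def)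
  have q: "complex_of_int q = of_int p * of_real \<sigma>"
    using \<sigma> by (metis of_real_mult of_real_of_int_eq)
  show "act_num (levi_element p q x w) (degenerate_point \<sigma> y u) = (of_int p)\<^sup>2 * (of_real u + \<i>)"
    by (simp add: act_num_def stacked_def levi_element_def degenerate_point_def siegel_point_def q
        power2_eq_square algebra_simps)
qed

text \<open>
  As \<open>y\<close> grows, all terms tend to zero except the one of the coset of \<open>levi_element\<close>, whose last row
  \<open>(0, 0, p, q)\<close> is the primitive one proportional to \<open>(0, 0, 1, \<sigma>)\<close>. That term does not depend on
  \<open>y\<close>. The row majorant permits to take the limit termwise, and bounds the series uniformly in \<open>u\<close>.
\<close>
lemma klingen_eisenstein_degenerates:
  assumes "even k" and f: "f \<in> cusp_forms k"
    and p: "p \<ge> (1::int)" and pq: "coprime p q"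
    and \<sigma>: "of_int q = of_int p * \<sigma>" "0 \<le> \<sigma>" "\<sigma> \<le> 1"
  obtains K where
    "\<And>y u. 1 \<le> y \<Longrightarrow> 0 \<le> u \<Longrightarrow> u \<le> 1 \<Longrightarrow> norm (klingen_eisenstein k f (degenerate_point \<sigma> y u)) \<le> K"
    "\<And>u. 0 \<le> u \<Longrightarrow> u \<le> 1 \<Longrightarrow> (\<lambda>n. klingen_eisenstein k f (degenerate_point \<sigma> (real (Suc n)) u))
         \<longlonglongrightarrow> f ((of_int p)\<^sup>2 * (of_real u + \<i>))"
proof -
  obtain C where C: "C \<ge> 0" "k \<le> 4 \<Longrightarrow> C = 0"
    and fC: "\<And>\<tau>. Im \<tau> > 0 \<Longrightarrow> norm (f \<tau>) \<le> C * Im \<tau> powr (- (of_int k / 2))"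
    using cusp_form_bound[OF f] by metis
  define P where "P = of_int k / (4 :: real)"
  have CP: "C = 0 \<or> P > 1" using C(2) by (force simp: P_def)
  define B where "B = (\<lambda>X. row_majorant C P (last_row (coset_rep X)))"
  have sumB: "B summable_on C21_cosets"
  proof -
    have "row_majorant C P summable_on (\<lambda>X. last_row (coset_rep X)) ` C21_cosets"
      using summable_row_majorant[OF CP] by (rule summable_on_subset_banach) auto
    thus ?thesis
      unfolding summable_on_reindex[OF inj_on_last_row] by (simp add: B_def o_def)
  qed
  note mod = cusp_form_modular[OF f]
  have row_pos: "row_form \<sigma> y u (last_row g) > 0" if "g \<in> Sp2Z" "1 \<le> y" "0 \<le> u" "u \<le> 1" for g y u
    using row_form_lower_bound(1)[OF that(2-4) \<sigma>(2,3)] last_row_nonzero[OF that(1)]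
    by (cases "last_row g") auto
  have bound: "norm (klingen_term k f (degenerate_point \<sigma> y u) g)
      \<le> C * row_form \<sigma> y u (last_row g) powr (- (2 * P))"
    if "g \<in> Sp2Z" "1 \<le> y" "0 \<le> u" "u \<le> 1" for g y u
    using klingen_term_bound(4)[OF fC Im_act_degenerate[OF that(1)] row_pos[OF that]]
    by (simp add: P_def)
  have le_B: "norm (klingen_term k f (degenerate_point \<sigma> y u) (coset_rep X)) \<le> B X"
    if "X \<in> C21_cosets" "1 \<le> y" "0 \<le> u" "u \<le> 1" for X y u
  proof -
    note g = coset_rep_C21(2)[OF that(1)]
    show ?thesis
      unfolding B_def
      using bound[OF g that(2-4)] row_form_powr_le_majorant[OF that(2-4) \<sigma>(2,3) last_row_nonzero[OF g] C(1) CP]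
      by linarith
  qed
  obtain x w where xw: "q * w + p * x = 1"
    using pq by (metis bezout_int coprime_imp_gcd_eq_1 mult.commute add.commute)
  define g0 where "g0 = levi_element p q x w"
  have g0: "g0 \<in> Sp2Z" unfolding g0_def by (rule levi_element_Sp2Z[OF xw])
  define X0 where "X0 = (\<lambda>h. h ** g0) ` C21"
  have X0: "X0 \<in> C21_cosets" using g0 by (auto simp: X0_def C21_cosets_def)
  have row0: "last_row g0 = (0, 0, p, q)"
    by (simp add: g0_def last_row_def levi_element_def)
  have main_term: "klingen_term k f (degenerate_point \<sigma> y u) (coset_rep X0) = f ((of_int p)\<^sup>2 * (of_real u + \<i>))"
    if yu: "1 \<le> y" "0 \<le> u" "u \<le> 1" for y u
  proof -
    obtain h where h: "h \<in> C21" "coset_rep X0 = h ** g0"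
      using coset_rep_C21(1)[OF X0] by (auto simp: X0_def)
    note b = klingen_term_bound[OF fC Im_act_degenerate[OF g0] row_pos[OF g0 yu]]
    have "klingen_term k f (degenerate_point \<sigma> y u) (coset_rep X0) = klingen_term k f (degenerate_point \<sigma> y u) g0"
      unfolding h(2) by (rule klingen_term_C21_invariant[OF h(1) \<open>even k\<close> mod b(1,2)])
    also have "\<dots> = f ((of_int p)\<^sup>2 * (of_real u + \<i>))"
      using b(3) levi_element_act[OF xw \<sigma>(1), of y u] unfolding g0_def by simp
    finally show ?thesis .
  qed
  have other_terms: "(\<lambda>n. klingen_term k f (degenerate_point \<sigma> (real (Suc n)) u) (coset_rep X)) \<longlonglongrightarrow> 0"
    if X: "X \<in> C21_cosets" "X \<noteq> X0" and u: "0 \<le> u" "u \<le> 1" for X u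
  proof (cases "C = 0")
    case True
    thus ?thesis
      using bound[OF coset_rep_C21(2)[OF X(1)] _ u] by simp
  next
    case False
    hence P: "P > 0" using CP by simp
    note g = coset_rep_C21(2)[OF X(1)]
    obtain c1 c2 d1 d2 where r: "last_row (coset_rep X) = (c1, c2, d1, d2)"
      by (cases "last_row (coset_rep X)")
    have "\<not> (c1 = 0 \<and> c2 = 0 \<and> \<sigma> * of_int d1 = of_int d2)"
    proof
      assume 0: "c1 = 0 \<and> c2 = 0 \<and> \<sigma> * of_int d1 = of_int d2"
      hence "of_int p * (\<sigma> * of_int d1) = of_int p * (of_int d2 :: real)" by simp
      hence "real_of_int (q * d1) = of_int (p * d2)" using \<sigma>(1) by (simp add: mult.assoc)
      hence qd: "q * d1 = p * d2" by linarith
      hence "p dvd q * d1" by simp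
      hence "p dvd d1" using pq by (simp add: coprime_dvd_mult_right_iff)
      then obtain e where e: "d1 = e * p" by (metis dvd_def mult.commute)
      hence e2: "d2 = e * q" using qd p by (simp add: algebra_simps)
      have row: "coset_rep X $ Inr 2 $ j = e * g0 $ Inr 2 $ j" for j
      proof -
        have "\<forall>j. coset_rep X $ Inr 2 $ j = e * g0 $ Inr 2 $ j"
          using r row0 0 e e2 unfolding all_2_plus_2 last_row_def by auto
        thus ?thesis by blast
      qed
      obtain h where h: "h \<in> C21" "coset_rep X = h ** g0"
        using same_coset_C21[OF g0 g row] by blast
      obtain e' where e': "e' = 1 \<or> e' = (-1::int)" and
        "h $ Inr 2 $ Inl 1 = 0" "h $ Inr 2 $ Inl 2 = 0" "h $ Inr 2 $ Inr 1 = 0" "h $ Inr 2 $ Inr 2 = e'"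
        using C21_entries[OF h(1)] by metis
      hence "coset_rep X $ Inr 2 $ j = e' * g0 $ Inr 2 $ j" for j
        unfolding h(2) by (simp add: matrix_matrix_mult_def sum_2_plus_2)
      from C21_coset_eqI[OF g0 g e' this] have "X = X0"
        using coset_rep_C21(3)[OF X(1)] by (simp add: X0_def)
      thus False using X(2) by simp
    qed
    then obtain \<delta> where \<delta>: "\<delta> > 0" "\<And>y. y \<ge> 1 \<Longrightarrow> y * \<delta> \<le> row_form \<sigma> y u (last_row (coset_rep X))"
      unfolding r using row_form_growth by metis
    have le: "norm (klingen_term k f (degenerate_point \<sigma> (real (Suc n)) u) (coset_rep X))
        \<le> C * (real (Suc n) * \<delta>) powr (- (2 * P))" for n
    proof -
      have "row_form \<sigma> (real (Suc n)) u (last_row (coset_rep X)) powr (- (2 * P))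
          \<le> (real (Suc n) * \<delta>) powr (- (2 * P))"
        using \<delta>(1) \<delta>(2)[of "real (Suc n)"] P by (intro powr_mono2') auto
      thus ?thesis
        using bound[OF g _ u, of "real (Suc n)"] mult_left_mono[OF _ C(1)] by fastforce
    qed
    have "filterlim (\<lambda>n. real (Suc n) * \<delta>) at_top sequentially"
      using \<delta>(1) by (intro filterlim_at_top_mult_tendsto_pos[OF tendsto_const]
          filterlim_compose[OF filterlim_real_sequentially filterlim_Suc]) 
    hence "(\<lambda>n. C * (real (Suc n) * \<delta>) powr (- (2 * P))) \<longlonglongrightarrow> C * 0"
      using P by (intro tendsto_mult_left tendsto_neg_powr) auto
    hence "(\<lambda>n. C * (real (Suc n) * \<delta>) powr (- (2 * P))) \<longlonglongrightarrow> 0" by simp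
    thus ?thesis
      by (rule Lim_null_comparison[rotated]) (use le in auto)
  qed
  show thesis
  proof (rule that[of "infsum B C21_cosets"])
    show "norm (klingen_eisenstein k f (degenerate_point \<sigma> y u)) \<le> infsum B C21_cosets"
      if "1 \<le> y" "0 \<le> u" "u \<le> 1" for y u
    proof -
      have "(\<lambda>X. norm (klingen_term k f (degenerate_point \<sigma> y u) (coset_rep X))) summable_on C21_cosets"
        using sumB le_B[OF _ that] by (rule Infinite_Sum.abs_summable_on_comparison_test')
      hence s: "(\<lambda>X. klingen_term k f (degenerate_point \<sigma> y u) (coset_rep X)) summable_on C21_cosets"
        by (rule abs_summable_summable)
      show ?thesis unfolding klingen_eisenstein_eq
        by (rule norm_infsum_le[OF has_sum_infsum[OF s] has_sum_infsum[OF sumB] le_B[OF _ that]])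
    qed
    show "(\<lambda>n. klingen_eisenstein k f (degenerate_point \<sigma> (real (Suc n)) u))
         \<longlonglongrightarrow> f ((of_int p)\<^sup>2 * (of_real u + \<i>))" if u: "0 \<le> u" "u \<le> 1" for u
    proof -
      define l where "l X = (if X = X0 then f ((of_int p)\<^sup>2 * (of_real u + \<i>)) else 0)" for X
      have "(\<lambda>n. klingen_eisenstein k f (degenerate_point \<sigma> (real (Suc n)) u)) \<longlonglongrightarrow> infsum l C21_cosets"
        unfolding klingen_eisenstein_eq
      proof (rule infsum_dominated_tendsto[OF sumB])
        show "norm (klingen_term k f (degenerate_point \<sigma> (real (Suc n)) u) (coset_rep X)) \<le> B X"
          if "X \<in> C21_cosets" for n X
          using le_B[OF that _ u] by simp
        show "(\<lambda>n. klingen_term k f (degenerate_point \<sigma> (real (Suc n)) u) (coset_rep X)) \<longlonglongrightarrow> l X"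
          if "X \<in> C21_cosets" for X
        proof (cases "X = X0")
          case True
          thus ?thesis using main_term[OF _ u] by (simp add: l_def)
        next
          case False
          thus ?thesis using other_terms[OF that False u] by (simp add: l_def)
        qed
      qed
      also have "infsum l C21_cosets = infsum l {X0}"
        using X0 by (intro infsum_cong_neutral) (auto simp: l_def)
      finally show ?thesis by (simp add: l_def)
    qed
  qed
qed

text \<open>
  The Fourier-Jacobi coefficient is, up to an exponential, a Fourier coefficient in \<open>u\<close> of the Klingen
  Eisenstein series. By dominated convergence its limit is the same Fourier coefficient of
  \<open>f(p\<^sup>2 (u + i))\<close>, in which only \<open>a N\<close> with \<open>p\<^sup>2 N = m\<close> occurs.
\<close>
lemma fourier_jacobi_limit:
  assumes "even k" and f: "f \<in> cusp_forms k" and a: "cusp_expansion f a"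
    and fj: "fourier_jacobi_expansion (klingen_eisenstein k f) \<phi>"
    and p: "p \<ge> (1::int)" and pq: "coprime p q"
    and \<sigma>: "of_int q = of_int p * \<sigma>" "0 \<le> \<sigma>" "\<sigma> \<le> 1"
    and N: "N \<ge> 1" "int m = p\<^sup>2 * int N"
  shows "(\<lambda>n. ee (of_nat m * of_real (\<sigma>\<^sup>2) * (\<i> * of_real (real (Suc n)))) *
      \<phi> m (\<i> * of_real (real (Suc n))) (of_real \<sigma> * (\<i> * of_real (real (Suc n))))) \<longlonglongrightarrow> a N"
proof -
  obtain K where K: "\<And>y u. 1 \<le> y \<Longrightarrow> 0 \<le> u \<Longrightarrow> u \<le> 1 \<Longrightarrow>
      norm (klingen_eisenstein k f (degenerate_point \<sigma> y u)) \<le> K"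
    and lim: "\<And>u. 0 \<le> u \<Longrightarrow> u \<le> 1 \<Longrightarrow>
      (\<lambda>n. klingen_eisenstein k f (degenerate_point \<sigma> (real (Suc n)) u))
         \<longlonglongrightarrow> f ((of_int p)\<^sup>2 * (of_real u + \<i>))"
    using klingen_eisenstein_degenerates[OF assms(1) f p pq \<sigma>] by blast
  define \<tau> where "\<tau> n = \<i> * complex_of_real (real (Suc n))" for n
  define G where "G n u = klingen_eisenstein k f (degenerate_point \<sigma> (real (Suc n)) u)" for n u
  define c where "c n j = \<phi> j (\<tau> n) (of_real \<sigma> * \<tau> n) * ee (of_nat j * (\<i> * of_real (\<sigma>\<^sup>2 * real (Suc n) + 1)))"
    for n j
  have int_G: "((\<lambda>u. G n u * ee (- of_int (int m) * of_real u)) has_integral c n m) {0..1}" for n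
  proof -
    have "((\<lambda>j. c n j * ee (of_int (int j) * of_real u)) has_sum G n u) UNIV" for u
    proof -
      have "degenerate_point \<sigma> (real (Suc n)) u \<in> siegel_half_space"
        by (rule degenerate_point_in_half_space) simp
      hence "((\<lambda>j. \<phi> j (\<tau> n) (of_real \<sigma> * \<tau> n) * ee (of_nat j * (of_real u + \<i> * of_real (\<sigma>\<^sup>2 * real (Suc n) + 1))))
          has_sum G n u) UNIV"
        using fj unfolding fourier_jacobi_expansion_def degenerate_point_def G_def \<tau>_def by blast
      thus ?thesis by (simp only: c_def distrib_left ee_add of_int_of_nat_eq mult_ac)
    qed
    from fourier_coefficient[OF this, of "int m"] show ?thesis by simp
  qed
  have int_f: "((\<lambda>u. f ((of_int p)\<^sup>2 * (of_real u + \<i>)) * ee (- of_int (int m) * of_real u))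
      has_integral a N * ee (of_nat m * \<i>)) {0..1}"
  proof -
    define c' where "c' n = (if n \<ge> 1 then a n * ee (of_int (p\<^sup>2 * int n) * \<i>) else 0)" for n :: nat
    have "((\<lambda>n. c' n * ee (of_int (p\<^sup>2 * int n) * of_real u)) has_sum f ((of_int p)\<^sup>2 * (of_real u + \<i>))) UNIV" for u
    proof -
      have "Im ((of_int p)\<^sup>2 * (complex_of_real u + \<i>)) > 0"
        using p by (simp add: power2_eq_square)
      hence "((\<lambda>n. a n * ee (of_nat n * ((of_int p)\<^sup>2 * (of_real u + \<i>)))) has_sum f ((of_int p)\<^sup>2 * (of_real u + \<i>))) {1..}"
        using a by (simp add: cusp_expansion_def)
      moreover have "ee (of_nat n * ((of_int p)\<^sup>2 * (of_real u + \<i>)))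
          = ee (of_int (p\<^sup>2 * int n) * \<i>) * ee (of_int (p\<^sup>2 * int n) * of_real u)" for n
        unfolding ee_add[symmetric] by (simp add: algebra_simps)
      ultimately have "((\<lambda>n. a n * (ee (of_int (p\<^sup>2 * int n) * \<i>) * ee (of_int (p\<^sup>2 * int n) * of_real u)))
          has_sum f ((of_int p)\<^sup>2 * (of_real u + \<i>))) {1..}"
        by simp
      also have "?this \<longleftrightarrow> ?thesis"
        by (intro has_sum_cong_neutral) (auto simp: c'_def)
      finally show ?thesis .
    qed
    from fourier_coefficient[OF this, of "int m"]
    have "((\<lambda>u. f ((of_int p)\<^sup>2 * (of_real u + \<i>)) * ee (- of_int (int m) * of_real u))
      has_integral infsum c' {n. p\<^sup>2 * int n = int m}) {0..1}" .
    moreover have "{n. p\<^sup>2 * int n = int m} = {N}" using N p by auto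
    moreover have "c' N = a N * ee (of_nat m * \<i>)"
      using N(1) unfolding c'_def N(2)[symmetric] by simp
    ultimately show ?thesis by simp
  qed
  have "(\<lambda>n. integral {0..1} (\<lambda>u. G n u * ee (- of_int (int m) * of_real u)))
      \<longlonglongrightarrow> integral {0..1} (\<lambda>u. f ((of_int p)\<^sup>2 * (of_real u + \<i>)) * ee (- of_int (int m) * of_real u))"
  proof (rule dominated_convergence(2))
    show "(\<lambda>u. G n u * ee (- of_int (int m) * of_real u)) integrable_on {0..1}" for n
      using int_G by blast
    show "(\<lambda>_. K) integrable_on {0..1::real}" by (rule integrable_const_ivl)
    show "norm (G n u * ee (- of_int (int m) * of_real u)) \<le> K" if "u \<in> {0..1}" for n u
      using K[of "real (Suc n)" u] that by (simp add: G_def norm_mult norm_ee)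
    show "(\<lambda>n. G n u * ee (- of_int (int m) * of_real u))
        \<longlonglongrightarrow> f ((of_int p)\<^sup>2 * (of_real u + \<i>)) * ee (- of_int (int m) * of_real u)" if "u \<in> {0..1}" for u
      unfolding G_def using that by (intro tendsto_mult_right lim) auto
  qed
  hence "(\<lambda>n. c n m) \<longlonglongrightarrow> a N * ee (of_nat m * \<i>)"
    unfolding integral_unique[OF int_G] integral_unique[OF int_f] .
  hence "(\<lambda>n. c n m / ee (of_nat m * \<i>)) \<longlonglongrightarrow> a N * ee (of_nat m * \<i>) / ee (of_nat m * \<i>)"
    by (intro tendsto_divide tendsto_const) auto
  moreover have "c n m / ee (of_nat m * \<i>) = ee (of_nat m * of_real (\<sigma>\<^sup>2) * \<tau> n) * \<phi> m (\<tau> n) (of_real \<sigma> * \<tau> n)" for n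
  proof -
    have "of_nat m * (\<i> * of_real (\<sigma>\<^sup>2 * real (Suc n) + 1)) = of_nat m * of_real (\<sigma>\<^sup>2) * \<tau> n + of_nat m * \<i>"
      by (simp add: \<tau>_def algebra_simps)
    thus ?thesis unfolding c_def by (simp only: ee_add) simp
  qed
  ultimately show ?thesis by (simp add: \<tau>_def)
qed

section \<open>Jacobi Eisenstein series as sums over coprime pairs\<close>

text \<open>
  A coset sum is a sum over any index set that labels the cosets, provided that the summand is
  invariant.
\<close>
lemma coset_sum_eq_infsum:
  assumes mult: "\<And>h h'. h \<in> H \<Longrightarrow> h' \<in> H \<Longrightarrow> mul h h' \<in> H"
    and assoc: "\<And>h h' g. mul (mul h h') g = mul h (mul h' g)"
    and e: "e \<in> H" "\<And>g. mul e g = g"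
    and label: "\<And>g g'. g \<in> G \<Longrightarrow> g' \<in> G \<Longrightarrow> \<kappa> g = \<kappa> g' \<Longrightarrow> \<exists>h\<in>H. g' = mul h g"
    and inv: "\<And>h g. h \<in> H \<Longrightarrow> g \<in> G \<Longrightarrow> \<kappa> (mul h g) = \<kappa> g \<and> t (mul h g) = t g"
    and \<kappa>: "\<And>g. g \<in> G \<Longrightarrow> \<kappa> g \<in> I"
    and rep: "\<And>i. i \<in> I \<Longrightarrow> rep i \<in> G \<and> \<kappa> (rep i) = i"
  shows "coset_sum mul H G t = (\<Sum>\<^sub>\<infinity>i\<in>I. t (rep i))"
proof -
  define coset where "coset g = (\<lambda>h. mul h g) ` H" for g
  have sub: "coset g' \<subseteq> coset g" if gg': "g \<in> G" "g' \<in> G" "\<kappa> g = \<kappa> g'" for g g'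
  proof -
    obtain h where h: "h \<in> H" "g' = mul h g" using label[OF gg'] by blast
    show ?thesis using mult[OF _ h(1)] assoc by (auto simp: coset_def h(2) simp flip: assoc)
  qed
  have eqI: "coset g = coset g'" if "g \<in> G" "g' \<in> G" "\<kappa> g = \<kappa> g'" for g g'
    using sub[OF that] sub[OF that(2,1)] that(3) by simp
  have bij: "bij_betw (\<lambda>i. coset (rep i)) I (coset ` G)"
    unfolding bij_betw_def
  proof
    show "inj_on (\<lambda>i. coset (rep i)) I"
    proof (rule inj_onI)
      fix i j assume ij: "i \<in> I" "j \<in> I" and eq: "coset (rep i) = coset (rep j)"
      have "mul e (rep i) \<in> coset (rep i)" using e(1) by (auto simp: coset_def)
      hence "rep i \<in> coset (rep j)" using e(2) eq by simp
      then obtain h where "h \<in> H" "rep i = mul h (rep j)" by (auto simp: coset_def)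
      thus "i = j" using inv rep ij by metis
    qed
    show "(\<lambda>i. coset (rep i)) ` I = coset ` G"
    proof (intro equalityI subsetI)
      fix X assume "X \<in> coset ` G"
      then obtain g where g: "g \<in> G" "X = coset g" by blast
      have "X = coset (rep (\<kappa> g))" using eqI[of g "rep (\<kappa> g)"] g rep \<kappa> by simp
      thus "X \<in> (\<lambda>i. coset (rep i)) ` I" using \<kappa>[OF g(1)] by blast
    qed (use rep in auto)
  qed
  have "coset_sum mul H G t = (\<Sum>\<^sub>\<infinity>X\<in>coset ` G. t (SOME g. g \<in> X))"
    by (simp add: coset_sum_def coset_def)
  also have "\<dots> = (\<Sum>\<^sub>\<infinity>i\<in>I. t (SOME g. g \<in> coset (rep i)))"
    by (rule infsum_reindex_bij_betw[OF bij, symmetric])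
  also have "\<dots> = (\<Sum>\<^sub>\<infinity>i\<in>I. t (rep i))"
  proof (rule infsum_cong)
    fix i assume i: "i \<in> I"
    have "mul e (rep i) \<in> coset (rep i)" using e(1) by (auto simp: coset_def)
    hence "(SOME g. g \<in> coset (rep i)) \<in> coset (rep i)" by (rule someI)
    then obtain h where "h \<in> H" "(SOME g. g \<in> coset (rep i)) = mul h (rep i)" by (auto simp: coset_def)
    thus "t (SOME g. g \<in> coset (rep i)) = t (rep i)" using inv rep i by metis
  qed
  finally show ?thesis .
qed

text \<open>
  An upper row that completes the coprime pair \<open>(c, d)\<close> to a matrix of determinant one. Another choice
  changes the image of \<open>\<tau>\<close> by an integer, which does not affect the terms of the Eisenstein series.
\<close>
definition upper_row :: "int \<Rightarrow> int \<Rightarrow> int \<times> int" where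
  "upper_row c d = (SOME (p, q). p * d - q * c = 1)"

lemma upper_row_det:
  assumes "coprime c d"
  shows "fst (upper_row c d) * d - snd (upper_row c d) * c = 1"
proof -
  obtain u v where "u * d + v * c = 1"
    using assms by (metis bezout_int coprime_imp_gcd_eq_1 gcd.commute)
  hence "u * d - (- v) * c = 1" by simp
  hence "case (u, - v) of (p, q) \<Rightarrow> p * d - q * c = 1" by simp
  from someI[of "\<lambda>(p, q). p * d - q * c = 1", OF this] show ?thesis
    by (simp add: upper_row_def case_prod_beta)
qed

definition cusp_act :: "int \<Rightarrow> int \<Rightarrow> complex \<Rightarrow> complex" where
  "cusp_act c d \<tau> = (of_int (fst (upper_row c d)) * \<tau> + of_int (snd (upper_row c d))) / (of_int c * \<tau> + of_int d)"

lemma denominator_nonzero: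
  assumes "Im \<tau> > 0" "coprime c d"
  shows "of_int c * \<tau> + of_int d \<noteq> 0"
proof
  assume 0: "of_int c * \<tau> + of_int d = 0"
  hence "of_int c * Im \<tau> = 0" by (auto simp: complex_eq_iff)
  hence "c = 0" using assms(1) by simp
  with 0 have "d = 0" by simp
  thus False using assms(2) \<open>c = 0\<close> by simp
qed

lemma cusp_act_eq:
  assumes "Im \<tau> > 0" "p * d - q * c = 1" "coprime c d"
  obtains t where "(of_int p * \<tau> + of_int q) / (of_int c * \<tau> + of_int d) = cusp_act c d \<tau> + of_int t"
proof -
  define p0 q0 where "p0 = fst (upper_row c d)" and "q0 = snd (upper_row c d)"
  have det0: "p0 * d - q0 * c = 1" using upper_row_det[OF assms(3)] by (simp add: p0_def q0_def)
  \<comment> \<open>The translation taking one upper row to the other, by Cramer's rule.\<close>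
  define t where "t = p0 * q - q0 * p"
  have "p = p0 + t * c"
    using assms(2) det0 unfolding t_def by algebra
  moreover have "q = q0 + t * d"
    using assms(2) det0 unfolding t_def by algebra
  ultimately have "of_int p * \<tau> + of_int q = of_int p0 * \<tau> + of_int q0 + of_int t * (of_int c * \<tau> + of_int d)"
    by (simp add: algebra_simps)
  hence "(of_int p * \<tau> + of_int q) / (of_int c * \<tau> + of_int d) = cusp_act c d \<tau> + of_int t"
    using denominator_nonzero[OF assms(1,3)] by (simp add: cusp_act_def p0_def q0_def add_divide_distrib)
  thus thesis by (rule that)
qed

text \<open>
  The term of a Jacobi Eisenstein series of index \<open>a b\<^sup>2\<close> at \<open>(\<tau>, z)\<close>, with \<open>w = b z\<close> and
  \<open>n = s + b \<nu>\<close>, where \<open>\<nu>\<close> labels the translations of the lattice. In these variables \<open>b\<close> and \<open>s\<close>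
  disappear: the series \<open>E\<^bsub>k,m,s\<^esub>\<close> differ only in the residue class of \<open>n\<close> modulo \<open>b\<close>.
\<close>
definition eis_term :: "int \<Rightarrow> nat \<Rightarrow> complex \<Rightarrow> complex \<Rightarrow> int \<times> int \<times> int \<Rightarrow> complex" where
  "eis_term k a \<tau> w = (\<lambda>(c, d, n). (of_int c * \<tau> + of_int d) powi (- k) *
     ee (of_nat a * ((of_int n)\<^sup>2 * cusp_act c d \<tau> + 2 * of_int n * w / (of_int c * \<tau> + of_int d)
       - of_int c * w\<^sup>2 / (of_int c * \<tau> + of_int d))))"

definition eis_index :: "int set \<Rightarrow> (int \<times> int \<times> int) set" where
  "eis_index R = {(c, d, n). coprime c d \<and> n \<in> R}"

definition eis_part :: "int \<Rightarrow> nat \<Rightarrow> complex \<Rightarrow> complex \<Rightarrow> int set \<Rightarrow> complex" where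
  "eis_part k a \<tau> w R = 1 / 2 * (\<Sum>\<^sub>\<infinity>i\<in>eis_index R. eis_term k a \<tau> w i)"

lemma vec2_eqI: "x $ 1 = y $ 1 \<Longrightarrow> x $ 2 = y $ 2 \<Longrightarrow> x = (y :: 'a^2)"
  by (simp add: vec_eq_iff forall_2)

lemma jacobi_mult_entries:
  "fst (jacobi_mult g h) $ i $ j = fst g $ i $ 1 * fst h $ 1 $ j + fst g $ i $ 2 * fst h $ 2 $ j"
  "snd (jacobi_mult g h) $ j = snd g $ 1 * fst h $ 1 $ j + snd g $ 2 * fst h $ 2 $ j + snd h $ j"
  by (simp_all add: jacobi_mult_def matrix_matrix_mult_def vector_matrix_mult_def sum_2 mult.commute)

lemma jacobi_group_eqI:
  fixes g h :: "(int^2^2) \<times> (int^2)"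
  assumes "\<And>i j. fst g $ i $ j = fst h $ i $ j" "\<And>j. snd g $ j = snd h $ j"
  shows "g = h"
  using assms by (simp add: prod_eq_iff vec_eq_iff)

lemma jacobi_mult_assoc: "jacobi_mult (jacobi_mult g h) x = jacobi_mult g (jacobi_mult h x)"
  by (intro jacobi_group_eqI) (simp_all add: jacobi_mult_entries algebra_simps)

lemma jacobi_group_det:
  "g \<in> jacobi_group \<longleftrightarrow> fst g $ 1 $ 1 * fst g $ 2 $ 2 - fst g $ 1 $ 2 * fst g $ 2 $ 1 = 1"
  by (cases g) (simp add: jacobi_group_def SL2Z_def det_2)

text \<open>The exponent of a term of \<open>E\<^bsub>k,m,s\<^esub>\<close>, as a function on the Jacobi group.\<close>
definition slash_exponent ::
  "nat \<Rightarrow> nat \<Rightarrow> nat \<Rightarrow> complex \<Rightarrow> complex \<Rightarrow> (int^2^2) \<times> (int^2) \<Rightarrow> complex" where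
  "slash_exponent a b s \<tau> z \<gamma> =
     (let p = of_int (fst \<gamma> $ 1 $ 1); q = of_int (fst \<gamma> $ 1 $ 2);
          c = of_int (fst \<gamma> $ 2 $ 1); d = of_int (fst \<gamma> $ 2 $ 2);
          l = of_int (snd \<gamma> $ 1); \<mu> = of_int (snd \<gamma> $ 2)
      in of_nat (a * b^2) * (- (c * (z + l * \<tau> + \<mu>)^2 / (c * \<tau> + d)) + l^2 * \<tau> + 2 * l * z)
         + (of_nat (a * s^2) * ((p * \<tau> + q) / (c * \<tau> + d))
         + of_nat (2 * a * b * s) * ((z + l * \<tau> + \<mu>) / (c * \<tau> + d))))"

lemma slash_eis:
  "slash k (a * b^2) \<gamma> (\<lambda>\<tau> z. ee (of_nat (a * s^2) * \<tau> + of_nat (2 * a * b * s) * z)) \<tau> z =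
    (of_int (fst \<gamma> $ 2 $ 1) * \<tau> + of_int (fst \<gamma> $ 2 $ 2)) powi (- k) * ee (slash_exponent a b s \<tau> z \<gamma>)"
  unfolding slash_def slash_exponent_def Let_def ee_add by (simp only: mult.assoc)

text \<open>
  Multiplying \<open>M\<close> on the left by a translation by \<open>n\<close> changes only the term \<open>a s\<^sup>2 M\<langle>\<tau>\<rangle>\<close>, by an integer. A lattice
  translation by \<open>\<mu>' (c, d)\<close> adds \<open>\<mu>' j\<close> to the numerator \<open>v\<close>, and completing the square leaves
  only integers.
\<close>
lemma slash_exponent_invariant:
  assumes h: "h \<in> jacobi_group_inf" and g: "g \<in> jacobi_group" and \<tau>: "Im \<tau> > 0"
  obtains N where "slash_exponent a b s \<tau> z (jacobi_mult h g) = slash_exponent a b s \<tau> z g + of_int N"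
proof -
  obtain n \<mu>' where h: "h = (vector [vector [1, n], vector [0, 1]], vector [0, \<mu>'])"
    using h by (auto simp: jacobi_group_inf_def)
  define p q c d l \<mu> where "p = fst g $ 1 $ 1" and "q = fst g $ 1 $ 2" and "c = fst g $ 2 $ 1"
    and "d = fst g $ 2 $ 2" and "l = snd g $ 1" and "\<mu> = snd g $ 2"
  note defs = p_def q_def c_def d_def l_def \<mu>_def
  have det: "p * d - q * c = 1" using g by (simp add: jacobi_group_det defs)
  have cop: "coprime c d"
    using det by (metis coprimeI dvd_diff dvd_mult)
  define j where "j = of_int c * \<tau> + of_int d"
  have j: "j \<noteq> 0" using denominator_nonzero[OF \<tau> cop] by (simp add: j_def)
  define v where "v = z + of_int l * \<tau> + of_int \<mu>"
  define N where "N = int (a * b^2) * (- 2 * c * \<mu>' * \<mu> - c * d * \<mu>'^2) + int (a * s^2) * n + int (2 * a * b * s) * \<mu>'"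
  have e1: "slash_exponent a b s \<tau> z g =
    of_nat (a * b^2) * (- (of_int c * v^2 / j) + (of_int l)^2 * \<tau> + 2 * of_int l * z)
      + (of_nat (a * s^2) * ((of_int p * \<tau> + of_int q) / j) + of_nat (2 * a * b * s) * (v / j))"
    by (simp add: slash_exponent_def Let_def defs v_def j_def)
  have e2: "slash_exponent a b s \<tau> z (jacobi_mult h g) =
    of_nat (a * b^2) * (- (of_int c * (v + of_int \<mu>' * j)^2 / j) + (of_int l + of_int \<mu>' * of_int c)^2 * \<tau>
          + 2 * (of_int l + of_int \<mu>' * of_int c) * z)
      + (of_nat (a * s^2) * ((of_int p * \<tau> + of_int q + of_int n * j) / j)
      + of_nat (2 * a * b * s) * ((v + of_int \<mu>' * j) / j))"
    unfolding slash_exponent_def Let_def jacobi_mult_entries h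
    by (simp add: v_def j_def algebra_simps flip: defs)
  have s1: "of_int c * (v + of_int \<mu>' * j)^2 / j = of_int c * v^2 / j + 2 * of_int c * of_int \<mu>' * v + of_int c * (of_int \<mu>')^2 * j"
    using j by (simp add: power2_eq_square field_simps)
  have s2: "(of_int p * \<tau> + of_int q + of_int n * j) / j = (of_int p * \<tau> + of_int q) / j + of_int n"
    "(v + of_int \<mu>' * j) / j = v / j + of_int \<mu>'"
    using j by (simp_all add: add_divide_distrib)
  have "- (of_int c * (v + of_int \<mu>' * j)^2 / j) + (of_int l + of_int \<mu>' * of_int c)^2 * \<tau>
          + 2 * (of_int l + of_int \<mu>' * of_int c) * z
     = (- (of_int c * v^2 / j) + (of_int l)^2 * \<tau> + 2 * of_int l * z)
       + of_int (- 2 * c * \<mu>' * \<mu> - c * d * \<mu>'^2)"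
    unfolding s1 by (simp add: v_def j_def power2_eq_square algebra_simps)
  note quadratic = this
  have "slash_exponent a b s \<tau> z (jacobi_mult h g) = slash_exponent a b s \<tau> z g + of_int N"
    unfolding e1 e2 s2 quadratic N_def by (simp add: algebra_simps)
  thus thesis by (rule that)
qed

text \<open>
  The representative with lower row \<open>(c, d)\<close> and lattice part \<open>[\<nu>, 0] M\<close>, so that acting with it
  is acting with \<open>[\<nu>, 0]\<close> and then with \<open>M\<close>. The cosets are labelled by \<open>c\<close>, \<open>d\<close> and
  \<open>\<nu> = \<lambda> d - \<mu> c\<close>, the first coordinate of \<open>[\<lambda>, \<mu>] M\<^bsup>-1\<^esup>\<close>.
\<close>
definition eis_rep :: "int \<times> int \<times> int \<Rightarrow> (int^2^2) \<times> (int^2)" where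
  "eis_rep = (\<lambda>(c, d, \<nu>). let (p, q) = upper_row c d in
     (vector [vector [p, q], vector [c, d]], vector [\<nu> * p, \<nu> * q]))"

text \<open>
  The translation \<open>[\<nu>, 0]\<close> completes \<open>a s\<^sup>2 \<tau> + 2 a b s z\<close> to the same expression with \<open>s + b \<nu>\<close> for
  \<open>s\<close>; the slash action of \<open>M\<close> gives the remaining summand. The integer is a product of the lattice
  coordinates.
\<close>
lemma slash_exponent_rep:
  assumes cop: "coprime c d" and \<tau>: "Im \<tau> > 0"
  obtains N where "slash_exponent a b s \<tau> z (eis_rep (c, d, \<nu>)) =
    of_nat a * ((of_int (int s + int b * \<nu>))\<^sup>2 * cusp_act c d \<tau>
       + 2 * of_int (int s + int b * \<nu>) * (of_nat b * z) / (of_int c * \<tau> + of_int d)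
       - of_int c * (of_nat b * z)\<^sup>2 / (of_int c * \<tau> + of_int d)) + of_int N"
proof -
  obtain p q where pq: "upper_row c d = (p, q)" by (cases "upper_row c d")
  have det: "p * d - q * c = 1" using upper_row_det[OF cop] by (simp add: pq)
  define P Q C D V B S where "P = complex_of_int p" and "Q = complex_of_int q" and "C = complex_of_int c"
    and "D = complex_of_int d" and "V = complex_of_int \<nu>" and "B = complex_of_nat b" and "S = complex_of_nat s"
  define j where "j = C * \<tau> + D"
  define A where "A = P * \<tau> + Q"
  have j: "j \<noteq> 0" using denominator_nonzero[OF \<tau> cop] by (simp add: j_def C_def D_def)
  have detC: "P * D - Q * C = 1"
    unfolding P_def Q_def C_def D_def using det by (metis of_int_1 of_int_diff of_int_mult)
  have r1: "P * j - C * A = 1" using detC by (simp add: j_def A_def algebra_simps)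
  have key: "- (C * (z + V * A)^2 / j) + (V * P)^2 * \<tau> + 2 * (V * P) * z
      = V^2 * (A / j) + 2 * V * z / j - C * z^2 / j - V^2 * P * Q"
  proof -
    have "- (C * (z + V * A)^2) + ((V * P)^2 * \<tau> + 2 * (V * P) * z) * j
       = V^2 * A + 2 * V * z - C * z^2 - V^2 * P * Q * j"
      using r1 unfolding A_def by algebra
    hence "(- (C * (z + V * A)^2) + ((V * P)^2 * \<tau> + 2 * (V * P) * z) * j) / j
       = (V^2 * A + 2 * V * z - C * z^2 - V^2 * P * Q * j) / j" by simp
    thus ?thesis using j by (simp add: add_divide_distrib diff_divide_distrib algebra_simps)
  qed
  have act: "cusp_act c d \<tau> = A / j"
    by (simp add: cusp_act_def pq A_def P_def Q_def j_def C_def D_def)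
  define N where "N = - int (a * b^2) * (\<nu>^2 * p * q)"
  have "slash_exponent a b s \<tau> z (eis_rep (c, d, \<nu>)) =
     of_nat a * B^2 * (- (C * (z + V * A)^2 / j) + (V * P)^2 * \<tau> + 2 * (V * P) * z)
      + (of_nat a * S^2 * (A / j) + 2 * of_nat a * B * S * ((z + V * A) / j))"
    by (simp add: slash_exponent_def eis_rep_def pq Let_def A_def P_def Q_def j_def C_def D_def V_def B_def S_def
        algebra_simps)
  also have "\<dots> = of_nat a * ((S + B * V)^2 * (A / j) + 2 * (S + B * V) * (B * z) / j - C * (B * z)^2 / j) + of_int N"
    unfolding key using j
    by (simp add: N_def power2_eq_square algebra_simps add_divide_distrib P_def Q_def V_def B_def)
  finally show thesis
    using that[of N] by (simp add: act S_def B_def V_def C_def D_def j_def)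
qed

lemma jacobi_eisenstein_at_eq_infsum:
  assumes \<tau>: "Im \<tau> > 0"
  shows "jacobi_eisenstein_at k a b s \<tau> z =
    1 / 2 * (\<Sum>\<^sub>\<infinity>(c, d, \<nu>)\<in>eis_index UNIV. eis_term k a \<tau> (of_nat b * z) (c, d, int s + int b * \<nu>))"
proof -
  define t where "t \<gamma> = (of_int (fst \<gamma> $ 2 $ 1) * \<tau> + of_int (fst \<gamma> $ 2 $ 2)) powi (- k) *
    ee (slash_exponent a b s \<tau> z \<gamma>)" for \<gamma> :: "(int^2^2) \<times> (int^2)"
  define \<kappa> where "\<kappa> \<gamma> = (fst \<gamma> $ 2 $ 1, fst \<gamma> $ 2 $ 2, snd \<gamma> $ 1 * fst \<gamma> $ 2 $ 2 - snd \<gamma> $ 2 * fst \<gamma> $ 2 $ 1)"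
    for \<gamma> :: "(int^2^2) \<times> (int^2)"
  have cop: "coprime (fst g $ 2 $ 1) (fst g $ 2 $ 2)" if "g \<in> jacobi_group" for g
    using that unfolding jacobi_group_det by (metis coprimeI dvd_diff dvd_mult)
  have "coset_sum jacobi_mult jacobi_group_inf jacobi_group t = (\<Sum>\<^sub>\<infinity>i\<in>eis_index UNIV. t (eis_rep i))"
  proof (rule coset_sum_eq_infsum[where \<kappa> = \<kappa> and e = "(mat 1, 0)"])
    show "jacobi_mult h h' \<in> jacobi_group_inf" if "h \<in> jacobi_group_inf" "h' \<in> jacobi_group_inf" for h h'
    proof -
      from that(1) obtain n \<mu> where h: "h = (vector [vector [1, n], vector [0, 1]], vector [0, \<mu>])"
        by (auto simp: jacobi_group_inf_def)
      from that(2) obtain n' \<mu>' where "h' = (vector [vector [1, n'], vector [0, 1]], vector [0, \<mu>'])"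
        by (auto simp: jacobi_group_inf_def)
      with h have "jacobi_mult h h' = (vector [vector [1, n + n'], vector [0, 1]], vector [0, \<mu> + \<mu>'])"
        by (intro prod_eqI vec2_eqI) (simp_all add: jacobi_mult_entries)
      thus ?thesis by (auto simp: jacobi_group_inf_def)
    qed
    show "(mat 1, 0) \<in> jacobi_group_inf"
    proof -
      have "(mat 1, 0) = (vector [vector [1, 0], vector [0, 1]] :: int^2^2, vector [0, 0] :: int^2)"
        by (intro prod_eqI vec2_eqI) (simp_all add: mat_def)
      thus ?thesis by (force simp: jacobi_group_inf_def)
    qed
    show "jacobi_mult (mat 1, 0) g = g" for g
      by (simp add: jacobi_mult_def)
    show "\<exists>h\<in>jacobi_group_inf. g' = jacobi_mult h g"
      if g: "g \<in> jacobi_group" "g' \<in> jacobi_group" and eq: "\<kappa> g = \<kappa> g'" for g g'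
    proof -
      define c d where "c = fst g $ 2 $ 1" and "d = fst g $ 2 $ 2"
      have cd': "fst g' $ 2 $ 1 = c" "fst g' $ 2 $ 2 = d"
        and nu: "snd g $ 1 * d - snd g $ 2 * c = snd g' $ 1 * d - snd g' $ 2 * c"
        using eq by (auto simp: \<kappa>_def c_def d_def)
      define p q p' q' where "p = fst g $ 1 $ 1" and "q = fst g $ 1 $ 2"
        and "p' = fst g' $ 1 $ 1" and "q' = fst g' $ 1 $ 2"
      have det: "p * d - q * c = 1" "p' * d - q' * c = 1"
        using g cd' by (auto simp: jacobi_group_det p_def q_def p'_def q'_def c_def d_def)
      \<comment> \<open>The upper rows differ by a multiple of \<open>(c, d)\<close>, and so do the lattice parts.\<close>
      define n where "n = p * q' - q * p'"
      have n: "p' = p + n * c" "q' = q + n * d" using det unfolding n_def by algebra+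
      define x1 x2 where "x1 = snd g' $ 1 - snd g $ 1" and "x2 = snd g' $ 2 - snd g $ 2"
      define \<mu> where "\<mu> = p * x2 - q * x1"
      have "x1 * d = x2 * c" using nu by (simp add: x1_def x2_def algebra_simps)
      hence \<mu>: "x1 = \<mu> * c" "x2 = \<mu> * d" using det(1) unfolding \<mu>_def by algebra+
      have "g' = jacobi_mult (vector [vector [1, n], vector [0, 1]], vector [0, \<mu>]) g"
        using n \<mu> cd' by (intro prod_eqI vec2_eqI)
          (simp_all add: jacobi_mult_entries p_def q_def p'_def q'_def c_def d_def x1_def x2_def algebra_simps)
      thus ?thesis by (auto simp: jacobi_group_inf_def)
    qed
    show "\<kappa> (jacobi_mult h g) = \<kappa> g \<and> t (jacobi_mult h g) = t g"
      if h: "h \<in> jacobi_group_inf" and g: "g \<in> jacobi_group" for h g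
    proof
      obtain n \<mu> where h': "h = (vector [vector [1, n], vector [0, 1]], vector [0, \<mu>])"
        using h by (auto simp: jacobi_group_inf_def)
      show "\<kappa> (jacobi_mult h g) = \<kappa> g"
        by (simp add: \<kappa>_def jacobi_mult_entries h' algebra_simps)
      obtain N where "slash_exponent a b s \<tau> z (jacobi_mult h g) = slash_exponent a b s \<tau> z g + of_int N"
        using slash_exponent_invariant[OF h g \<tau>] .
      thus "t (jacobi_mult h g) = t g"
        by (simp add: t_def ee_add_int jacobi_mult_entries h')
    qed
    show "\<kappa> g \<in> eis_index UNIV" if "g \<in> jacobi_group" for g
      using cop[OF that] by (simp add: eis_index_def \<kappa>_def)
    show "eis_rep i \<in> jacobi_group \<and> \<kappa> (eis_rep i) = i" if "i \<in> eis_index UNIV" for i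
    proof -
      obtain c d \<nu> where i: "i = (c, d, \<nu>)" by (cases i)
      obtain p q where pq: "upper_row c d = (p, q)" by (cases "upper_row c d")
      have det: "p * d - q * c = 1" using upper_row_det[of c d] that by (simp add: pq i eis_index_def)
      have "\<nu> * p * d - \<nu> * q * c = \<nu> * (p * d - q * c)" by (simp add: algebra_simps)
      thus ?thesis using det by (simp add: i eis_rep_def pq jacobi_group_det \<kappa>_def)
    qed
  qed (rule jacobi_mult_assoc)
  also have "\<dots> = (\<Sum>\<^sub>\<infinity>(c, d, \<nu>)\<in>eis_index UNIV. eis_term k a \<tau> (of_nat b * z) (c, d, int s + int b * \<nu>))"
  proof (rule infsum_cong)
    fix i assume "i \<in> eis_index UNIV"
    then obtain c d \<nu> where i: "i = (c, d, \<nu>)" and cd: "coprime c d" by (auto simp: eis_index_def)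
    have row: "fst (eis_rep i) $ 2 $ 1 = c" "fst (eis_rep i) $ 2 $ 2 = d"
      by (simp_all add: eis_rep_def i case_prod_beta Let_def)
    obtain N where "slash_exponent a b s \<tau> z (eis_rep (c, d, \<nu>)) =
      of_nat a * ((of_int (int s + int b * \<nu>))\<^sup>2 * cusp_act c d \<tau>
       + 2 * of_int (int s + int b * \<nu>) * (of_nat b * z) / (of_int c * \<tau> + of_int d)
       - of_int c * (of_nat b * z)\<^sup>2 / (of_int c * \<tau> + of_int d)) + of_int N"
      using slash_exponent_rep[OF cd \<tau>] .
    thus "t (eis_rep i) = (case i of (c, d, \<nu>) \<Rightarrow> eis_term k a \<tau> (of_nat b * z) (c, d, int s + int b * \<nu>))"
      unfolding t_def row unfolding i by (simp only: eis_term_def prod.case ee_add_int)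
  qed
  finally show ?thesis
    by (simp only: jacobi_eisenstein_at_def jacobi_average_def slash_eis t_def[abs_def])
qed

lemma jacobi_eisenstein_at_eq_part:
  assumes \<tau>: "Im \<tau> > 0" and b: "b \<ge> 1"
  shows "jacobi_eisenstein_at k a b s \<tau> z = eis_part k a \<tau> (of_nat b * z) {n. int b dvd n - int s}"
proof -
  have "(\<Sum>\<^sub>\<infinity>(c, d, \<nu>)\<in>eis_index UNIV. eis_term k a \<tau> (of_nat b * z) (c, d, int s + int b * \<nu>))
    = (\<Sum>\<^sub>\<infinity>i\<in>eis_index {n. int b dvd n - int s}. eis_term k a \<tau> (of_nat b * z) i)"
    by (rule infsum_reindex_bij_witness[where j = "\<lambda>(c, d, \<nu>). (c, d, int s + int b * \<nu>)"
        and i = "\<lambda>(c, d, n). (c, d, (n - int s) div int b)"])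
      (use b in \<open>auto simp: eis_index_def\<close>)
  thus ?thesis
    by (simp add: jacobi_eisenstein_at_eq_infsum[OF \<tau>] eis_part_def)
qed

lemma jacobi_eisenstein_eq_at: "jacobi_eisenstein k (a * b\<^sup>2) = jacobi_eisenstein_at k a b 0"
  by (simp add: jacobi_eisenstein_def jacobi_eisenstein_at_def)

section \<open>Size of the terms of a Jacobi Eisenstein series\<close>

text \<open>
  All imaginary parts have the denominator \<open>|c \<tau> + d|\<^sup>2\<close>, and the numerators complete to the square of
  \<open>n + \<rho> d - \<theta> c\<close>. This is the invariance of \<open>|\<phi>| exp (- 2 \<pi> m (Im z)\<^sup>2 / Im \<tau>)\<close> up to the automorphy
  factor, in the real coordinates of \<open>w\<close> with respect to \<open>\<tau>\<close> and \<open>1\<close>.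
\<close>
lemma norm_eis_term:
  assumes \<tau>: "Im \<tau> > 0" and cop: "coprime c d" and w: "w = of_real \<rho> * \<tau> + of_real \<theta>"
  shows "norm (eis_term k a \<tau> w (c, d, n)) = norm (of_int c * \<tau> + of_int d) powi (- k) *
    exp (2 * pi * a * \<rho>\<^sup>2 * Im \<tau>) *
    exp (- (2 * pi * a * Im \<tau> / (norm (of_int c * \<tau> + of_int d))\<^sup>2 * (n + \<rho> * d - \<theta> * c)\<^sup>2))"
proof -
  obtain p q where pq: "upper_row c d = (p, q)" by (cases "upper_row c d")
  have detI: "p * d - q * c = 1" using upper_row_det[OF cop] by (simp add: pq)
  have "real_of_int p * d - real_of_int q * c = of_int (p * d - q * c)" by simp
  hence det: "real_of_int p * d - real_of_int q * c = 1" unfolding detI by simp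
  define x y where "x = Re \<tau>" and "y = Im \<tau>"
  define j where "j = of_int c * \<tau> + of_int d"
  have j: "j \<noteq> 0" using denominator_nonzero[OF \<tau> cop] by (simp add: j_def)
  define J where "J = (norm j)\<^sup>2"
  have J: "J > 0" using j by (simp add: J_def)
  have Jxy: "J = (c * x + d)\<^sup>2 + (c * y)\<^sup>2"
    by (simp add: J_def j_def cmod_power2 x_def y_def)
  have div: "Im (v / j) * J = Im (v * cnj j)" for v
    using J by (simp add: Im_divide J_def cmod_power2)
  have 1: "Im (cusp_act c d \<tau>) * J = y"
  proof -
    have "Im (cusp_act c d \<tau>) * J = y * (p * d - q * c)"
      unfolding cusp_act_def pq j_def[symmetric] div by (simp add: j_def x_def y_def algebra_simps)
    thus ?thesis by (simp add: det)
  qed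
  have 2: "Im (w / j) * J = y * (\<rho> * d - \<theta> * c)"
    unfolding div w by (simp add: j_def x_def y_def algebra_simps)
  have 3: "Im (of_int c * w\<^sup>2 / j) * J = \<rho>\<^sup>2 * y * J - y * (\<rho> * d - \<theta> * c)\<^sup>2"
    unfolding div unfolding w Jxy by (simp add: j_def x_def y_def power2_eq_square algebra_simps)
  define E where "E = (of_int n)\<^sup>2 * cusp_act c d \<tau> + 2 * of_int n * w / j - of_int c * w\<^sup>2 / j"
  have "Im E * J = n\<^sup>2 * (Im (cusp_act c d \<tau>) * J) + 2 * n * (Im (w / j) * J) - Im (of_int c * w\<^sup>2 / j) * J"
  proof -
    have "Im ((of_int n)\<^sup>2 * cusp_act c d \<tau>) = n\<^sup>2 * Im (cusp_act c d \<tau>)"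
      by (simp add: power2_eq_square)
    moreover have "Im (2 * of_int n * w / j) = 2 * n * Im (w / j)"
    proof -
      have "2 * of_int n * w / j = of_real (2 * of_int n) * (w / j)" by simp
      thus ?thesis by (simp only: Im_complex_of_real Re_complex_of_real times_complex.sel mult_zero_left add_0_right)
    qed
    ultimately show ?thesis by (simp add: E_def algebra_simps)
  qed
  also have "\<dots> = y * (n + \<rho> * d - \<theta> * c)\<^sup>2 - \<rho>\<^sup>2 * y * J"
    unfolding 1 2 3 by (simp add: power2_eq_square algebra_simps)
  finally have "Im E = y / J * (n + \<rho> * d - \<theta> * c)\<^sup>2 - \<rho>\<^sup>2 * y"
    using J by (simp add: field_simps)
  hence im: "Im (of_nat a * E) = a * (y / J * (n + \<rho> * d - \<theta> * c)\<^sup>2 - \<rho>\<^sup>2 * y)" by simp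
  have "norm (ee (of_nat a * E)) = exp (2 * pi * a * \<rho>\<^sup>2 * y + - (2 * pi * a * y / J * (n + \<rho> * d - \<theta> * c)\<^sup>2))"
    unfolding norm_ee im by (simp add: right_diff_distrib mult_ac)
  moreover have "eis_term k a \<tau> w (c, d, n) = j powi (- k) * ee (of_nat a * E)"
    by (simp add: eis_term_def E_def j_def)
  ultimately show ?thesis
    by (simp only: norm_mult norm_power_int exp_add J_def j_def y_def mult.assoc)
qed

text \<open>
  The number \<open>h\<close> measures how far the lattice spanned by \<open>\<tau>\<close> and \<open>1\<close> is from the standard one. It is
  kept as a parameter because it can be taken constant along \<open>\<tau> = i y\<close>, \<open>y \<ge> 1\<close>.
\<close>
lemma denominator_lower_bound:
  assumes \<tau>: "Im \<tau> > 0" and cop: "coprime c d" and h: "h \<ge> 1 + (1 + norm \<tau>) / Im \<tau>"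
  defines "J \<equiv> norm (of_int c * \<tau> + of_int d)"
  shows "1 \<le> h * J" "\<bar>real_of_int c\<bar> \<le> h * J" "\<bar>real_of_int d\<bar> \<le> h * J"
proof -
  define j where "j = of_int c * \<tau> + of_int d"
  have "\<bar>Im j\<bar> \<le> J" unfolding J_def j_def[symmetric] by (rule abs_Im_le_cmod)
  hence c: "\<bar>real_of_int c\<bar> \<le> J / Im \<tau>" using \<tau> by (simp add: j_def abs_mult field_simps)
  have "norm (of_int d :: complex) \<le> norm j + norm (of_int c * \<tau>)"
    using norm_triangle_ineq4[of j "of_int c * \<tau>"] by (simp add: j_def)
  hence d: "\<bar>real_of_int d\<bar> \<le> J + J / Im \<tau> * norm \<tau>"
    using mult_right_mono[OF c norm_ge_zero[of \<tau>]] by (simp add: J_def j_def norm_mult)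
  have J0: "J \<ge> 0" by (simp add: J_def)
  have "(1 + (1 + norm \<tau>) / Im \<tau>) * J \<le> h * J" using h J0 by (rule mult_right_mono)
  hence hJ: "J + J / Im \<tau> + J / Im \<tau> * norm \<tau> \<le> h * J"
    by (simp add: algebra_simps add_divide_distrib)
  have pos: "0 \<le> J / Im \<tau>" "0 \<le> J / Im \<tau> * norm \<tau>" using \<tau> J0 by simp_all
  show "\<bar>real_of_int c\<bar> \<le> h * J" using c hJ pos J0 by linarith
  show "\<bar>real_of_int d\<bar> \<le> h * J" using d hJ pos J0 by linarith
  have "c \<noteq> 0 \<or> d \<noteq> 0" using cop by auto
  hence "1 \<le> \<bar>c\<bar> + \<bar>d\<bar>" by linarith
  hence "1 \<le> \<bar>real_of_int c\<bar> + \<bar>real_of_int d\<bar>" by linarith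
  thus "1 \<le> h * J" using c d hJ by linarith
qed

text \<open>
  A Gaussian of precision \<open>B\<close> is traded for polynomial decay of order \<open>3/2\<close> in \<open>n\<close>, summable over the
  integers, at the cost of the factor \<open>L\<^bsup>3/4\<^esup>\<close>. As \<open>L\<close> will be of the size of \<open>|c \<tau> + d|\<^sup>2\<close>, this
  leaves the exponent \<open>3/2 - k\<close> for \<open>|c \<tau> + d|\<close>; any order strictly between \<open>1\<close> and \<open>k - 2\<close> would do.
\<close>
lemma gaussian_decay:
  fixes x :: real and n :: int
  assumes B: "B > 0" and L: "L \<ge> 1" "L \<ge> 1 / B"
  shows "exp (- (B * (n + x)\<^sup>2)) \<le> 8 * L powr (3 / 4) * int_decay (3 / 2) (n + \<lfloor>x\<rfloor>)"
proof -
  define q where "q = n + x"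
  have pow: "2 powr (3 / 2 :: real) * 2 powr (3 / 2) = 8"
    by (simp flip: powr_add)
  have two: "1 \<le> 2 powr (3 / 2 :: real)" by (rule ge_one_powr_ge_zero) auto
  have L34: "1 \<le> L powr (3 / 4)" using L by (intro ge_one_powr_ge_zero) auto
  have decay: "(1 + \<bar>q\<bar>) powr (- (3 / 2)) \<le> 2 powr (3 / 2) * int_decay (3 / 2) (n + \<lfloor>x\<rfloor>)"
  proof -
    have "\<bar>real_of_int (n + \<lfloor>x\<rfloor>)\<bar> \<le> \<bar>q\<bar> + 1"
      unfolding q_def using of_int_floor_le[of x] real_of_int_floor_add_one_gt[of x] by simp linarith
    hence "(1 + \<bar>real_of_int (n + \<lfloor>x\<rfloor>)\<bar>) / 2 \<le> 1 + \<bar>q\<bar>" by simp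
    hence "(1 + \<bar>q\<bar>) powr (- (3 / 2)) \<le> ((1 + \<bar>real_of_int (n + \<lfloor>x\<rfloor>)\<bar>) / 2) powr (- (3 / 2))"
      by (intro powr_mono2') auto
    also have "\<dots> = 2 powr (3 / 2) * int_decay (3 / 2) (n + \<lfloor>x\<rfloor>)"
      unfolding int_decay_def by (subst powr_divide) (auto simp: powr_minus field_simps)
    finally show ?thesis .
  qed
  have "exp (- (B * q\<^sup>2)) \<le> 2 powr (3 / 2) * L powr (3 / 4) * (1 + \<bar>q\<bar>) powr (- (3 / 2))"
  proof (cases "\<bar>q\<bar> \<le> 1")
    case True
    have "exp (- (B * q\<^sup>2)) \<le> 1" using B by simp
    also have "1 \<le> 2 powr (3 / 2) * L powr (3 / 4) * 2 powr (- (3 / 2))"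
      using L34 by (simp add: powr_minus divide_inverse[symmetric])
    also have "2 powr (- (3 / 2)) \<le> (1 + \<bar>q\<bar>) powr (- (3 / 2))"
      using True by (intro powr_mono2') auto
    finally show ?thesis by (simp add: mult_left_mono)
  next
    case False
    define t where "t = B * q\<^sup>2"
    have q0: "q \<noteq> 0" using False by auto
    have t: "t > 0" unfolding t_def using B q0 by simp
    have "t powr (3 / 4) \<le> (3 / 4) powr (3 / 4) * exp t"
      using t by (intro powr_le_exp) auto
    also have "(3 / 4) powr (3 / 4) \<le> (1 :: real)"
      using powr_mono2[of "3 / 4" "3 / 4" "1 :: real"] by simp
    finally have "t powr (3 / 4) \<le> exp t" by simp
    hence "exp (- t) \<le> t powr (- (3 / 4))"
      using t by (simp add: exp_minus powr_minus le_imp_inverse_le)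
    also have "t powr (- (3 / 4)) = (1 / B) powr (3 / 4) * \<bar>q\<bar> powr (- (3 / 2))"
    proof -
      have "(q\<^sup>2) powr (- (3 / 4)) = \<bar>q\<bar> powr (- (3 / 2))"
        using q0 powr_powr[of "\<bar>q\<bar>" 2 "- (3 / 4)"] by simp
      thus ?thesis unfolding t_def using B by (simp add: powr_mult powr_divide powr_minus field_simps)
    qed
    also have "(1 / B) powr (3 / 4) * \<bar>q\<bar> powr (- (3 / 2)) \<le> L powr (3 / 4) * (((1 + \<bar>q\<bar>) / 2) powr (- (3 / 2)))"
      using L B False by (intro mult_mono powr_mono2 powr_mono2') auto
    also have "((1 + \<bar>q\<bar>) / 2) powr (- (3 / 2)) = 2 powr (3 / 2) * (1 + \<bar>q\<bar>) powr (- (3 / 2))"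
      by (subst powr_divide) (auto simp: powr_minus field_simps)
    finally show ?thesis by (simp add: t_def mult_ac)
  qed
  also have "\<dots> \<le> 2 powr (3 / 2) * L powr (3 / 4) * (2 powr (3 / 2) * int_decay (3 / 2) (n + \<lfloor>x\<rfloor>))"
    using decay by (intro mult_left_mono) auto
  also have "\<dots> = (2 powr (3 / 2) * 2 powr (3 / 2)) * L powr (3 / 4) * int_decay (3 / 2) (n + \<lfloor>x\<rfloor>)"
    by (simp only: mult_ac)
  finally show ?thesis unfolding pow q_def .
qed

definition eis_majorant :: "real \<Rightarrow> real \<Rightarrow> int \<times> int \<times> int \<Rightarrow> real" where
  "eis_majorant \<rho> \<theta> = (\<lambda>(c, d, n).
     int_decay (5 / 4) c * (int_decay (5 / 4) d * int_decay (3 / 2) (n + \<lfloor>\<rho> * d - \<theta> * c\<rfloor>)))"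

lemma summable_eis_majorant: "eis_majorant \<rho> \<theta> summable_on UNIV"
proof -
  have s: "int_decay (5 / 4) summable_on UNIV" "int_decay (3 / 2) summable_on UNIV"
    by (intro summable_int_decay; simp)+
  have "(\<lambda>(c, d, n). int_decay (5 / 4) c * (int_decay (5 / 4) d * int_decay (3 / 2) n)) summable_on UNIV"
    using summable_on_times_nonneg[OF s(1) summable_on_times_nonneg[OF s(1,2)]]
    by (simp add: case_prod_unfold)
  also have "?this \<longleftrightarrow> ?thesis"
    by (rule summable_on_reindex_bij_witness[where
        i = "\<lambda>(c, d, n). (c, d, n + \<lfloor>\<rho> * real_of_int d - \<theta> * real_of_int c\<rfloor>)"
        and j = "\<lambda>(c, d, n). (c, d, n - \<lfloor>\<rho> * real_of_int d - \<theta> * real_of_int c\<rfloor>)"])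
      (auto simp: eis_majorant_def)
  finally show ?thesis .
qed

text \<open>
  The majorant does not depend on \<open>\<tau>\<close>, and the constant depends on it only through \<open>h\<close> and the
  exponential, which the factor \<open>e(a s\<^sup>2 \<tau>)\<close> of a boundary value at \<open>w = s \<tau>\<close> cancels.
\<close>
lemma eis_term_bound:
  assumes \<tau>: "Im \<tau> > 0" and cop: "coprime c d" and w: "w = of_real \<rho> * \<tau> + of_real \<theta>"
    and h: "h \<ge> 1 + (1 + norm \<tau>) / Im \<tau>" and a: "a \<ge> 1" and k: "k \<ge> 4"
  shows "norm (eis_term k a \<tau> w (c, d, n)) \<le>
    8 * (h\<^sup>2) powr (3 / 4) * (4 * h\<^sup>2) powr (k / 2 - 3 / 4) * exp (2 * pi * a * \<rho>\<^sup>2 * Im \<tau>) *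
      eis_majorant \<rho> \<theta> (c, d, n)"
proof -
  define y where "y = Im \<tau>"
  define J where "J = norm (of_int c * \<tau> + of_int d)"
  have y: "y > 0" using \<tau> by (simp add: y_def)
  have J: "J > 0" using denominator_nonzero[OF \<tau> cop] by (simp add: J_def)
  note lb = denominator_lower_bound[OF \<tau> cop h, folded J_def]
  have hy: "h \<ge> 1" "h \<ge> 1 / y"
  proof -
    have "0 \<le> (1 + norm \<tau>) / Im \<tau>" using \<tau> by simp
    thus "h \<ge> 1" using h by linarith
    have "1 / y \<le> (1 + norm \<tau>) / y" using y by (intro divide_right_mono) auto
    thus "h \<ge> 1 / y" using h unfolding y_def by linarith
  qed
  define B where "B = 2 * pi * a * y / J\<^sup>2"
  have B: "B > 0" using y J a by (simp add: B_def)
  define L where "L = h\<^sup>2 * J\<^sup>2"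
  have "1 \<le> (h * J)\<^sup>2" using lb(1) by simp
  hence L1: "L \<ge> 1" by (simp add: L_def power_mult_distrib)
  have L2: "L \<ge> 1 / B"
  proof -
    have "1 * 1 \<le> 2 * pi * a" using pi_gt3 a by (intro mult_mono) auto
    hence "1 * y \<le> 2 * pi * a * y" using y by (intro mult_right_mono) auto
    hence "J\<^sup>2 / (2 * pi * a * y) \<le> J\<^sup>2 / (1 * y)"
      using y by (intro divide_left_mono) auto
    hence "1 / B \<le> J\<^sup>2 * (1 / y)" by (simp add: B_def)
    also have "\<dots> \<le> J\<^sup>2 * h" using hy by (intro mult_left_mono) auto
    also have "\<dots> \<le> J\<^sup>2 * h\<^sup>2" using hy by (intro mult_left_mono) (auto simp: power2_eq_square)
    finally show ?thesis by (simp add: L_def mult.commute)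
  qed
  define P where "P = (1 + \<bar>real_of_int c\<bar>) * (1 + \<bar>real_of_int d\<bar>)"
  have P1: "P \<ge> 1" unfolding P_def using mult_mono[of 1 "1 + \<bar>real_of_int c\<bar>" 1 "1 + \<bar>real_of_int d\<bar>"] by simp
  have "P \<le> (2 * (h * J)) * (2 * (h * J))"
    unfolding P_def using lb by (intro mult_mono) auto
  hence P: "P \<le> 4 * h\<^sup>2 * J\<^sup>2" by (simp add: power2_eq_square mult_ac)
  define e where "e = k / 2 - 3 / (4 :: real)"
  have e: "e \<ge> 5 / 4" using k by (simp add: e_def)
  have Jp: "J powi (- k) * (J\<^sup>2) powr (3 / 4) = (J\<^sup>2) powr (- e)"
  proof -
    have "J powi (- k) = J powr (- k)"
      using powr_real_of_int'[of J "- k"] J by simp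
    moreover have "(J\<^sup>2) powr r = J powr (2 * r)" for r
      using J powr_powr[of J 2 r] by simp
    ultimately show ?thesis by (simp add: e_def flip: powr_add)
  qed
  have Je: "(J\<^sup>2) powr (- e) \<le> (4 * h\<^sup>2) powr e * (int_decay (5 / 4) c * int_decay (5 / 4) d)"
  proof -
    have "(J\<^sup>2) powr (- e) = (4 * h\<^sup>2) powr e * (4 * h\<^sup>2 * J\<^sup>2) powr (- e)"
      using J hy by (simp add: powr_mult powr_minus field_simps)
    also have "(4 * h\<^sup>2 * J\<^sup>2) powr (- e) \<le> P powr (- e)"
      using P P1 e by (intro powr_mono2') auto
    also have "P powr (- e) \<le> P powr (- (5 / 4))"
      using P1 e by (intro powr_mono) auto
    also have "P powr (- (5 / 4)) = int_decay (5 / 4) c * int_decay (5 / 4) d"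
      by (simp add: P_def int_decay_def powr_mult)
    finally show ?thesis by (simp add: mult_left_mono)
  qed
  define x where "x = \<rho> * real_of_int d - \<theta> * real_of_int c"
  define D where "D = int_decay (3 / 2) (n + \<lfloor>x\<rfloor>)"
  have "norm (eis_term k a \<tau> w (c, d, n)) = exp (2 * pi * a * \<rho>\<^sup>2 * y) * (J powi (- k) * exp (- (B * (n + x)\<^sup>2)))"
    unfolding norm_eis_term[OF \<tau> cop w] B_def J_def y_def x_def by (simp add: algebra_simps)
  also have "J powi (- k) * exp (- (B * (n + x)\<^sup>2)) \<le> J powi (- k) * (8 * L powr (3 / 4) * D)"
    unfolding D_def using gaussian_decay[OF B L1 L2] J by (intro mult_left_mono) auto
  also have "\<dots> = 8 * (h\<^sup>2) powr (3 / 4) * (J powi (- k) * (J\<^sup>2) powr (3 / 4)) * D"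
    by (simp add: L_def powr_mult mult_ac)
  also have "\<dots> \<le> 8 * (h\<^sup>2) powr (3 / 4) * ((4 * h\<^sup>2) powr e * (int_decay (5 / 4) c * int_decay (5 / 4) d)) * D"
    unfolding Jp using Je by (intro mult_right_mono mult_left_mono) (auto simp: D_def)
  finally show ?thesis
    by (simp add: eis_majorant_def D_def x_def e_def y_def mult_ac)
qed

lemma exists_real_coordinates:
  assumes "Im \<tau> > 0"
  obtains \<rho> \<theta> :: real where "w = of_real \<rho> * \<tau> + of_real \<theta>"
  using that[of "Im w / Im \<tau>" "Re w - Im w / Im \<tau> * Re \<tau>"] assms
  by (simp add: complex_eq_iff)

lemma summable_eis_term:
  assumes \<tau>: "Im \<tau> > 0" and a: "a \<ge> 1" and k: "k \<ge> 4"
  shows "eis_term k a \<tau> w summable_on eis_index R"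
proof -
  obtain \<rho> \<theta> where w: "w = of_real \<rho> * \<tau> + of_real \<theta>"
    using exists_real_coordinates[OF \<tau>] .
  define h where "h = 1 + (1 + norm \<tau>) / Im \<tau>"
  define K where "K = 8 * (h\<^sup>2) powr (3 / 4) * (4 * h\<^sup>2) powr (k / 2 - 3 / 4) * exp (2 * pi * a * \<rho>\<^sup>2 * Im \<tau>)"
  have "(\<lambda>i. K * eis_majorant \<rho> \<theta> i) summable_on eis_index R"
    using summable_on_cmult_right[OF summable_eis_majorant] by (rule summable_on_subset_banach) auto
  moreover have "norm (eis_term k a \<tau> w i) \<le> K * eis_majorant \<rho> \<theta> i" if "i \<in> eis_index R" for i
    using that eis_term_bound[OF \<tau> _ w _ a k] by (auto simp: eis_index_def K_def h_def)
  ultimately show ?thesis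
    by (rule abs_summable_summable[OF Infinite_Sum.abs_summable_on_comparison_test'])
qed

section \<open>Boundary values\<close>

text \<open>
  Along \<open>\<tau> = i y\<close>, \<open>w = s \<tau>\<close> only the terms with \<open>c = 0\<close> and \<open>n = - s d\<close> survive; each of them
  equals \<open>e(- a s\<^sup>2 \<tau>)\<close>.
\<close>
lemma eis_term_limit:
  assumes a: "a \<ge> 1" and k: "k \<ge> 4" and ev: "even k" and cop: "coprime c d"
  defines "\<tau> \<equiv> \<lambda>m. \<i> * complex_of_real (real (Suc m))"
  shows "(\<lambda>m. ee (of_nat a * (of_int s)\<^sup>2 * \<tau> m) * eis_term k a (\<tau> m) (of_int s * \<tau> m) (c, d, n))
    \<longlonglongrightarrow> (if c = 0 \<and> n = - s * d then 1 else 0)"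
proof -
  define T where "T m = ee (of_nat a * (of_int s)\<^sup>2 * \<tau> m) * eis_term k a (\<tau> m) (of_int s * \<tau> m) (c, d, n)" for m
  have im: "Im (\<tau> m) = real (Suc m)" "Im (\<tau> m) > 0" for m by (simp_all add: \<tau>_def)
  define j where "j m = of_int c * \<tau> m + of_int d" for m
  have w: "of_int s * \<tau> m = of_real (of_int s) * \<tau> m + of_real 0" for m by simp
  have norm_T: "norm (T m) = norm (j m) powi (- k) *
      exp (- (2 * pi * a * real (Suc m) / (norm (j m))\<^sup>2 * (n + s * d)\<^sup>2))" for m
  proof -
    have "norm (ee (of_nat a * (of_int s)\<^sup>2 * \<tau> m)) = exp (- (2 * pi * a * (of_int s)\<^sup>2 * real (Suc m)))"
      unfolding norm_ee by (simp add: \<tau>_def power2_eq_square)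
    hence "norm (T m) = (exp (- (2 * pi * a * (of_int s)\<^sup>2 * real (Suc m))) * exp (2 * pi * a * (of_int s)\<^sup>2 * real (Suc m))) *
      (norm (j m) powi (- k) * exp (- (2 * pi * a * real (Suc m) / (norm (j m))\<^sup>2 * (n + s * d)\<^sup>2)))"
      unfolding T_def norm_mult norm_eis_term[OF im(2) cop w] im(1) j_def by (simp add: mult_ac)
    thus ?thesis by (simp flip: exp_add)
  qed
  have lim_y: "filterlim (\<lambda>m. real (Suc m)) at_top sequentially"
    by (rule filterlim_compose[OF filterlim_real_sequentially filterlim_Suc])
  consider "c \<noteq> 0" | "c = 0" "n \<noteq> - s * d" | "c = 0" "n = - s * d" by blast
  hence "T \<longlonglongrightarrow> (if c = 0 \<and> n = - s * d then 1 else 0)"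
  proof cases
    case 1
    have "norm (T m) \<le> inverse (real (Suc m))" for m
    proof -
      have "1 * real (Suc m) \<le> \<bar>real_of_int c\<bar> * real (Suc m)"
        using 1 by (intro mult_right_mono) linarith+
      also have "\<dots> = \<bar>Im (j m)\<bar>" by (simp add: j_def \<tau>_def abs_mult)
      also have "\<dots> \<le> norm (j m)" by (rule abs_Im_le_cmod)
      finally have J: "real (Suc m) \<le> norm (j m)" by simp
      have "norm (T m) \<le> norm (j m) powi (- k) * 1"
        unfolding norm_T by (intro mult_left_mono) auto
      also have "norm (j m) powi (- k) \<le> norm (j m) powi (- 1)"
        using J k by (intro power_int_increasing) auto
      also have "\<dots> \<le> inverse (real (Suc m))"
        using J by (simp add: power_int_minus le_imp_inverse_le)
      finally show ?thesis by simp
    qed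
    moreover have "(\<lambda>m. inverse (real (Suc m))) \<longlonglongrightarrow> 0"
      by (rule tendsto_inverse_0_at_top[OF lim_y])
    ultimately have "T \<longlonglongrightarrow> 0"
      by (intro Lim_null_comparison[of T]) (auto intro: always_eventually)
    thus ?thesis using 1 by simp
  next
    case 2
    have d: "\<bar>d\<bar> = 1" using cop 2 by simp
    hence "norm (j m) = 1" for m using 2 by (simp add: j_def)
    hence nT: "norm (T m) = exp (- (2 * pi * a * (n + s * d)\<^sup>2 * real (Suc m)))" for m
      unfolding norm_T by (simp add: mult_ac)
    have "n + s * d \<noteq> 0" using 2 by auto
    hence "(real_of_int (n + s * d))\<^sup>2 > 0" by (simp only: zero_less_power2 of_int_eq_0_iff not_False_eq_True)
    hence pos: "2 * pi * a * (real_of_int n + s * d)\<^sup>2 > 0" using a by simp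
    have "(\<lambda>m. exp (- (2 * pi * a * (real_of_int n + s * d)\<^sup>2 * real (Suc m)))) \<longlonglongrightarrow> 0"
      using pos lim_y
      by (intro filterlim_compose[OF exp_at_bot] filterlim_compose[OF filterlim_uminus_at_bot_at_top]
          filterlim_tendsto_pos_mult_at_top[OF tendsto_const])
    hence "T \<longlonglongrightarrow> 0"
      by (intro Lim_null_comparison[of T]) (auto intro!: always_eventually simp: nT)
    thus ?thesis using 2 by simp
  next
    case 3
    have d: "d = 1 \<or> d = - 1" using cop 3 by auto
    obtain p q where pq: "upper_row c d = (p, q)" by (cases "upper_row c d")
    have "p * d - q * c = 1" using upper_row_det[OF cop] by (simp add: pq)
    hence "p * d = 1" using 3(1) by simp
    hence p: "p = d" using d by auto
    have act: "cusp_act c d (\<tau> m) = \<tau> m + of_int (q * d)" for m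
      unfolding cusp_act_def pq fst_conv snd_conv p using d 3(1) by auto
    have "T m = 1" for m
    proof -
      have "j m powi (- k) = 1" using d ev 3 by (auto simp: j_def power_int_minus_left)
      moreover have "of_nat a * ((of_int n)\<^sup>2 * cusp_act c d (\<tau> m) + 2 * of_int n * (of_int s * \<tau> m) / j m
          - of_int c * (of_int s * \<tau> m)\<^sup>2 / j m)
        = - (of_nat a * (of_int s)\<^sup>2 * \<tau> m) + of_int (int a * s\<^sup>2 * q * d)"
        using d unfolding act by (auto simp: 3 j_def power2_eq_square algebra_simps)
      ultimately have "eis_term k a (\<tau> m) (of_int s * \<tau> m) (c, d, n) = ee (- (of_nat a * (of_int s)\<^sup>2 * \<tau> m))"
        unfolding eis_term_def prod.case j_def[symmetric] by (simp only: ee_add_int mult_1_left)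
      thus ?thesis unfolding T_def by (simp add: ee_minus)
    qed
    hence "T = (\<lambda>_. 1)" by (intro ext)
    thus ?thesis using 3 by simp
  qed
  thus ?thesis unfolding T_def .
qed

text \<open>
  The terms have a majorant that does not depend on \<open>\<tau>\<close>, so the limit is taken termwise. The indices
  that survive are \<open>(0, 1, - s)\<close> and \<open>(0, - 1, s)\<close>.
\<close>
lemma eis_part_limit:
  assumes a: "a \<ge> 1" and k: "k \<ge> 4" and ev: "even k"
  defines "\<tau> \<equiv> \<lambda>m. \<i> * complex_of_real (real (Suc m))"
  shows "(\<lambda>m. ee (of_nat a * (of_int s)\<^sup>2 * \<tau> m) * eis_part k a (\<tau> m) (of_int s * \<tau> m) R)
    \<longlonglongrightarrow> 1 / 2 * ((if s \<in> R then 1 else 0) + (if - s \<in> R then 1 else 0))"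
proof -
  define K where "K = (8 * ((3::real)\<^sup>2) powr (3 / 4) * (4 * 3\<^sup>2) powr (k / 2 - 3 / 4))"
  define l :: "int \<times> int \<times> int \<Rightarrow> complex" where "l = (\<lambda>(c, d, n). if c = 0 \<and> n = - s * d then 1 else 0)"
  define t where "t m i = ee (of_nat a * (of_int s)\<^sup>2 * \<tau> m) * eis_term k a (\<tau> m) (of_int s * \<tau> m) i" for m i
  have im: "Im (\<tau> m) = real (Suc m)" "Im (\<tau> m) > 0" for m by (simp_all add: \<tau>_def)
  have bound: "norm (t m i) \<le> K * eis_majorant (of_int s) 0 i" if iR: "i \<in> eis_index R" for m i
  proof -
    from iR obtain c d n where i: "i = (c, d, n)" and cop: "coprime c d" by (auto simp: eis_index_def)
    \<comment> \<open>On the imaginary axis above \<open>i\<close> one has \<open>1 + (1 + y) / y \<le> 3\<close>.\<close>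
    have "norm (\<tau> m) = real (Suc m)" unfolding \<tau>_def norm_mult norm_of_real by simp
    hence h: "3 \<ge> 1 + (1 + norm (\<tau> m)) / Im (\<tau> m)"
      unfolding im(1) by (simp add: field_simps)
    have "norm (eis_term k a (\<tau> m) (of_int s * \<tau> m) i) \<le>
      K * exp (2 * pi * a * (of_int s)\<^sup>2 * real (Suc m)) * eis_majorant (of_int s) 0 i"
      unfolding i K_def im(1)[symmetric] by (rule eis_term_bound[OF im(2) cop _ h a k]) simp
    moreover have "norm (ee (of_nat a * (of_int s)\<^sup>2 * \<tau> m)) = exp (- (2 * pi * a * (of_int s)\<^sup>2 * real (Suc m)))"
      unfolding norm_ee by (simp add: \<tau>_def power2_eq_square)
    ultimately have "norm (t m i) \<le> exp (- (2 * pi * a * (of_int s)\<^sup>2 * real (Suc m))) *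
        (K * exp (2 * pi * a * (of_int s)\<^sup>2 * real (Suc m)) * eis_majorant (of_int s) 0 i)"
      unfolding t_def norm_mult by (simp only:) (rule mult_left_mono, auto)
    also have "\<dots> = (exp (- (2 * pi * a * (of_int s)\<^sup>2 * real (Suc m))) * exp (2 * pi * a * (of_int s)\<^sup>2 * real (Suc m))) *
        (K * eis_majorant (of_int s) 0 i)" by (simp only: mult_ac)
    finally show ?thesis by (simp flip: exp_add)
  qed
  have sum: "(\<lambda>i. K * eis_majorant (of_int s) 0 i) summable_on eis_index R"
    using summable_on_cmult_right[OF summable_eis_majorant] by (rule summable_on_subset_banach) auto
  have "(\<lambda>m. infsum (t m) (eis_index R)) \<longlonglongrightarrow> infsum l (eis_index R)"
  proof (rule infsum_dominated_tendsto[OF sum bound])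
    show "(\<lambda>m. t m i) \<longlonglongrightarrow> l i" if "i \<in> eis_index R" for i
    proof -
      from that obtain c d n where i: "i = (c, d, n)" and cop: "coprime c d" by (auto simp: eis_index_def)
      show ?thesis using eis_term_limit[OF a k ev cop] by (simp add: t_def l_def i \<tau>_def)
    qed
  qed
  also have "infsum l (eis_index R) = infsum l (eis_index R \<inter> {(0, 1, - s), (0, - 1, s)})"
  proof (rule infsum_cong_neutral)
    fix i assume "i \<in> eis_index R - eis_index R \<inter> {(0, 1, - s), (0, - 1, s)}"
    thus "l i = 0" by (cases i) (auto simp: l_def eis_index_def abs_if split: if_splits)
  qed auto
  also have "\<dots> = (if s \<in> R then 1 else 0) + (if - s \<in> R then 1 else 0)"
  proof -
    have "eis_index R \<inter> {(0, 1, - s), (0, - 1, s)} =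
      (if - s \<in> R then {(0, 1, - s)} else {}) \<union> (if s \<in> R then {(0, - 1, s)} else {})"
      by (auto simp: eis_index_def)
    thus ?thesis by (auto simp: l_def)
  qed
  finally have "(\<lambda>m. 1 / 2 * infsum (t m) (eis_index R))
      \<longlonglongrightarrow> 1 / 2 * ((if s \<in> R then 1 else 0) + (if - s \<in> R then 1 else 0))"
    by (rule tendsto_mult_left)
  moreover have "1 / 2 * infsum (t m) (eis_index R)
      = ee (of_nat a * (of_int s)\<^sup>2 * \<tau> m) * eis_part k a (\<tau> m) (of_int s * \<tau> m) R" for m
    unfolding t_def by (simp add: infsum_cmult_right' eis_part_def)
  ultimately show ?thesis by simp
qed

text \<open>
  The pairs \<open>(c, d)\<close> and \<open>(- c, - d)\<close> give the same image of \<open>\<tau>\<close> up to an integer, and the sign of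
  \<open>c \<tau> + d\<close> is compensated by that of \<open>n\<close> in the exponent and by the evenness of \<open>k\<close> in front.
\<close>
lemma eis_term_minus:
  assumes \<tau>: "Im \<tau> > 0" and cop: "coprime c d" and ev: "even k"
  shows "eis_term k a \<tau> w (- c, - d, - n) = eis_term k a \<tau> w (c, d, n)"
proof -
  obtain p q where pq: "upper_row (- c) (- d) = (p, q)" by (cases "upper_row (- c) (- d)")
  have "p * (- d) - q * (- c) = 1" using upper_row_det[of "- c" "- d"] cop by (simp add: pq)
  hence "(- p) * d - (- q) * c = 1" by simp
  then obtain t where t: "(of_int (- p) * \<tau> + of_int (- q)) / (of_int c * \<tau> + of_int d) = cusp_act c d \<tau> + of_int t"
    using cusp_act_eq[OF \<tau> _ cop] by metis
  define j where "j = of_int c * \<tau> + of_int d"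
  have mj: "of_int (- c) * \<tau> + of_int (- d) = - j" by (simp add: j_def)
  have "cusp_act (- c) (- d) \<tau> = (of_int p * \<tau> + of_int q) / (- j)"
    by (simp only: cusp_act_def pq mj fst_conv snd_conv)
  also have "\<dots> = - (of_int p * \<tau> + of_int q) / j"
    by (metis minus_divide_left minus_divide_right)
  also have "\<dots> = cusp_act c d \<tau> + of_int t"
    unfolding t[symmetric] by (simp add: j_def)
  finally have act: "cusp_act (- c) (- d) \<tau> = cusp_act c d \<tau> + of_int t" .
  have "of_nat a * ((of_int (- n))\<^sup>2 * cusp_act (- c) (- d) \<tau> + 2 * of_int (- n) * w / (- j) - of_int (- c) * w\<^sup>2 / (- j))
    = of_nat a * ((of_int n)\<^sup>2 * cusp_act c d \<tau> + 2 * of_int n * w / j - of_int c * w\<^sup>2 / j) + of_int (int a * n\<^sup>2 * t)"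
    unfolding act by (simp add: algebra_simps)
  moreover have "(- j) powi (- k) = j powi (- k)" using ev by (simp add: power_int_minus_left)
  ultimately show ?thesis
    unfolding eis_term_def prod.case mj j_def[symmetric] by (simp only: ee_add_int)
qed

lemma eis_part_minus:
  assumes "Im \<tau> > 0" "even k"
  shows "eis_part k a \<tau> w (uminus ` R) = eis_part k a \<tau> w R"
proof -
  have "infsum (eis_term k a \<tau> w) (eis_index (uminus ` R)) = infsum (eis_term k a \<tau> w) (eis_index R)"
    by (rule infsum_reindex_bij_witness[where i = "\<lambda>(c, d, n). (- c, - d, - n)" and j = "\<lambda>(c, d, n). (- c, - d, - n)"])
      (use assms eis_term_minus[of \<tau> _ _ k a w "- _"] in \<open>auto simp: eis_index_def\<close>)
  thus ?thesis by (simp add: eis_part_def)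
qed

lemma eis_part_disjoint_union:
  assumes "Im \<tau> > 0" "a \<ge> 1" "k \<ge> 4" "finite S"
    and disj: "\<And>s t. s \<in> S \<Longrightarrow> t \<in> S \<Longrightarrow> s \<noteq> t \<Longrightarrow> R s \<inter> R t = {}"
  shows "eis_part k a \<tau> w (\<Union>s\<in>S. R s) = (\<Sum>s\<in>S. eis_part k a \<tau> w (R s))"
proof -
  have "eis_index (\<Union>s\<in>S. R s) = (\<Union>s\<in>S. eis_index (R s))" by (auto simp: eis_index_def)
  moreover have "(\<Sum>s\<in>S. infsum (eis_term k a \<tau> w) (eis_index (R s)))
      = infsum (eis_term k a \<tau> w) (\<Union>s\<in>S. eis_index (R s))"
    using assms(1-4) summable_eis_term disj by (intro sum_infsum) (fastforce simp: eis_index_def)+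
  ultimately show ?thesis
    by (simp add: eis_part_def flip: sum_divide_distrib)
qed

text \<open>
  The term at \<open>(n, r)\<close> decays with the exponent \<open>n + r \<sigma> + m \<sigma>\<^sup>2\<close>, which is
  \<open>(4 n m - r\<^sup>2) / (4 m) + m (\<sigma> + r / (2 m))\<^sup>2\<close> and hence positive for a cusp form. The terms decrease
  in \<open>y\<close>, so those at \<open>y = 1\<close> form a majorant.
\<close>
lemma jacobi_cusp_form_limit:
  fixes s :: int
  assumes "\<phi> \<in> jacobi_cusp_forms k m" and m: "m = a * b\<^sup>2" "m \<ge> 1"
  defines "\<tau> \<equiv> \<lambda>n. \<i> * complex_of_real (real (Suc n))"
  defines "\<sigma> \<equiv> of_int s / of_nat b :: real"
  shows "(\<lambda>n. ee (of_nat a * (of_int s)\<^sup>2 * \<tau> n) * \<phi> (\<tau> n) (of_real \<sigma> * \<tau> n)) \<longlonglongrightarrow> 0"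
proof -
  obtain c where c: "jacobi_expansion \<phi> c" "\<And>n r. c n r \<noteq> 0 \<Longrightarrow> r\<^sup>2 < 4 * n * int m"
    using assms(1) by (auto simp: jacobi_cusp_forms_def)
  define t where "t N = (\<lambda>(n, r). ee (of_nat a * (of_int s)\<^sup>2 * \<tau> N) *
     (c n r * ee (of_int n * \<tau> N + of_int r * (of_real \<sigma> * \<tau> N))))" for N
  define e where "e = (\<lambda>(n, r). of_int n + of_int r * \<sigma> + a * (real_of_int s)\<^sup>2)"
  have im: "Im (\<tau> N) = real (Suc N)" "Re (\<tau> N) = 0" for N by (simp_all add: \<tau>_def)
  have norm_t: "norm (t N i) = norm (c (fst i) (snd i)) * exp (- (2 * pi * real (Suc N) * e i))" for N i
  proof -
    have "Im (of_nat a * (of_int s)\<^sup>2 * \<tau> N) = a * (real_of_int s)\<^sup>2 * real (Suc N)"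
      by (simp add: im power2_eq_square)
    moreover have "Im (of_int (fst i) * \<tau> N + of_int (snd i) * (of_real \<sigma> * \<tau> N)) = (of_int (fst i) + of_int (snd i) * \<sigma>) * real (Suc N)"
      by (simp add: im algebra_simps)
    ultimately have "norm (t N i) = norm (c (fst i) (snd i)) *
      exp (- 2 * pi * (a * (real_of_int s)\<^sup>2 * real (Suc N)) + - 2 * pi * ((of_int (fst i) + of_int (snd i) * \<sigma>) * real (Suc N)))"
      by (simp only: t_def case_prod_beta norm_mult norm_ee exp_add mult_ac)
    thus ?thesis by (simp add: e_def case_prod_beta algebra_simps)
  qed
  have b: "b \<ge> 1" using m by (cases b) auto
  have pos: "e i > 0" if "c (fst i) (snd i) \<noteq> 0" for i
  proof -
    obtain n r where i: "i = (n, r)" by (cases i)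
    have "r\<^sup>2 < 4 * n * int m" using c(2)[of n r] that by (simp add: i)
    hence "real_of_int (r\<^sup>2) < real_of_int (4 * n * int m)" by (simp only: of_int_less_iff)
    hence r: "(real_of_int r)\<^sup>2 < 4 * n * real m" by simp
    have "real a * (real_of_int s)\<^sup>2 = m * \<sigma>\<^sup>2"
      using b by (simp add: \<sigma>_def m power_divide)
    hence "4 * real m * e i = (4 * n * real m - (real_of_int r)\<^sup>2) + (r + 2 * m * \<sigma>)\<^sup>2"
      by (simp add: e_def i power2_eq_square algebra_simps)
    also have "\<dots> > 0" using r by (intro add_pos_nonneg) auto
    finally have "0 < 4 * real m * e i" .
    thus ?thesis using m(2) by (simp add: zero_less_mult_iff)
  qed
  have has: "(t N has_sum (ee (of_nat a * (of_int s)\<^sup>2 * \<tau> N) * \<phi> (\<tau> N) (of_real \<sigma> * \<tau> N))) UNIV" for N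
  proof -
    have "((\<lambda>(n, r). c n r * ee (of_int n * \<tau> N + of_int r * (of_real \<sigma> * \<tau> N))) has_sum \<phi> (\<tau> N) (of_real \<sigma> * \<tau> N)) UNIV"
      using c(1) im[of N] by (simp add: jacobi_expansion_def)
    from has_sum_cmult_right[OF this, of "ee (of_nat a * (of_int s)\<^sup>2 * \<tau> N)"]
    show ?thesis by (simp add: t_def case_prod_unfold)
  qed
  have "t 0 summable_on UNIV" using has_sum_imp_summable[OF has] .
  hence s0: "(\<lambda>i. norm (t 0 i)) summable_on UNIV" by (simp add: summable_on_iff_abs_summable_on_complex)
  have "(\<lambda>N. infsum (t N) UNIV) \<longlonglongrightarrow> infsum (\<lambda>_. 0) (UNIV :: (int \<times> int) set)"
  proof (rule infsum_dominated_tendsto[OF s0])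
    show "norm (t N i) \<le> norm (t 0 i)" for N i
    proof (cases "c (fst i) (snd i) = 0")
      case False
      have "2 * pi * real (Suc 0) * e i \<le> 2 * pi * real (Suc N) * e i"
        using pos[OF False] by (intro mult_right_mono mult_left_mono) auto
      thus ?thesis unfolding norm_t by (intro mult_left_mono) auto
    qed (simp add: norm_t)
    show "(\<lambda>N. t N i) \<longlonglongrightarrow> 0" for i
    proof (cases "c (fst i) (snd i) = 0")
      case True
      hence "t N i = 0" for N using norm_t[of N i] by simp
      thus ?thesis by simp
    next
      case False
      have "(\<lambda>N. exp (- (2 * pi * e i * real (Suc N)))) \<longlonglongrightarrow> 0"
        using pos[OF False]
        by (intro filterlim_compose[OF exp_at_bot] filterlim_compose[OF filterlim_uminus_at_bot_at_top]
          filterlim_tendsto_pos_mult_at_top[OF tendsto_const] filterlim_compose[OF filterlim_real_sequentially filterlim_Suc]) auto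
      from tendsto_mult_left[OF this, of "norm (c (fst i) (snd i))"]
      have "(\<lambda>N. norm (t N i)) \<longlonglongrightarrow> 0" by (simp add: norm_t mult_ac)
      thus ?thesis by (rule tendsto_norm_zero_cancel)
    qed
  qed
  thus ?thesis using infsumI[OF has] by simp
qed

section \<open>Divergence in small weight\<close>

text \<open>
  Summability over coprime pairs would imply summability over all pairs, by scaling with a common
  factor; but each row of the full sum contributes a term of the harmonic series.
\<close>
lemma not_summable_coprime_pairs:
  "\<not> (\<lambda>(c, d). 1 / (real c + real d)\<^sup>2) summable_on {(c, d). coprime c d \<and> c \<ge> 1 \<and> d \<ge> (1::nat)}"
proof
  define A where "A = {(c, d). coprime c d \<and> c \<ge> 1 \<and> d \<ge> (1::nat)}"
  assume "(\<lambda>(c, d). 1 / (real c + real d)\<^sup>2) summable_on {(c, d). coprime c d \<and> c \<ge> 1 \<and> d \<ge> (1::nat)}"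
  hence 1: "(\<lambda>(c, d). 1 / (real c + real d)\<^sup>2) summable_on A" by (simp add: A_def)
  have "(\<lambda>n. 1 / (real n)\<^sup>2) summable_on UNIV"
    using inverse_power_summable[of 2, where 'a = real]
    by (intro summable_nonneg_imp_summable_on) (auto simp: inverse_eq_divide)
  hence 2: "(\<lambda>n. 1 / (real n)\<^sup>2) summable_on {1..}" by (rule summable_on_subset_banach) auto
  have "(\<lambda>(g, i). 1 / (real g)\<^sup>2 * (case i of (c, d) \<Rightarrow> 1 / (real c + real d)\<^sup>2)) summable_on {1..} \<times> A"
    by (rule summable_on_times_nonneg[OF 2 1]) auto
  also have "?this \<longleftrightarrow> (\<lambda>(x, y). 1 / (real x + real y)\<^sup>2) summable_on {1..} \<times> {1..}"
  proof (rule summable_on_reindex_bij_witness[where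
        i = "\<lambda>(x, y). (gcd x y, (x div gcd x y, y div gcd x y))" and j = "\<lambda>(g, (c, d)). (g * c, g * d)"], goal_cases)
    case (1 i)
    thus ?case by (auto simp: A_def gcd_mult_distrib_nat[symmetric])
  next
    case (2 i)
    thus ?case by (auto simp: A_def)
  next
    case (3 i)
    thus ?case by auto
  next
    case (4 i)
    obtain x y where xy: "i = (x, y)" "x \<ge> 1" "y \<ge> 1" using 4 by auto
    have g: "gcd x y > 0" using xy by simp
    have "x div gcd x y \<ge> 1" "y div gcd x y \<ge> 1"
      using xy g by (auto simp: Suc_le_eq div_greater_zero_iff intro!: dvd_imp_le)
    thus ?case using xy g by (auto simp: A_def Suc_le_eq intro!: div_gcd_coprime)
  next
    case (5 i)
    thus ?case by (auto simp: A_def power_mult_distrib simp flip: distrib_left)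
  qed
  finally have all: "(\<lambda>(x, y). 1 / (real x + real y)\<^sup>2) summable_on {1..} \<times> {1..}" .
  have row: "(\<lambda>y. 1 / (real x + real y)\<^sup>2) summable_on {1..}" if "x \<in> {1..}" for x
    using summable_on_SigmaD1[OF all that] by simp
  have "(\<lambda>x. \<Sum>\<^sub>\<infinity>y\<in>{1..}. 1 / (real x + real y)\<^sup>2) summable_on {1..}"
    using summable_on_SigmaD[OF all] row by simp
  moreover have "1 / 4 * inverse (real x) \<le> (\<Sum>\<^sub>\<infinity>y\<in>{1..}. 1 / (real x + real y)\<^sup>2)" if "x \<in> {1..}" for x
  proof -
    have x: "real x > 0" using that by simp
    have "1 / 4 * inverse (real x) = (\<Sum>y\<in>{1..x}. 1 / (2 * real x)\<^sup>2)"
      using x by (simp add: power2_eq_square field_simps)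
    also have "\<dots> \<le> (\<Sum>y\<in>{1..x}. 1 / (real x + real y)\<^sup>2)"
      using x by (intro sum_mono divide_left_mono power_mono) auto
    also have "\<dots> \<le> (\<Sum>\<^sub>\<infinity>y\<in>{1..}. 1 / (real x + real y)\<^sup>2)"
      using row[OF that] by (intro finite_sum_le_infsum) auto
    finally show ?thesis .
  qed
  ultimately have "(\<lambda>x. 1 / 4 * inverse (real x)) summable_on {1..}"
    by (rule summable_on_comparison_test) auto
  hence "(\<lambda>x. inverse (real x)) summable_on {1..}"
    by (subst (asm) summable_on_cmult_right') auto
  also have "?this \<longleftrightarrow> (\<lambda>x. inverse (real x)) summable_on UNIV"
    by (rule summable_on_cong_neutral) auto
  finally have "summable (\<lambda>x. inverse (real x))" by (rule summable_on_imp_summable)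
  thus False using not_summable_harmonic[where 'a = real] by simp
qed

text \<open>
  For every coprime pair one integer \<open>n\<close> in the residue class makes the Gaussian factor bounded
  below, so the sum dominates the sum of \<open>|c \<tau> + d|\<^bsup>-2\<^esup>\<close>.
\<close>
lemma not_summable_eis_term:
  assumes \<tau>: "Im \<tau> > 0" and k: "k \<le> 2" and b: "b \<ge> (1::nat)"
  shows "\<not> eis_term k a \<tau> w summable_on eis_index {n. int b dvd n - s}"
proof
  assume "eis_term k a \<tau> w summable_on eis_index {n. int b dvd n - s}"
  hence abs: "(\<lambda>i. norm (eis_term k a \<tau> w i)) summable_on eis_index {n. int b dvd n - s}"
    by (simp add: summable_on_iff_abs_summable_on_complex)
  obtain \<rho> \<theta> where w: "w = of_real \<rho> * \<tau> + of_real \<theta>"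
    using exists_real_coordinates[OF \<tau>] .
  define A where "A = {(c, d). coprime c d \<and> c \<ge> 1 \<and> d \<ge> (1::nat)}"
  define x where "x c d = \<rho> * real d - \<theta> * real c" for c d :: nat
  \<comment> \<open>The member of the residue class for which \<open>N c d + x c d\<close> lies in \<open>[0, b)\<close>.\<close>
  define N where "N c d = s - int b * \<lfloor>(s + x c d) / b\<rfloor>" for c d
  define \<iota> where "\<iota> = (\<lambda>(c, d). (int c, int d, N c d))"
  have N: "0 \<le> N c d + x c d" "N c d + x c d \<le> b" for c d
  proof -
    have "N c d + x c d = b * ((s + x c d) / b - \<lfloor>(s + x c d) / b\<rfloor>)"
      using b by (simp add: N_def right_diff_distrib)
    moreover have "0 \<le> (s + x c d) / b - \<lfloor>(s + x c d) / b\<rfloor>" "(s + x c d) / b - \<lfloor>(s + x c d) / b\<rfloor> \<le> 1"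
      by linarith+
    ultimately show "0 \<le> N c d + x c d" "N c d + x c d \<le> b"
      using b mult_left_mono[of "(s + x c d) / b - \<lfloor>(s + x c d) / b\<rfloor>" 1 "real b"] by simp_all
  qed
  have inj: "inj_on \<iota> A" by (auto simp: inj_on_def \<iota>_def)
  have sub: "\<iota> ` A \<subseteq> eis_index {n. int b dvd n - s}"
    by (auto simp: \<iota>_def A_def eis_index_def N_def)
  have "(\<lambda>i. norm (eis_term k a \<tau> w i)) summable_on \<iota> ` A"
    using abs sub by (rule summable_on_subset_banach)
  hence sumA: "(\<lambda>i. norm (eis_term k a \<tau> w (\<iota> i))) summable_on A"
    unfolding summable_on_reindex[OF inj] by (simp add: o_def)
  define h where "h = 1 + (1 + norm \<tau>) / Im \<tau>"
  have h: "h > 0" using \<tau> by (auto simp: h_def intro!: add_pos_nonneg)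
  define E where "E = exp (2 * pi * a * \<rho>\<^sup>2 * Im \<tau>) * exp (- (2 * pi * a * Im \<tau> * h\<^sup>2 * (real b)\<^sup>2))"
  define K where "K = h powi (k - 2) * E / (1 + norm \<tau>)\<^sup>2"
  have K: "K > 0" unfolding K_def E_def using h
    by (intro divide_pos_pos mult_pos_pos zero_less_power_int zero_less_power add_pos_nonneg) auto
  have "K * (1 / (real c + real d)\<^sup>2) \<le> norm (eis_term k a \<tau> w (\<iota> (c, d)))" if "(c, d) \<in> A" for c d
  proof -
    have cop: "coprime (int c) (int d)" and c1: "c \<ge> 1" using that by (auto simp: A_def)
    define J where "J = norm (of_int (int c) * \<tau> + of_int (int d))"
    have hJ: "1 \<le> h * J"
      unfolding J_def by (rule denominator_lower_bound(1)[OF \<tau> cop]) (simp add: h_def)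
    have J: "J > 0" using denominator_nonzero[OF \<tau> cop] by (simp add: J_def)
    have hJ2: "inverse h \<le> J" using hJ h by (simp add: field_simps)
    have e: "norm (eis_term k a \<tau> w (\<iota> (c, d))) = J powi (- k) * exp (2 * pi * a * \<rho>\<^sup>2 * Im \<tau>) *
      exp (- (2 * pi * a * Im \<tau> / J\<^sup>2 * (N c d + x c d)\<^sup>2))"
      unfolding \<iota>_def prod.case norm_eis_term[OF \<tau> cop w] J_def x_def by (simp add: algebra_simps)
    have "2 * pi * a * Im \<tau> / J\<^sup>2 * (N c d + x c d)\<^sup>2 \<le> 2 * pi * a * Im \<tau> * h\<^sup>2 * (real b)\<^sup>2"
    proof -
      have "1 \<le> (h * J)\<^sup>2" using hJ by simp
      hence "1 / J\<^sup>2 \<le> h\<^sup>2" using J by (simp add: field_simps)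
      hence "2 * pi * a * Im \<tau> * (1 / J\<^sup>2) \<le> 2 * pi * a * Im \<tau> * h\<^sup>2"
        using \<tau> by (intro mult_left_mono) auto
      note 1 = this
      have 2: "(N c d + x c d)\<^sup>2 \<le> (real b)\<^sup>2" using N by (intro power_mono) auto
      have "2 * pi * a * Im \<tau> * (1 / J\<^sup>2) * (N c d + x c d)\<^sup>2 \<le> 2 * pi * a * Im \<tau> * h\<^sup>2 * (real b)\<^sup>2"
        using \<tau> by (intro mult_mono[OF 1 2]) auto
      thus ?thesis by simp
    qed
    hence 1: "E \<le> exp (2 * pi * a * \<rho>\<^sup>2 * Im \<tau>) * exp (- (2 * pi * a * Im \<tau> / J\<^sup>2 * (N c d + x c d)\<^sup>2))"
      unfolding E_def by simp
    have 2: "h powi (k - 2) / J\<^sup>2 \<le> J powi (- k)"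
    proof -
      have "h powi (k - 2) = inverse h powi (2 - k)"
        using power_int_minus[of h "2 - k"] by (simp add: power_int_inverse)
      also have "\<dots> \<le> J powi (2 - k)"
        using hJ2 h k by (intro power_int_mono) auto
      also have "\<dots> = J\<^sup>2 * J powi (- k)"
        using J power_int_add[of J 2 "- k"] by simp
      finally show ?thesis using J by (simp add: field_simps)
    qed
    have 3: "1 / ((1 + norm \<tau>)\<^sup>2 * (real c + real d)\<^sup>2) \<le> 1 / J\<^sup>2"
    proof -
      have "J \<le> real c * norm \<tau> + real d"
        unfolding J_def by (rule order_trans[OF norm_triangle_ineq]) (simp add: norm_mult)
      also have "\<dots> \<le> (1 + norm \<tau>) * (real c + real d)" by (simp add: algebra_simps)
      finally have "J\<^sup>2 \<le> ((1 + norm \<tau>) * (real c + real d))\<^sup>2" using J by (intro power_mono) auto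
      thus ?thesis using J by (intro frac_le) (auto simp: power_mult_distrib)
    qed
    have "K * (1 / (real c + real d)\<^sup>2) = h powi (k - 2) * (1 / ((1 + norm \<tau>)\<^sup>2 * (real c + real d)\<^sup>2)) * E"
      by (simp add: K_def)
    also have "\<dots> \<le> h powi (k - 2) * (1 / J\<^sup>2) * E"
      using 3 h by (intro mult_right_mono mult_left_mono) (auto simp: E_def)
    also have "\<dots> \<le> J powi (- k) * (exp (2 * pi * a * \<rho>\<^sup>2 * Im \<tau>) * exp (- (2 * pi * a * Im \<tau> / J\<^sup>2 * (N c d + x c d)\<^sup>2)))"
      using 1 2 J by (intro mult_mono) (auto simp: E_def)
    finally show ?thesis unfolding e by (simp add: mult.assoc)
  qed
  hence "(\<lambda>i. K * (case i of (c, d) \<Rightarrow> 1 / (real c + real d)\<^sup>2)) summable_on A"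
    using K by (intro summable_on_comparison_test[OF sumA]) auto
  hence "(\<lambda>(c, d). 1 / (real c + real d)\<^sup>2) summable_on A"
    using K by (subst (asm) summable_on_cmult_right') auto
  thus False using not_summable_coprime_pairs by (simp add: A_def)
qed

section \<open>Divisor sums\<close>

lemma moebius_mu_prime_mult:
  assumes p: "prime p" and d: "\<not> p dvd d"
  shows "moebius_mu (p * d) = - moebius_mu d"
proof -
  have nz: "p \<noteq> 0" "d \<noteq> 0" using p d by (auto intro: ccontr)
  have "coprime p d" using p d by (simp add: prime_imp_coprime)
  hence sf: "squarefree (p * d) \<longleftrightarrow> squarefree d"
    using p by (auto intro: squarefree_mult_coprime squarefree_prime dest: squarefree_multD)
  have "prime_factors (p * d) = insert p (prime_factors d)"
    using nz p by (simp add: prime_factors_product prime_factorization_prime)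
  moreover have "p \<notin> prime_factors d" using d by (auto simp: prime_factors_dvd)
  ultimately have "card (prime_factors (p * d)) = Suc (card (prime_factors d))" by simp
  thus ?thesis by (simp add: moebius_mu_def sf)
qed

text \<open>
  For a prime \<open>p\<close> dividing \<open>n\<close>, the square-free divisors not divisible by \<open>p\<close> cancel against their
  products with \<open>p\<close>.
\<close>
lemma sum_moebius_mu:
  assumes "n \<ge> 1"
  shows "(\<Sum>d | d dvd n. moebius_mu d) = (if n = 1 then 1 else 0)"
proof (cases "n = 1")
  case True
  thus ?thesis by (simp add: moebius_mu_def)
next
  case False
  then obtain p where p: "prime p" "p dvd n" using prime_factor_nat by blast
  have fin: "finite {d. d dvd n}" using assms by simp
  define S where "S = {d. d dvd n \<and> squarefree d \<and> \<not> p dvd d}"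
  have finS: "finite S" unfolding S_def using fin by (rule rev_finite_subset) auto
  have "(\<Sum>d | d dvd n. moebius_mu d) = (\<Sum>d\<in>S \<union> (\<lambda>d. p * d) ` S. moebius_mu d)"
  proof (rule sum.mono_neutral_right[OF fin])
    have "p * d dvd n" if "d \<in> S" for d
      using that p by (auto simp: S_def intro: divides_mult prime_imp_coprime)
    thus "S \<union> (\<lambda>d. p * d) ` S \<subseteq> {d. d dvd n}" by (auto simp: S_def)
    show "\<forall>d\<in>{d. d dvd n} - (S \<union> (\<lambda>d. p * d) ` S). moebius_mu d = 0"
    proof
      fix d assume d: "d \<in> {d. d dvd n} - (S \<union> (\<lambda>d. p * d) ` S)"
      have "\<not> squarefree d"
      proof
        assume sf: "squarefree d"
        hence "p dvd d" using d by (auto simp: S_def)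
        then obtain e where e: "d = p * e" by (elim dvdE)
        have "\<not> p dvd e"
        proof
          assume "p dvd e"
          hence "p\<^sup>2 dvd d" unfolding e power2_eq_square by (rule mult_dvd_mono[OF dvd_refl])
          hence "p dvd 1" using squarefreeD[OF sf] by blast
          thus False using p by simp
        qed
        hence "e \<in> S" using d sf e by (auto simp: S_def dest: squarefree_multD dvd_mult_right)
        thus False using d e by auto
      qed
      thus "moebius_mu d = 0" by (simp add: moebius_mu_def)
    qed
  qed
  also have "\<dots> = (\<Sum>d\<in>S. moebius_mu d) + (\<Sum>d\<in>(\<lambda>d. p * d) ` S. moebius_mu d)"
    using finS by (intro sum.union_disjoint) (auto simp: S_def)
  also have "(\<Sum>d\<in>(\<lambda>d. p * d) ` S. moebius_mu d) = (\<Sum>d\<in>S. moebius_mu (p * d))"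
    using p(1) by (subst sum.reindex) (auto simp: inj_on_def prime_gt_0_nat)
  also have "\<dots> = - (\<Sum>d\<in>S. moebius_mu d)"
    using moebius_mu_prime_mult[OF p(1)] by (simp add: S_def sum_negf)
  finally show ?thesis using False by simp
qed

text \<open>
  The coefficient of \<open>E s\<close> is a sum over pairs \<open>(l, d)\<close> with \<open>l d\<close> dividing \<open>gcd s b\<close>; summing over
  \<open>d\<close> first leaves \<open>l = gcd s b\<close>.
\<close>
lemma moebius_inversion_gcd:
  fixes A E :: "nat \<Rightarrow> complex"
  assumes b: "b \<ge> 1"
  shows "(\<Sum>l | l dvd b. A l * (\<Sum>d | d * l dvd b. of_int (moebius_mu d) * (\<Sum>s | s < b \<and> d * l dvd s. E s)))
    = (\<Sum>s<b. A (gcd s b) * E s)"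
proof -
  have fin_l: "finite {l. l dvd b}" using b by simp
  have fin_d: "finite {d. d * l dvd b}" for l
    using b by (intro finite_subset[OF _ fin_l]) (auto dest: dvd_mult_left)
  have inner: "(\<Sum>d | d * l dvd b. of_int (moebius_mu d) * (if d * l dvd s then 1 else 0))
      = (if l = gcd s b then 1 else (0 :: complex))" if l: "l dvd b" for l s
  proof -
    define g where "g = gcd s b"
    have g: "g \<ge> 1" using b by (simp add: g_def Suc_le_eq)
    have l0: "l > 0" using l b by (auto intro: Nat.gr0I)
    have "(\<Sum>d | d * l dvd b. of_int (moebius_mu d) * (if d * l dvd s then 1 else (0 :: complex)))
        = (\<Sum>d | d * l dvd g. of_int (moebius_mu d))"
      by (rule sum.mono_neutral_cong_right[OF fin_d]) (auto simp: g_def)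
    also have "\<dots> = (if l = g then 1 else 0)"
    proof (cases "l dvd g")
      case True
      then obtain e where e: "g = e * l" by (metis dvd_def mult.commute)
      have "{d. d * l dvd g} = {d. d dvd e}" using l0 by (auto simp: e)
      moreover have "e \<ge> 1" using g e by (cases e) auto
      ultimately have "(\<Sum>d | d * l dvd g. of_int (moebius_mu d)) = (of_int (if e = 1 then 1 else 0) :: complex)"
        using sum_moebius_mu[of e] by (simp flip: of_int_sum)
      thus ?thesis using l0 by (simp add: e)
    next
      case False
      hence "{d. d * l dvd g} = {}" by (auto dest: dvd_mult_right)
      thus ?thesis using False by auto
    qed
    finally show ?thesis by (simp add: g_def)
  qed
  have "(\<Sum>l | l dvd b. A l * (\<Sum>d | d * l dvd b. of_int (moebius_mu d) * (\<Sum>s | s < b \<and> d * l dvd s. E s)))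
     = (\<Sum>l | l dvd b. A l * (\<Sum>d | d * l dvd b. of_int (moebius_mu d) * (\<Sum>s<b. (if d * l dvd s then 1 else 0) * E s)))"
  proof -
    have "(\<Sum>s | s < b \<and> d * l dvd s. E s) = (\<Sum>s<b. (if d * l dvd s then 1 else 0) * E s)" for l d
      by (rule sum.mono_neutral_cong_left) auto
    thus ?thesis by simp
  qed
  also have "\<dots> = (\<Sum>l | l dvd b. \<Sum>s<b. A l * E s * (\<Sum>d | d * l dvd b. of_int (moebius_mu d) * (if d * l dvd s then 1 else 0)))"
  proof (intro sum.cong refl)
    fix l
    have "(\<Sum>d | d * l dvd b. of_int (moebius_mu d) * (\<Sum>s<b. (if d * l dvd s then 1 else 0) * E s))
       = (\<Sum>s<b. \<Sum>d | d * l dvd b. of_int (moebius_mu d) * ((if d * l dvd s then 1 else 0) * E s))"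
      unfolding sum_distrib_left by (rule sum.swap)
    thus "A l * (\<Sum>d | d * l dvd b. of_int (moebius_mu d) * (\<Sum>s<b. (if d * l dvd s then 1 else 0) * E s))
       = (\<Sum>s<b. A l * E s * (\<Sum>d | d * l dvd b. of_int (moebius_mu d) * (if d * l dvd s then 1 else 0)))"
      by (simp only: sum_distrib_left) (simp only: mult_ac)
  qed
  also have "\<dots> = (\<Sum>l | l dvd b. \<Sum>s<b. A l * E s * (if l = gcd s b then 1 else 0))"
    by (intro sum.cong refl) (simp only: inner mem_Collect_eq)
  also have "\<dots> = (\<Sum>s<b. \<Sum>l | l dvd b. if l = gcd s b then A l * E s else 0)"
    by (subst sum.swap) (intro sum.cong refl, simp)
  also have "\<dots> = (\<Sum>s<b. A (gcd s b) * E s)"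
    using fin_l by (simp add: sum.delta')
  finally show ?thesis .
qed

text \<open>
  A prime has multiplicity at most one in the square-free factor, so its multiplicity in \<open>b\<close> is half
  of that in the product, rounded down.
\<close>
lemma squarefree_times_square_unique:
  fixes a a' b b' :: nat
  assumes eq: "a * b\<^sup>2 = a' * b'\<^sup>2" and pos: "a * b\<^sup>2 \<noteq> 0" and sf: "squarefree a" "squarefree a'"
  shows "a = a'" "b = b'"
proof -
  have "a' * b'\<^sup>2 \<noteq> 0" using eq pos by metis
  with pos have nz: "a \<noteq> 0" "b \<noteq> 0" "a' \<noteq> 0" "b' \<noteq> 0" by auto
  have part: "multiplicity p b = multiplicity p (a * b\<^sup>2) div 2"
    if "prime p" "squarefree a" "a \<noteq> 0" "b \<noteq> 0" for p a b :: nat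
  proof -
    have "multiplicity p a \<le> 1" using that by (simp add: squarefree_factorial_semiring'')
    moreover have "multiplicity p (a * b\<^sup>2) = multiplicity p a + 2 * multiplicity p b"
      using that by (simp add: prime_elem_multiplicity_mult_distrib prime_elem_multiplicity_power_distrib)
    ultimately show ?thesis by simp
  qed
  have "multiplicity p b = multiplicity p b'" if "prime p" for p
    unfolding part[OF that sf(1) nz(1,2)] part[OF that sf(2) nz(3,4)] eq ..
  thus bb: "b = b'" using nz by (auto intro!: multiplicity_eq_nat[of b b'])
  show "a = a'" using eq nz(4) unfolding bb by simp
qed

section \<open>The Eisenstein part\<close>

text \<open>
  The coefficients are Fourier coefficients of \<open>f\<close> on the line \<open>Im \<tau> = 1\<close>.
\<close>
lemma cusp_expansion_zero:
  assumes a: "cusp_expansion f a" and f: "\<And>\<tau>. Im \<tau> > 0 \<Longrightarrow> f \<tau> = 0" and "n \<ge> 1"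
  shows "a n = 0"
proof -
  define c where "c j = (if j \<ge> 1 then a j * ee (of_nat j * \<i>) else 0)" for j :: nat
  have "((\<lambda>j. c j * ee (of_int (int j) * of_real u)) has_sum 0) UNIV" for u
  proof -
    have "((\<lambda>j. a j * ee (of_nat j * (of_real u + \<i>))) has_sum f (of_real u + \<i>)) {1..}"
      using a by (simp add: cusp_expansion_def)
    moreover have "f (of_real u + \<i>) = 0" by (rule f) simp
    ultimately have "((\<lambda>j. a j * ee (of_nat j * (of_real u + \<i>))) has_sum 0) {1..}" by simp
    also have "?this \<longleftrightarrow> ?thesis"
      by (intro has_sum_cong_neutral) (auto simp: c_def distrib_left ee_add)
    finally show ?thesis .
  qed
  from fourier_coefficient[OF this, of "int n"]
  have "((\<lambda>u. 0 :: complex) has_integral c n) {0..1::real}" by simp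
  hence "c n = 0" using has_integral_0_eq by blast
  thus ?thesis using \<open>n \<ge> 1\<close> by (simp add: c_def)
qed

definition residue_class :: "nat \<Rightarrow> nat \<Rightarrow> int set" where
  "residue_class b s = {n. int b dvd n - int s}"

lemma residue_class_disjoint:
  assumes "s < b" "t < b" "s \<noteq> t"
  shows "residue_class b s \<inter> residue_class b t = {}"
proof -
  have False if "int b dvd n - int s" "int b dvd n - int t" for n
  proof -
    have "int b dvd (n - int t) - (n - int s)" by (rule dvd_diff[OF that(2,1)])
    hence "int b dvd int s - int t" by simp
    hence "int b \<le> \<bar>int s - int t\<bar>" using assms(3) dvd_imp_le_int[of "int s - int t" "int b"] by simp
    thus False using assms by linarith
  qed
  thus ?thesis by (auto simp: residue_class_def)
qed

lemma multiples_eq_Union_residue_classes: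
  assumes b: "b \<ge> 1" and \<beta>: "\<beta> dvd b"
  shows "{n. int \<beta> dvd n} = (\<Union>s\<in>{s. s < b \<and> \<beta> dvd s}. residue_class b s)"
proof (intro equalityI subsetI)
  fix n assume n: "n \<in> {n. int \<beta> dvd n}"
  define s where "s = nat (n mod int b)"
  have s: "int s = n mod int b" using b by (simp add: s_def)
  have "s < b" using b s pos_mod_bound[of "int b" n] by linarith
  moreover have "int \<beta> dvd int s" unfolding s using n \<beta> by (simp add: dvd_mod)
  moreover have "n \<in> residue_class b s" unfolding residue_class_def mem_Collect_eq s
    by (simp add: minus_mod_eq_mult_div)
  ultimately show "n \<in> (\<Union>s\<in>{s. s < b \<and> \<beta> dvd s}. residue_class b s)" by auto
next
  fix n assume "n \<in> (\<Union>s\<in>{s. s < b \<and> \<beta> dvd s}. residue_class b s)"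
  then obtain s where "\<beta> dvd s" "int b dvd n - int s" by (auto simp: residue_class_def)
  moreover have "int \<beta> dvd int b" using \<beta> by simp
  ultimately have "int \<beta> dvd (n - int s) + int s" by (intro dvd_add) (auto intro: dvd_trans)
  thus "n \<in> {n. int \<beta> dvd n}" by simp
qed

text \<open>
  The operator replaces \<open>\<beta> z\<close> by \<open>b z\<close>, so both series are sums of the same terms; on the left
  \<open>n\<close> runs through the multiples of \<open>\<beta>\<close>, which are a union of residue classes modulo \<open>b\<close>.
\<close>
lemma jacobi_U_eisenstein:
  assumes \<tau>: "Im \<tau> > 0" and a: "a \<ge> 1" and k: "k \<ge> 4" and b: "b \<ge> 1" and \<beta>: "\<beta> dvd b"
  shows "jacobi_U (b div \<beta>) (jacobi_eisenstein k (a * \<beta>\<^sup>2)) \<tau> z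
    = (\<Sum>s | s < b \<and> \<beta> dvd s. eis_part k a \<tau> (of_nat b * z) (residue_class b s))"
proof -
  have \<beta>1: "\<beta> \<ge> 1" using b \<beta> by (cases \<beta>) auto
  have "of_nat \<beta> * (of_nat (b div \<beta>) * z) = of_nat (\<beta> * (b div \<beta>)) * z" by simp
  also have "\<dots> = of_nat b * z" using \<beta> by (simp only: dvd_mult_div_cancel)
  finally have w: "of_nat \<beta> * (of_nat (b div \<beta>) * z) = of_nat b * z" .
  have "jacobi_U (b div \<beta>) (jacobi_eisenstein k (a * \<beta>\<^sup>2)) \<tau> z = eis_part k a \<tau> (of_nat b * z) {n. int \<beta> dvd n}"
    unfolding jacobi_U_def jacobi_eisenstein_eq_at jacobi_eisenstein_at_eq_part[OF \<tau> \<beta>1] w by simp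
  also have "\<dots> = (\<Sum>s | s < b \<and> \<beta> dvd s. eis_part k a \<tau> (of_nat b * z) (residue_class b s))"
    unfolding multiples_eq_Union_residue_classes[OF b \<beta>]
    using residue_class_disjoint by (intro eis_part_disjoint_union[OF \<tau> a k]) auto
  finally show ?thesis .
qed

text \<open>
  An Eisenstein combination is recovered from its boundary values, half of each coefficient being
  attached to \<open>s\<close> and half to \<open>- s\<close>, at which the Eisenstein series agree.
\<close>
lemma eisenstein_combination:
  assumes \<tau>: "Im \<tau> > 0" and ev: "even k" and b: "b \<ge> 1"
  shows "(\<Sum>s<b. (\<Sum>t<b. \<alpha> t * (1 / 2 * ((if int s \<in> residue_class b t then 1 else 0)
       + (if - int s \<in> residue_class b t then 1 else 0)))) * eis_part k a \<tau> w (residue_class b s))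
     = (\<Sum>s<b. \<alpha> s * eis_part k a \<tau> w (residue_class b s))"
proof -
  define E where "E s = eis_part k a \<tau> w (residue_class b s)" for s
  define neg where "neg t = (if t = 0 then 0 else b - t)" for t
  have mem: "int s \<in> residue_class b t \<longleftrightarrow> s = t" if "s < b" "t < b" for s t
  proof -
    have "int s \<in> residue_class b s" by (simp add: residue_class_def)
    thus ?thesis using residue_class_disjoint[OF that] by blast
  qed
  have neg_less: "neg t < b" if "t < b" for t using that b by (auto simp: neg_def)
  have neg_class: "residue_class b (neg t) = uminus ` residue_class b t" if "t < b" for t
  proof -
    have "int b dvd n - int (neg t) \<longleftrightarrow> int b dvd (- n) - int t" for n
    proof -
      have "int b dvd (n - int (neg t)) + ((- n) - int t)" using that by (auto simp: neg_def)
      thus ?thesis by (metis dvd_add_left_iff dvd_add_right_iff)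
    qed
    hence cls: "n \<in> residue_class b (neg t) \<longleftrightarrow> - n \<in> residue_class b t" for n
      by (simp add: residue_class_def)
    show ?thesis
    proof (intro equalityI subsetI)
      fix n assume "n \<in> residue_class b (neg t)"
      hence "- (- n) \<in> uminus ` residue_class b t" unfolding cls by (rule imageI)
      thus "n \<in> uminus ` residue_class b t" by simp
    qed (auto simp: cls)
  qed
  have mem_neg: "- int s \<in> residue_class b t \<longleftrightarrow> s = neg t" if "s < b" "t < b" for s t
  proof -
    have "- int s \<in> residue_class b t \<longleftrightarrow> int s \<in> residue_class b (neg t)"
      unfolding neg_class[OF that(2)] by force
    thus ?thesis using mem[OF that(1) neg_less[OF that(2)]] by simp
  qed
  have E_neg: "E (neg t) = E t" if "t < b" for t
    unfolding E_def neg_class[OF that] by (rule eis_part_minus[OF \<tau> ev])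
  have "(\<Sum>s<b. (\<Sum>t<b. \<alpha> t * (1 / 2 * ((if int s \<in> residue_class b t then 1 else 0)
       + (if - int s \<in> residue_class b t then 1 else 0)))) * E s)
    = (\<Sum>s<b. \<Sum>t<b. \<alpha> t * (1 / 2 * ((if s = t then E s else 0) + (if s = neg t then E s else 0))))"
    unfolding sum_distrib_right by (intro sum.cong refl) (auto simp: mem mem_neg)
  also have "\<dots> = (\<Sum>t<b. \<alpha> t * (1 / 2 * ((\<Sum>s<b. if s = t then E s else 0) + (\<Sum>s<b. if s = neg t then E s else 0))))"
    by (subst sum.swap) (simp only: sum_distrib_left sum.distrib distrib_left)
  also have "\<dots> = (\<Sum>t<b. \<alpha> t * E t)"
    using neg_less E_neg by (intro sum.cong refl) simp
  finally show ?thesis by (simp only: E_def)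
qed

text \<open>
  With \<open>g = gcd s b\<close> the slope \<open>s / b\<close> is \<open>q / p\<close> in lowest terms, \<open>p = b / g\<close>, and
  \<open>m / p\<^sup>2 = a g\<^sup>2\<close>.
\<close>
lemma fourier_jacobi_boundary_value:
  assumes ev: "even k" and f: "f \<in> cusp_forms k" and a: "cusp_expansion f a\<^sub>f"
    and fj: "fourier_jacobi_expansion (klingen_eisenstein k f) \<phi>"
    and m: "m = a * b\<^sup>2" "m \<ge> 1" and s: "s < b"
  shows "(\<lambda>n. ee (of_nat a * (of_int (int s))\<^sup>2 * (\<i> * of_real (real (Suc n)))) *
      \<phi> m (\<i> * of_real (real (Suc n))) (of_real (of_int (int s) / of_nat b) * (\<i> * of_real (real (Suc n)))))
      \<longlonglongrightarrow> a\<^sub>f (a * (gcd s b)\<^sup>2)"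
proof -
  define g where "g = gcd s b"
  have g: "g \<ge> 1" "g dvd s" "g dvd b" using s by (auto simp: g_def Suc_le_eq)
  have a1: "a \<ge> 1" using m by (cases a) auto
  obtain p q where pq: "b = p * g" "s = q * g" "coprime p q"
    using gcd_coprime_exists[of b s] s by (metis g_def gcd.commute gcd_eq_0_iff not_less0)
  have p1: "int p \<ge> 1" using s pq by (cases p) auto
  have sq: "of_nat m * of_real ((real_of_int (int s) / real b)\<^sup>2) = of_nat a * (of_int (int s) :: complex)\<^sup>2"
    using s by (simp add: m(1) power_divide)
  have "(\<lambda>n. ee (of_nat m * of_real ((real_of_int (int s) / real b)\<^sup>2) * (\<i> * of_real (real (Suc n)))) *
      \<phi> m (\<i> * of_real (real (Suc n))) (of_real (of_int (int s) / of_nat b) * (\<i> * of_real (real (Suc n)))))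
      \<longlonglongrightarrow> a\<^sub>f (a * g\<^sup>2)"
  proof (rule fourier_jacobi_limit[OF ev f a fj p1])
    show "coprime (int p) (int q)" using pq(3) by simp
    show "real_of_int (int q) = real_of_int (int p) * (real_of_int (int s) / real b)"
      using s pq g by (simp add: field_simps)
    show "0 \<le> real_of_int (int s) / real b" "real_of_int (int s) / real b \<le> 1" using s by auto
    show "a * g\<^sup>2 \<ge> 1" using a1 g by (simp add: Suc_le_eq)
    show "int m = (int p)\<^sup>2 * int (a * g\<^sup>2)" by (simp add: m(1) pq(1) power_mult_distrib)
  qed
  thus ?thesis unfolding sq g_def .
qed

theorem theorem4p4:
  fixes k :: int and f :: "complex \<Rightarrow> complex" and a\<^sub>f :: "nat \<Rightarrow> complex"
    and m a b :: nat
    and \<phi> :: "nat \<Rightarrow> complex \<Rightarrow> complex \<Rightarrow> complex"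
    and \<E> \<phi>0 :: "complex \<Rightarrow> complex \<Rightarrow> complex"
  assumes "even k"
    and "f \<in> cusp_forms k"
    and "cusp_expansion f a\<^sub>f"
    and "m \<ge> 1" and "m = a * b^2" and "squarefree a" and "b \<ge> 1"
    and "fourier_jacobi_expansion (klingen_eisenstein k f) \<phi>"
    and "\<E> \<in> jacobi_eis k m"
    and "\<phi>0 \<in> jacobi_cusp_forms k m"
    and "\<And>\<tau> z. Im \<tau> > 0 \<Longrightarrow> \<phi> m \<tau> z = \<E> \<tau> z + \<phi>0 \<tau> z"
  shows "\<forall>\<tau> z. Im \<tau> > 0 \<longrightarrow>
    \<E> \<tau> z = (\<Sum>l | 1 \<le> l \<and> l \<le> b \<and> l dvd b. a\<^sub>f (a * l^2) *
      (\<Sum>d | 1 \<le> d \<and> d \<le> b \<and> d * l dvd b.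
         of_int (moebius_mu d) *
         jacobi_U (b div (l * d)) (jacobi_eisenstein k (a * l^2 * d^2)) \<tau> z))"
proof (intro allI impI)
  fix \<tau> z :: complex assume \<tau>: "Im \<tau> > 0"
  have a1: "a \<ge> 1" using \<open>m \<ge> 1\<close> \<open>m = a * b\<^sup>2\<close> by (cases a) auto
  obtain a' b' \<alpha> where m': "m = a' * b'\<^sup>2" "squarefree a'"
    and \<alpha>: "\<And>\<tau> z. Im \<tau> > 0 \<Longrightarrow> \<E> \<tau> z = (\<Sum>s<b'. \<alpha> s * jacobi_eisenstein_at k a' b' s \<tau> z)"
    using \<open>\<E> \<in> jacobi_eis k m\<close> unfolding jacobi_eis_def by blast
  have "a * b\<^sup>2 = a' * b'\<^sup>2" "a * b\<^sup>2 \<noteq> 0"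
    using m'(1) \<open>m \<ge> 1\<close> \<open>m = a * b\<^sup>2\<close> by (metis, metis not_one_le_zero)
  from squarefree_times_square_unique[OF this \<open>squarefree a\<close> m'(2)]
  have ab: "a' = a" "b' = b" by simp_all
  have \<E>: "\<E> \<tau> z = (\<Sum>s<b. \<alpha> s * eis_part k a \<tau> (of_nat b * z) (residue_class b s))" if "Im \<tau> > 0" for \<tau> z
    using \<alpha>[OF that] jacobi_eisenstein_at_eq_part[OF that \<open>b \<ge> 1\<close>] by (simp add: ab residue_class_def)
  have divs: "{l. 1 \<le> l \<and> l \<le> b \<and> l dvd b} = {l. l dvd b}"
    "{d. 1 \<le> d \<and> d \<le> b \<and> d * l dvd b} = {d. d * l dvd b}" for l
    using \<open>b \<ge> 1\<close> by (auto dest: dvd_imp_le dvd_mult_left intro: Suc_leI Nat.gr0I)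
  show "\<E> \<tau> z = (\<Sum>l | 1 \<le> l \<and> l \<le> b \<and> l dvd b. a\<^sub>f (a * l^2) *
      (\<Sum>d | 1 \<le> d \<and> d \<le> b \<and> d * l dvd b.
         of_int (moebius_mu d) *
         jacobi_U (b div (l * d)) (jacobi_eisenstein k (a * l^2 * d^2)) \<tau> z))"
  proof (cases "k \<ge> 4")
    case False
    hence k2: "k \<le> 2" using \<open>even k\<close> by (cases "k = 3") auto
    have f0: "f \<tau> = 0" if "Im \<tau> > 0" for \<tau>
      using cusp_forms_small_weight[OF \<open>f \<in> cusp_forms k\<close> _ that] k2 by simp
    have "a\<^sub>f (a * l\<^sup>2) = 0" if "l dvd b" for l
    proof (rule cusp_expansion_zero[OF \<open>cusp_expansion f a\<^sub>f\<close> f0])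
      have "l \<ge> 1" using that \<open>b \<ge> 1\<close> by (cases l) auto
      thus "a * l\<^sup>2 \<ge> 1" using a1 by (simp add: Suc_le_eq)
    qed
    moreover have "eis_part k a \<tau> (of_nat b * z) (residue_class b s) = 0" for s
      unfolding eis_part_def residue_class_def
      using not_summable_eis_term[OF \<tau> k2 \<open>b \<ge> 1\<close>] by (simp add: infsum_not_exists)
    ultimately show ?thesis unfolding \<E>[OF \<tau>] divs by simp
  next
    case True
    have boundary: "(\<Sum>t<b. \<alpha> t * (1 / 2 * ((if int s \<in> residue_class b t then 1 else 0)
       + (if - int s \<in> residue_class b t then 1 else 0)))) = a\<^sub>f (a * (gcd s b)\<^sup>2)" if s: "s < b" for s
    proof -
      define T where "T n = \<i> * complex_of_real (real (Suc n))" for n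
      define e where "e n = ee (of_nat a * (of_int (int s))\<^sup>2 * T n)" for n
      define Z where "Z n = complex_of_real (of_int (int s) / of_nat b) * T n" for n
      have T: "Im (T n) > 0" for n by (simp add: T_def)
      have bZ: "of_nat b * Z n = of_int (int s) * T n" for n using s by (simp add: Z_def)
      have 1: "(\<lambda>n. e n * \<phi> m (T n) (Z n)) \<longlonglongrightarrow> a\<^sub>f (a * (gcd s b)\<^sup>2)"
        unfolding e_def T_def Z_def
        by (rule fourier_jacobi_boundary_value[OF assms(1-3,8,5,4) s])
      have 2: "(\<lambda>n. e n * \<phi>0 (T n) (Z n)) \<longlonglongrightarrow> 0"
        unfolding e_def T_def Z_def
        by (rule jacobi_cusp_form_limit[OF assms(10,5,4)])
      have "(\<lambda>n. e n * \<phi> m (T n) (Z n) - e n * \<phi>0 (T n) (Z n)) \<longlonglongrightarrow> a\<^sub>f (a * (gcd s b)\<^sup>2) - 0"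
        by (rule tendsto_diff[OF 1 2])
      moreover have "e n * \<phi> m (T n) (Z n) - e n * \<phi>0 (T n) (Z n)
          = (\<Sum>t<b. \<alpha> t * (e n * eis_part k a (T n) (of_int (int s) * T n) (residue_class b t)))" for n
        using assms(11)[OF T, of n "Z n"] \<E>[OF T, of n "Z n"] bZ[of n]
        by (simp add: algebra_simps sum_distrib_left)
      ultimately have lim: "(\<lambda>n. \<Sum>t<b. \<alpha> t * (e n * eis_part k a (T n) (of_int (int s) * T n) (residue_class b t)))
          \<longlonglongrightarrow> a\<^sub>f (a * (gcd s b)\<^sup>2)" by simp
      have "(\<lambda>n. \<Sum>t<b. \<alpha> t * (e n * eis_part k a (T n) (of_int (int s) * T n) (residue_class b t)))
          \<longlonglongrightarrow> (\<Sum>t<b. \<alpha> t * (1 / 2 * ((if int s \<in> residue_class b t then 1 else 0)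
       + (if - int s \<in> residue_class b t then 1 else 0))))"
        unfolding e_def T_def
        by (intro tendsto_sum tendsto_mult_left eis_part_limit[OF a1 True \<open>even k\<close>])
      from LIMSEQ_unique[OF this lim] show ?thesis .
    qed
    have U: "jacobi_U (b div (l * d)) (jacobi_eisenstein k (a * l\<^sup>2 * d\<^sup>2)) \<tau> z
        = (\<Sum>s | s < b \<and> d * l dvd s. eis_part k a \<tau> (of_nat b * z) (residue_class b s))"
      if "d * l dvd b" for l d
      using jacobi_U_eisenstein[OF \<tau> a1 True \<open>b \<ge> 1\<close> that, of z]
      by (simp add: power_mult_distrib mult_ac)
    have "\<E> \<tau> z = (\<Sum>s<b. a\<^sub>f (a * (gcd s b)\<^sup>2) * eis_part k a \<tau> (of_nat b * z) (residue_class b s))"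
      unfolding \<E>[OF \<tau>] eisenstein_combination[OF \<tau> \<open>even k\<close> \<open>b \<ge> 1\<close>, of \<alpha>, symmetric]
      by (intro sum.cong refl) (simp only: boundary lessThan_iff)
    also have "\<dots> = (\<Sum>l | l dvd b. a\<^sub>f (a * l\<^sup>2) * (\<Sum>d | d * l dvd b. of_int (moebius_mu d) *
        (\<Sum>s | s < b \<and> d * l dvd s. eis_part k a \<tau> (of_nat b * z) (residue_class b s))))"
      by (rule moebius_inversion_gcd[OF \<open>b \<ge> 1\<close>, symmetric])
    also have "\<dots> = (\<Sum>l | l dvd b. a\<^sub>f (a * l\<^sup>2) * (\<Sum>d | d * l dvd b. of_int (moebius_mu d) *
        jacobi_U (b div (l * d)) (jacobi_eisenstein k (a * l^2 * d^2)) \<tau> z))"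
      by (intro sum.cong refl arg_cong2[where f = "(*)"]) (simp only: U mem_Collect_eq)
    finally show ?thesis unfolding divs .
  qed
qed

end
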